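(* For any $\alpha>1$ the spectrum of $L_\alpha=-\Delta+\alpha^2\partial_\theta^2$ (on the unit disk $\mathbf{B}\subset\mathbb{R}^2$ with Dirichlet boundary conditions) is unbounded from above and below. Moreover, there exists an unbounded sequence $(\alpha_n)_{n\in\mathbb{N}}\subset(1,\infty)$ such that the following properties hold for every $n\in\mathbb{N}$: (i) The spectrum of $L_{\alpha_n}$ consists of eigenvalues with finite multiplicity. (ii) There exists $c_n>0$ such that for each $\ell\in\mathbb{N}_0$, $k\in\mathbb{N}$ we either have $j_{\ell,k}^2-\alpha_n^2\ell^2=0$ or $$|j_{\ell,k}^2-\alpha_n^2\ell^2|\ge c_n\, j_{\ell,k}.$$ (iii) The spectrum of $L_{\alpha_n}$ has no finite accumulation points.
   Context: $\mathbb{N}=\{1,2,\dots\}$, $\mathbb{N}_0=\mathbb{N}\cup\{0\}$. $\mathbf{B}\subset\mathbb{R}^2$ is the open unit disk, $(r,\theta)$ are polar coordinates and $\partial_\theta=x_1\partial_{x_2}-x_2\partial_{x_1}$ is the angular derivative. For $\nu\ge 0$ and $k\in\mathbb{N}$, $j_{\nu,k}$ denotes the $k$-th positive zero of the Bessel function of the first kind $J_\nu$. The Dirichlet eigenfunctions of $-\Delta$ on $\mathbf{B}$, $\varphi_{\ell,k}(r,\theta)=A_{\ell,k}\cos(\ell\theta)J_\ell(j_{\ell,k}r)$ ($\ell\in\mathbb{N}_0$, $k\in\mathbb{N}$) and $\psi_{\ell,k}(r,\theta)=B_{\ell,k}\sin(\ell\theta)J_\ell(j_{\ell,k}r)$ ($\ell,k\in\mathbb{N}$),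 with constants $A_{\ell,k},B_{\ell,k}>0$ normalizing them in $L^2(\mathbf{B})$, form an orthonormal basis of $L^2(\mathbf{B})$. The operator $L_\alpha=-\Delta+\alpha^2\partial_\theta^2$ with Dirichlet boundary conditions is understood as the self-adjoint operator in $L^2(\mathbf{B})$ that is diagonal in this basis, with $L_\alpha\varphi_{\ell,k}=(j_{\ell,k}^2-\alpha^2\ell^2)\varphi_{\ell,k}$ and $L_\alpha\psi_{\ell,k}=(j_{\ell,k}^2-\alpha^2\ell^2)\psi_{\ell,k}$; its Dirichlet eigenvalues are the numbers $j_{\ell,k}^2-\alpha^2\ell^2$, $\ell\in\mathbb{N}_0$, $k\in\mathbb{N}$. *)

theory Defs
  imports "HOL-Analysis.Analysis"
begin

text \<open>
  Power series of the Bessel function of the first kind, for \<open>\<nu> \<ge> 0\<close> and \<open>x \<ge> 0\<close>. The case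
  distinction makes up for \<open>0 powr 0 = 0\<close>, so that \<open>J\<^sub>0(0) = 1\<close>.
\<close>

definition Bessel_J :: "real \<Rightarrow> real \<Rightarrow> real" where
  "Bessel_J \<nu> x = (if \<nu> = 0 then 1 else (x / 2) powr \<nu>) *
     (\<Sum>m. (-1) ^ m / (fact m * Gamma (\<nu> + real m + 1)) * (x / 2) ^ (2 * m))"

text \<open>The \<open>k\<close>-th positive zero; meaningful for \<open>k \<ge> 1\<close> only.\<close>

definition Bessel_zero :: "real \<Rightarrow> nat \<Rightarrow> real" where
  "Bessel_zero \<nu> k =
     (THE x. x > 0 \<and> Bessel_J \<nu> x = 0 \<and> card {y. 0 < y \<and> y \<le> x \<and> Bessel_J \<nu> y = 0} = k)"


text \<open>
  \<open>L\<^sup>2\<close> of the unit disk, as a space of complex-valued functions; almost everywhere equal functions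
  are not identified, so all notions below are formulated up to null sets.
\<close>

abbreviation disk :: "(real ^ 2) measure" where
  "disk \<equiv> lebesgue_on (ball 0 1)"

definition L2 :: "(real ^ 2 \<Rightarrow> complex) set" where
  "L2 = {f \<in> borel_measurable disk. integrable disk (\<lambda>x. (cmod (f x))\<^sup>2)}"

definition L2_inner :: "(real ^ 2 \<Rightarrow> complex) \<Rightarrow> (real ^ 2 \<Rightarrow> complex) \<Rightarrow> complex" where
  "L2_inner f g = (LINT x|disk. f x * cnj (g x))"

definition L2_norm :: "(real ^ 2 \<Rightarrow> complex) \<Rightarrow> real" where
  "L2_norm f = sqrt (LINT x|disk. (cmod (f x))\<^sup>2)"


definition polar_angle :: "real ^ 2 \<Rightarrow> real" where
  "polar_angle x = Arg (Complex (x $ 1) (x $ 2))"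

definition phi_raw :: "nat \<Rightarrow> nat \<Rightarrow> real ^ 2 \<Rightarrow> real" where
  "phi_raw l k x = cos (real l * polar_angle x) * Bessel_J (real l) (Bessel_zero (real l) k * norm x)"

definition psi_raw :: "nat \<Rightarrow> nat \<Rightarrow> real ^ 2 \<Rightarrow> real" where
  "psi_raw l k x = sin (real l * polar_angle x) * Bessel_J (real l) (Bessel_zero (real l) k * norm x)"

definition phi :: "nat \<Rightarrow> nat \<Rightarrow> real ^ 2 \<Rightarrow> complex" where
  "phi l k x = complex_of_real (phi_raw l k x / sqrt (LINT y|disk. (phi_raw l k y)\<^sup>2))"

definition psi :: "nat \<Rightarrow> nat \<Rightarrow> real ^ 2 \<Rightarrow> complex" where
  "psi l k x = complex_of_real (psi_raw l k x / sqrt (LINT y|disk. (psi_raw l k y)\<^sup>2))"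

datatype mode = Phi nat nat | Psi nat nat

definition modes :: "mode set" where
  "modes = {Phi l k | l k. k \<ge> 1} \<union> {Psi l k | l k. l \<ge> 1 \<and> k \<ge> 1}"

fun eigenfun :: "mode \<Rightarrow> real ^ 2 \<Rightarrow> complex" where
  "eigenfun (Phi l k) = phi l k"
| "eigenfun (Psi l k) = psi l k"

definition L_eigenvalue :: "real \<Rightarrow> nat \<Rightarrow> nat \<Rightarrow> real" where
  "L_eigenvalue \<alpha> l k = (Bessel_zero (real l) k)\<^sup>2 - \<alpha>\<^sup>2 * (real l)\<^sup>2"

fun mode_eigenvalue :: "real \<Rightarrow> mode \<Rightarrow> real" where
  "mode_eigenvalue \<alpha> (Phi l k) = L_eigenvalue \<alpha> l k"
| "mode_eigenvalue \<alpha> (Psi l k) = L_eigenvalue \<alpha> l k"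


text \<open>
  Unbounded operators in \<open>L\<^sup>2\<close> are given by their graphs. The operator \<open>L\<^sub>\<alpha>\<close> is the diagonal one:
  \<open>u\<close> is in the domain iff \<open>\<Sum>\<^sub>i \<lambda>\<^sub>i\<^sup>2 |\<langle>u, e\<^sub>i\<rangle>|\<^sup>2 < \<infinity>\<close>, and then \<open>L\<^sub>\<alpha> u = \<Sum>\<^sub>i \<lambda>\<^sub>i \<langle>u, e\<^sub>i\<rangle> e\<^sub>i\<close> with
  unconditional convergence in \<open>L\<^sup>2\<close>.
\<close>

type_synonym L2_operator = "((real ^ 2 \<Rightarrow> complex) \<times> (real ^ 2 \<Rightarrow> complex)) set"

definition L_domain :: "real \<Rightarrow> (real ^ 2 \<Rightarrow> complex) set" where
  "L_domain \<alpha> = {u \<in> L2.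
     (\<lambda>i. (mode_eigenvalue \<alpha> i)\<^sup>2 * (cmod (L2_inner u (eigenfun i)))\<^sup>2) summable_on modes}"

definition L_op :: "real \<Rightarrow> L2_operator" where
  "L_op \<alpha> = {(u, f). u \<in> L_domain \<alpha> \<and> f \<in> L2 \<and>
     ((\<lambda>F. L2_norm (\<lambda>x. f x -
         (\<Sum>i\<in>F. complex_of_real (mode_eigenvalue \<alpha> i) * L2_inner u (eigenfun i) * eigenfun i x)))
       \<longlongrightarrow> 0) (finite_subsets_at_top modes)}"

text \<open>\<open>z\<close> is in the resolvent set iff \<open>T - z\<close> is a bijection onto \<open>L\<^sup>2\<close> with bounded inverse.\<close>

definition resolvent_set :: "L2_operator \<Rightarrow> complex set" where
  "resolvent_set T = {z.
     (\<forall>(u, f) \<in> T. (AE x in disk. f x - z * u x = 0) \<longrightarrow> (AE x in disk. u x = 0)) \<and>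
     (\<forall>g \<in> L2. \<exists>(u, f) \<in> T. AE x in disk. f x - z * u x = g x) \<and>
     (\<exists>C. \<forall>(u, f) \<in> T. L2_norm u \<le> C * L2_norm (\<lambda>x. f x - z * u x))}"

definition spectrum :: "L2_operator \<Rightarrow> complex set" where
  "spectrum T = - resolvent_set T"

definition eigenspace :: "L2_operator \<Rightarrow> complex \<Rightarrow> (real ^ 2 \<Rightarrow> complex) set" where
  "eigenspace T z = {u. \<exists>f. (u, f) \<in> T \<and> (AE x in disk. f x = z * u x)}"

definition is_eigenvalue :: "L2_operator \<Rightarrow> complex \<Rightarrow> bool" where
  "is_eigenvalue T z \<longleftrightarrow> (\<exists>u \<in> eigenspace T z. \<not> (AE x in disk. u x = 0))"

definition finite_multiplicity :: "L2_operator \<Rightarrow> complex \<Rightarrow> bool" where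
  "finite_multiplicity T z \<longleftrightarrow>
     (\<exists>B. finite B \<and> B \<subseteq> L2 \<and>
        (\<forall>u \<in> eigenspace T z. \<exists>c. AE x in disk. u x = (\<Sum>v\<in>B. c v * v x)))"

end

theory Submission
  imports Defs "HOL-Real_Asymp.Real_Asymp"
begin

text \<open>
  Spectrally, \<open>L\<^sub>\<alpha>\<close> is governed by the zeros \<open>j\<^sub>\<ell>\<^sub>,\<^sub>k\<close> close to \<open>\<alpha> \<ell>\<close>. The Liouville--Green
  transformation turns the Bessel equation into a perturbation of \<open>W'' + W = 0\<close> in the variable
  \<open>\<zeta>\<^sub>\<ell>(x) = sqrt (x\<^sup>2 - \<ell>\<^sup>2) - \<ell> arccos (\<ell> / x)\<close>, and a Gronwall argument started at infinity gives, for
  \<open>x \<ge> a \<ell>\<close> with \<open>a > 1\<close>, \<open>(x\<^sup>2 - \<ell>\<^sup>2)\<^sup>1\<^sup>/\<^sup>4 J\<^sub>\<ell>(x) = A cos \<zeta>\<^sub>\<ell>(x) + B sin \<zeta>\<^sub>\<ell>(x) + O(1/x)\<close> uniformly in \<open>\<ell>\<close>.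
  By the recurrences \<open>A\<close> and \<open>B\<close> do not depend on \<open>\<ell>\<close>, and \<open>A \<noteq> 0\<close> because \<open>J\<^sub>0(\<pi>)\<close> is sufficiently
  negative. Since \<open>\<zeta>\<^sub>\<ell>(\<alpha> \<ell>) = \<ell> g(\<alpha>)\<close> with \<open>g = \<zeta>\<^sub>1\<close>, choosing \<open>g(\<alpha>) \<in> \<pi> \<nat>\<close> makes the leading term equal to
  \<open>\<plusminus>A\<close> at \<open>\<alpha> \<ell>\<close> for every \<open>\<ell>\<close>; hence all zeros of \<open>J\<^sub>\<ell>\<close> keep a fixed distance from \<open>\<alpha> \<ell>\<close> for large \<open>\<ell>\<close>.
  That every spectral point is an eigenvalue needs completeness of the eigenfunctions. For the radial
  factors it follows from the minimax inequality that a function orthogonal to the first \<open>n - 1\<close>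
  eigenfunctions has Rayleigh quotient at least the \<open>n\<close>-th eigenvalue, proved by completing a square
  as Jacobi did; for the disk one then uses density of the polynomials.
\<close>

section \<open>The Bessel--Clifford functions\<close>

text \<open>By j^2 - \<alpha>^2 l^2 = (j - \<alpha> l)(j + \<alpha> l), a constant lower bound on |j
  - \<alpha> l| yields one of order j on the eigenvalue. For general \<alpha> the phases l
  g(\<alpha>) can drift modulo pi as l grows, so zeros could come arbitrarily close to \<alpha> l.
  Phases that are multiples of pi stop the drift and kill the sine term, and everything then rests
  on A \<noteq> 0. Since l and x = \<alpha> l grow together, the error has to be uniform in l; hence
  Gronwall is run from infinity, where the squared moduli of all the curves share the limit A^2 +
  B^2. The series is kept in the variable y = x^2/4: J_l(x) = (x/2)^l C_l(x^2/4) with C_l entire.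
  Differentiation then merely shifts the index, and on the disk J_l(j r) is r^l times a smooth
  function of r^2, so that an eigenfunction is the real or imaginary part of z^l times such a
  function. Integrals over the disk thereby reduce to rotation invariance and the distribution of
  r^2.\<close>

definition clifford :: "nat \<Rightarrow> real \<Rightarrow> real" where
  "clifford l y = (\<Sum>m. (-1) ^ m / (fact m * fact (l + m)) * y ^ m)"

lemma summable_clifford: "summable (\<lambda>m. (-1) ^ m / (fact m * fact (l + m)) * (y::real) ^ m)"
proof (rule summable_comparison_test')
  show "summable (\<lambda>m. inverse (fact m) * \<bar>y\<bar> ^ m)"
    using summable_exp[of "\<bar>y\<bar>"] by simp
  show "norm ((-1) ^ m / (fact m * fact (l + m)) * y ^ m) \<le> inverse (fact m) * \<bar>y\<bar> ^ m"
    if "m \<ge> 0" for m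
  proof -
    have "(1::real) / (fact m * fact (l + m)) \<le> 1 / fact m"
      using fact_ge_1[of "l+m", where 'a=real] by (intro divide_left_mono) (auto simp: mult_le_cancel_left1)
    then show ?thesis
      by (auto simp: abs_mult power_abs divide_inverse intro!: mult_left_le_one_le)
  qed
qed

lemma clifford_sums: "(\<lambda>m. (-1) ^ m / (fact m * fact (l + m)) * y ^ m) sums clifford l y"
  unfolding clifford_def using summable_clifford by (rule summable_sums)

lemma clifford_0 [simp]: "clifford l 0 = 1 / fact l"
proof -
  have "(\<lambda>m. (-1) ^ m / (fact m * fact (l + m)) * (0::real) ^ m) sums ((-1) ^ 0 / (fact 0 * fact (l + 0)))"
    by (rule powser_sums_zero)
  then show ?thesis using clifford_sums[of l 0] sums_unique2 by fastforce
qed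

lemma clifford_has_real_derivative [derivative_intros]:
  assumes "(f has_real_derivative f') (at x within S)"
  shows "((\<lambda>x. clifford l (f x)) has_real_derivative (- clifford (Suc l) (f x) * f')) (at x within S)"
proof -
  have "DERIV (clifford l) y :> - clifford (Suc l) y" for y
  proof -
    let ?c = "\<lambda>m. (-1) ^ m / (fact m * fact (l + m)) :: real"
    have "DERIV (\<lambda>x. \<Sum>n. ?c n * x ^ n) y :> (\<Sum>n. diffs ?c n * y ^ n)"
      by (rule termdiffs_strong_converges_everywhere) (rule summable_clifford)
    moreover have "diffs ?c n * y ^ n = - ((-1) ^ n / (fact n * fact (Suc l + n)) * y ^ n)" for n
      by (simp add: diffs_def divide_simps)
    moreover have "(\<Sum>n. - ((-1) ^ n / (fact n * fact (Suc l + n)) * y ^ n)) = - clifford (Suc l) y"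
      using suminf_minus[OF summable_clifford[of "Suc l" y]] by (simp add: clifford_def)
    ultimately show ?thesis
      unfolding clifford_def[of l, abs_def] by simp
  qed
  from DERIV_chain2[OF this assms] show ?thesis .
qed

lemma continuous_on_clifford [continuous_intros]:
  assumes "continuous_on S f"
  shows "continuous_on S (\<lambda>x. clifford l (f x))"
proof -
  have "continuous_on UNIV (clifford l)"
    by (rule DERIV_continuous_on[where D="\<lambda>x. - clifford (Suc l) x * 1"])
       (rule clifford_has_real_derivative[OF DERIV_ident])
  then show ?thesis
    using continuous_on_compose2[OF _ assms] by blast
qed

text \<open>Comparison of the coefficients of y^m. This is the recurrence J_l + J_{l+2} = (2(l+1)/x)
  J_{l+1}; as \<open>clifford l\<close> has derivative \<open>- clifford (Suc l)\<close>, it is also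
  the Bessel equation y C'' + (l+1) C' + C = 0.\<close>

lemma clifford_rec: "clifford l y = (real l + 1) * clifford (Suc l) y - y * clifford (Suc (Suc l)) y"
proof -
  let ?c = "\<lambda>l m. (-1) ^ m / (fact m * fact (l + m)) * y ^ m :: real"
  \<comment> \<open>The series of y C_{l+2}(y), padded with a zero at index 0 so that all three
    series carry the same power of y at the same index.\<close>
  let ?d = "\<lambda>m. if m = 0 then 0 else y * ?c (l+2) (m - 1)"
  have "?d sums (y * clifford (l+2) y)"
    using sums_mult[OF clifford_sums[of "l+2" y], of y] sums_Suc_iff[of ?d "y * clifford (l+2) y"]
    by simp
  moreover have "(\<lambda>m. (real l + 1) * ?c (Suc l) m) sums ((real l + 1) * clifford (Suc l) y)"
    by (intro sums_mult clifford_sums)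
  ultimately have "(\<lambda>m. (real l + 1) * ?c (Suc l) m - ?d m) sums ((real l + 1) * clifford (Suc l) y - y * clifford (l+2) y)"
    by (rule sums_diff[rotated])
  moreover have "(real l + 1) * ?c (Suc l) m - ?d m = ?c l m" for m
  proof (cases m)
    case 0
    have "fact (Suc l) = (real l + 1) * fact l" "real l + 1 \<noteq> 0" by (simp_all add: algebra_simps)
    with 0 show ?thesis by (simp del: fact_Suc)
  next
    case (Suc k)
    have f: "fact (Suc l + m) = (real l + real m + 1) * fact (l + m)" "fact (l + 2 + k) = (real l + real m + 1) * fact (l + m)"
      "fact m = real m * fact k"
      using Suc by (simp_all add: algebra_simps)
    have nz: "real l + real m + 1 \<noteq> 0" "real m \<noteq> 0" using Suc by auto
    show ?thesis unfolding f using Suc nz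
      by (simp only: f) (simp add: divide_simps, simp add: algebra_simps)
  qed
  ultimately have "?c l sums ((real l + 1) * clifford (Suc l) y - y * clifford (l+2) y)" by simp
  then show ?thesis using clifford_sums[of l y] sums_unique2 by fastforce
qed

lemma Bessel_J_clifford:
  assumes "x \<ge> 0"
  shows "Bessel_J (real l) x = (x / 2) ^ l * clifford l (x\<^sup>2 / 4)"
proof -
  have "(-1) ^ m / (fact m * Gamma (real l + real m + 1)) * (x / 2) ^ (2 * m)
      = (-1) ^ m / (fact m * fact (l + m)) * (x\<^sup>2 / 4) ^ m" for m
  proof -
    have "Gamma (real l + real m + 1) = fact (l + m)"
      using Gamma_fact[of "l+m", where 'a=real] by (simp add: add_ac)
    moreover have "(x / 2) ^ (2 * m) = (x\<^sup>2 / 4) ^ m"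
      by (simp add: power_mult power_divide)
    ultimately show ?thesis by simp
  qed
  moreover have "(if real l = 0 then 1 else (x / 2) powr real l) = (x / 2) ^ l"
    using assms by (cases "x = 0") (auto simp: powr_realpow power_0_left)
  ultimately show ?thesis
    unfolding Bessel_J_def clifford_def by simp
qed

text \<open>By \<open>clifford_rec\<close> the derivative of this energy collapses to -(2l+1)
  C_{l+1}^2. It is the source of J_0^2 + J_1^2 \<le> 1, of upper bounds for the functions
  themselves, and of the simplicity of their zeros.\<close>

lemma clifford_energy_antimono:
  assumes "0 \<le> x" "x \<le> y"
  shows "(clifford l y)\<^sup>2 + y * (clifford (Suc l) y)\<^sup>2 \<le> (clifford l x)\<^sup>2 + x * (clifford (Suc l) x)\<^sup>2"
proof (rule DERIV_nonpos_imp_nonincreasing[OF assms(2)])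
  fix t assume t: "x \<le> t" "t \<le> y"
  let ?D = "- (2 * real l + 1) * (clifford (Suc l) t)\<^sup>2"
  have "((\<lambda>t. (clifford l t)\<^sup>2 + t * (clifford (Suc l) t)\<^sup>2) has_real_derivative ?D) (at t)"
    by (rule derivative_eq_intros refl)+
       (simp add: clifford_rec[of l t] algebra_simps power2_eq_square)
  then show "\<exists>D. ((\<lambda>t. (clifford l t)\<^sup>2 + t * (clifford (Suc l) t)\<^sup>2) has_real_derivative D) (at t) \<and> D \<le> 0"
    by (intro exI[of _ ?D] conjI mult_nonpos_nonneg) auto
qed

section \<open>The Liouville--Green transformation of the Bessel equation\<close>

text \<open>J_n for integer order with an ordinary power in place of \<open>powr\<close>: smooth on
  the whole line and equal to \<open>Bessel_J\<close> for x \<ge> 0.\<close>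

definition bessel :: "nat \<Rightarrow> real \<Rightarrow> real" where
  "bessel n x = (x / 2) ^ n * clifford n (x\<^sup>2 / 4)"

lemma bessel_rec:
  assumes "x \<noteq> 0"
  shows "bessel (Suc (Suc n)) x = 2 * (real n + 1) / x * bessel (Suc n) x - bessel n x"
proof -
  define p c1 c2 where "p = (x / 2) ^ n" and "c1 = clifford (Suc n) (x\<^sup>2 / 4)" and "c2 = clifford (Suc (Suc n)) (x\<^sup>2 / 4)"
  have e0: "bessel n x = p * ((real n + 1) * c1 - x\<^sup>2 / 4 * c2)"
    unfolding bessel_def p_def c1_def c2_def using clifford_rec[of n "x\<^sup>2 / 4"] by simp
  have e1: "bessel (Suc n) x = p * (x / 2) * c1" and e2: "bessel (Suc (Suc n)) x = p * (x / 2) * (x / 2) * c2"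
    by (simp_all add: bessel_def p_def c1_def c2_def)
  show ?thesis
    unfolding e0 e1 e2 using assms by (simp add: field_simps power2_eq_square)
qed

lemma DERIV_bessel:
  assumes "x > 0"
  shows "(bessel n has_real_derivative (real n / x * bessel n x - bessel (Suc n) x)) (at x)"
proof -
  have *: "real n * (x / 2) ^ (n - Suc 0) * (1/2) = real n / x * (x / 2) ^ n"
    using assms by (cases n) (auto simp: field_simps)
  have "((\<lambda>x. (x / 2) ^ n * clifford n (x\<^sup>2 / 4)) has_real_derivative
     (real n * (x / 2) ^ (n - Suc 0) * (1/2)) * clifford n (x\<^sup>2 / 4) + (- clifford (Suc n) (x\<^sup>2 / 4) * (x / 2)) * (x / 2) ^ n) (at x)"
    by (rule derivative_eq_intros refl | simp)+
  then have "((\<lambda>x. (x / 2) ^ n * clifford n (x\<^sup>2 / 4)) has_real_derivative (real n / x * bessel n x - bessel (Suc n) x)) (at x)"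
    unfolding * by (simp add: bessel_def algebra_simps)
  then show ?thesis by (simp add: bessel_def[abs_def])
qed

text \<open>Together with \<open>DERIV_bessel\<close> this is a closed first-order system for (J_n,
  J_{n+1}), which stands in for the second-order equation in the Liouville--Green
  computation.\<close>

lemma DERIV_bessel_Suc:
  assumes "x > 0"
  shows "(bessel (Suc n) has_real_derivative (bessel n x - (real n + 1) / x * bessel (Suc n) x)) (at x)"
proof -
  have "real (Suc n) / x * bessel (Suc n) x - bessel (Suc (Suc n)) x = bessel n x - (real n + 1) / x * bessel (Suc n) x"
    using assms by (simp add: bessel_rec field_simps)
  with DERIV_bessel[OF assms, of "Suc n"] show ?thesis by simp
qed

text \<open>
  Up to the factor \<open>lg_r = (x\<^sup>2 - n\<^sup>2)\<^sup>1\<^sup>/\<^sup>4\<close>, \<open>lg_W\<close> is the Bessel function, and \<open>lg_V\<close> is its derivative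
  with respect to \<open>lg_zeta\<close>. Rotating \<open>(lg_W, lg_V)\<close> by the angle \<open>lg_zeta\<close> gives the curve
  \<open>(lg_P, lg_R)\<close>, which moves only because of the perturbation \<open>lg_q\<close>.
\<close>

definition lg_r :: "nat \<Rightarrow> real \<Rightarrow> real" where
  "lg_r n x = sqrt (sqrt (x\<^sup>2 - (real n)\<^sup>2))"

definition lg_zeta :: "nat \<Rightarrow> real \<Rightarrow> real" where
  "lg_zeta n x = sqrt (x\<^sup>2 - (real n)\<^sup>2) - real n * arccos (real n / x)"

definition lg_W :: "nat \<Rightarrow> real \<Rightarrow> real" where
  "lg_W n x = lg_r n x * bessel n x"

definition lg_V :: "nat \<Rightarrow> real \<Rightarrow> real" where
  "lg_V n x = (x\<^sup>2 / (2 * lg_r n x ^ 5) + real n / lg_r n x) * bessel n x - x / lg_r n x * bessel (Suc n) x"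

definition lg_P :: "nat \<Rightarrow> real \<Rightarrow> real" where
  "lg_P n x = lg_W n x * cos (lg_zeta n x) - lg_V n x * sin (lg_zeta n x)"

definition lg_R :: "nat \<Rightarrow> real \<Rightarrow> real" where
  "lg_R n x = lg_W n x * sin (lg_zeta n x) + lg_V n x * cos (lg_zeta n x)"

text \<open>In the variable \<open>lg_zeta\<close> the Bessel equation reads W'' + (1 + x
  \<open>lg_q\<close> / \<open>lg_r\<close>^2) W = 0. Since \<open>lg_r\<close>^10 = (x^2 -
  n^2)^(5/2), \<open>lg_q\<close> is O(1/x^2), hence integrable, as long as x / n stays away from
  the turning point 1.\<close>

definition lg_q :: "nat \<Rightarrow> real \<Rightarrow> real" where
  "lg_q n x = x * (x\<^sup>2 + 4 * (real n)\<^sup>2) / (4 * lg_r n x ^ 10)"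

lemma lg_W_eq: "lg_W n x = lg_P n x * cos (lg_zeta n x) + lg_R n x * sin (lg_zeta n x)"
proof -
  have "lg_P n x * cos (lg_zeta n x) + lg_R n x * sin (lg_zeta n x)
      = lg_W n x * ((cos (lg_zeta n x))\<^sup>2 + (sin (lg_zeta n x))\<^sup>2)"
    unfolding lg_P_def lg_R_def by algebra
  then show ?thesis by simp
qed

lemma lg_norm: "(lg_P n x)\<^sup>2 + (lg_R n x)\<^sup>2 = (lg_W n x)\<^sup>2 + (lg_V n x)\<^sup>2"
proof -
  have "(lg_P n x)\<^sup>2 + (lg_R n x)\<^sup>2
     = ((lg_W n x)\<^sup>2 + (lg_V n x)\<^sup>2) * ((cos (lg_zeta n x))\<^sup>2 + (sin (lg_zeta n x))\<^sup>2)"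
    unfolding lg_P_def lg_R_def by algebra
  then show ?thesis by simp
qed

context
  fixes n :: nat and x :: real
  assumes xn: "x > real n"
begin

lemma lg_x_pos: "x > 0" using xn by (meson le_less_trans of_nat_0_le_iff)

lemma lg_arg_pos: "x\<^sup>2 - (real n)\<^sup>2 > 0"
  using xn by (simp add: power_strict_mono)

lemma lg_r_pos: "lg_r n x > 0"
  using lg_arg_pos by (simp add: lg_r_def)

lemma lg_r_sq: "lg_r n x ^ 2 = sqrt (x\<^sup>2 - (real n)\<^sup>2)"
  using lg_arg_pos by (simp add: lg_r_def)

lemma lg_r_pow4: "lg_r n x ^ 4 = x\<^sup>2 - (real n)\<^sup>2"
proof -
  have "lg_r n x ^ 4 = (lg_r n x ^ 2) ^ 2" by simp
  then show ?thesis unfolding lg_r_sq using lg_arg_pos by simp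
qed

lemma DERIV_lg_r: "(lg_r n has_real_derivative x / (2 * lg_r n x ^ 3)) (at x)"
proof -
  have "((\<lambda>x. sqrt (sqrt (x\<^sup>2 - (real n)\<^sup>2))) has_real_derivative
      2 * x * (inverse (sqrt (x\<^sup>2 - (real n)\<^sup>2)) / 2) * (inverse (sqrt (sqrt (x\<^sup>2 - (real n)\<^sup>2))) / 2)) (at x)"
    using lg_arg_pos by (auto intro!: derivative_eq_intros)
  moreover have "2 * x * (inverse (sqrt (x\<^sup>2 - (real n)\<^sup>2)) / 2) * (inverse (sqrt (sqrt (x\<^sup>2 - (real n)\<^sup>2))) / 2)
     = x / (2 * lg_r n x ^ 3)" (is "?a = ?b")
    unfolding lg_r_sq[symmetric] lg_r_def[symmetric] using lg_r_pos
    by (simp add: divide_simps power2_eq_square power3_eq_cube)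
  ultimately show ?thesis unfolding lg_r_def[abs_def] by (rule back_subst)
qed

lemma DERIV_lg_zeta: "(lg_zeta n has_real_derivative lg_r n x ^ 2 / x) (at x)"
proof -
  let ?s = "sqrt (x\<^sup>2 - (real n)\<^sup>2)"
  have x: "x > 0" by (rule lg_x_pos)
  have s: "?s > 0" "?s ^ 2 = x\<^sup>2 - (real n)\<^sup>2" using lg_arg_pos by auto
  have q: "-1 < real n / x" "real n / x < 1" using xn x by (auto simp: divide_simps)
  have "1 - (real n / x)\<^sup>2 = (?s / x)\<^sup>2"
    unfolding power_divide s(2) using x by (simp add: diff_divide_distrib)
  then have sq: "sqrt (1 - (real n / x)\<^sup>2) = ?s / x"
    using x s(1) by (intro real_sqrt_unique) (simp_all add: less_imp_le)
  have "((\<lambda>x. sqrt (x\<^sup>2 - (real n)\<^sup>2) - real n * arccos (real n / x)) has_real_derivative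
     2 * x * (inverse ?s / 2) - real n * (inverse (- sqrt (1 - (real n / x)\<^sup>2)) * (- real n / x\<^sup>2))) (at x)"
    using lg_arg_pos q x by (auto intro!: derivative_eq_intros simp: power2_eq_square)
  moreover have "2 * x * (inverse ?s / 2) - real n * (inverse (- sqrt (1 - (real n / x)\<^sup>2)) * (- real n / x\<^sup>2))
      = lg_r n x ^ 2 / x"
  proof -
    have "2 * x * (inverse s / 2) - real n * (inverse (- (s/x)) * (- real n / x\<^sup>2)) = s / x"
      if "s > 0" "s ^ 2 = x\<^sup>2 - (real n)\<^sup>2" for s
    proof -
      have "2 * x * (inverse s / 2) - real n * (inverse (- (s/x)) * (- real n / x\<^sup>2)) = (x\<^sup>2 - (real n)\<^sup>2) / (x * s)"
        using x that(1) by (simp add: field_simps power2_eq_square)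
      also have "\<dots> = s / x" using that(1) x unfolding that(2)[symmetric] by (simp add: power2_eq_square)
      finally show ?thesis .
    qed
    from this[OF s] show ?thesis unfolding sq lg_r_sq .
  qed
  ultimately show ?thesis by (simp add: lg_zeta_def[abs_def])
qed

lemma DERIV_lg_W: "(lg_W n has_real_derivative lg_r n x ^ 2 / x * lg_V n x) (at x)"
proof -
  have x: "x > 0" by (rule lg_x_pos)
  have "((\<lambda>x. lg_r n x * bessel n x) has_real_derivative
    (x / (2 * lg_r n x ^ 3)) * bessel n x + (real n / x * bessel n x - bessel (Suc n) x) * lg_r n x) (at x)"
    by (rule derivative_eq_intros DERIV_lg_r DERIV_bessel[OF x] refl)+
  moreover have "(x / (2 * lg_r n x ^ 3)) * bessel n x + (real n / x * bessel n x - bessel (Suc n) x) * lg_r n x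
     = lg_r n x ^ 2 / x * lg_V n x"
    unfolding lg_V_def using lg_r_pos x by (simp add: field_simps power_numeral_reduce)
  ultimately show ?thesis by (simp add: lg_W_def[abs_def])
qed

text \<open>Substituting the first-order system leaves a combination of J_n and J_{n+1}. The form of
  \<open>lg_V\<close> makes the coefficient of J_{n+1} vanish; that of J_n splits into the main term
  and \<open>lg_q\<close>.\<close>

lemma DERIV_lg_V:
  "(lg_V n has_real_derivative - (lg_r n x ^ 2 / x + lg_q n x) * lg_W n x) (at x)"
proof -
  have x: "x > 0" by (rule lg_x_pos)
  note r = lg_r_pos
  let ?r = "lg_r n x" let ?J = "bessel n x" let ?K = "bessel (Suc n) x"
  let ?r' = "x / (2 * ?r ^ 3)"
  let ?A = "x\<^sup>2 / (2 * ?r ^ 5) + real n / ?r"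
  let ?A' = "x / ?r ^ 5 - 5/2 * x\<^sup>2 / ?r ^ 6 * ?r' - real n / ?r ^ 2 * ?r'"
  let ?B' = "1 / ?r - x / ?r ^ 2 * ?r'"
  have A: "((\<lambda>x. x\<^sup>2 / (2 * lg_r n x ^ 5) + real n / lg_r n x) has_real_derivative ?A') (at x)"
    using r by (auto intro!: derivative_eq_intros DERIV_lg_r simp: field_simps power_numeral_reduce)
  have B: "((\<lambda>x. x / lg_r n x) has_real_derivative ?B') (at x)"
    using r by (auto intro!: derivative_eq_intros DERIV_lg_r simp: field_simps power_numeral_reduce)
  have "((\<lambda>x. (x\<^sup>2 / (2 * lg_r n x ^ 5) + real n / lg_r n x) * bessel n x - x / lg_r n x * bessel (Suc n) x) has_real_derivative
    (?A' * ?J + (real n / x * ?J - ?K) * ?A) - (?B' * ?K + (?J - (real n + 1) / x * ?K) * (x / ?r))) (at x)"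
    by (rule derivative_eq_intros A B DERIV_bessel[OF x] DERIV_bessel_Suc[OF x] refl)+
  moreover have "(?A' * ?J + (real n / x * ?J - ?K) * ?A) - (?B' * ?K + (?J - (real n + 1) / x * ?K) * (x / ?r))
    = - (?r ^ 2 / x + lg_q n x) * lg_W n x"
  proof -
    have gen: "(A' * J + (N * J - K) * A) - (B' * K + (J - M * K) * C) = (A' + N * A - C) * J - (A + B' - M * C) * K"
      for A A' B' C J K N M :: real by algebra
    have "(?A' * ?J + (real n / x * ?J - ?K) * ?A) - (?B' * ?K + (?J - (real n + 1) / x * ?K) * (x / ?r))
       = (?A' + real n / x * ?A - x / ?r) * ?J - (?A + ?B' - (real n + 1) / x * (x / ?r)) * ?K"
      by (rule gen)
    also have "?A + ?B' - (real n + 1) / x * (x / ?r) = 0"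
      using r x by (simp add: field_simps power_numeral_reduce)
    also have "?A' + real n / x * ?A - x / ?r = x / ?r ^ 5 - 5/4 * x ^ 3 / ?r ^ 9 + ((real n)\<^sup>2 - x\<^sup>2) / (x * ?r)"
      using r x by (simp add: field_simps power_numeral_reduce)
    also have "(real n)\<^sup>2 - x\<^sup>2 = - (?r ^ 4)" by (simp add: lg_r_pow4)
    also have "x / ?r ^ 5 - 5/4 * x ^ 3 / ?r ^ 9 = x * (4 * ?r ^ 4 - 5 * x\<^sup>2) / (4 * ?r ^ 9)"
      using r x by (simp add: field_simps power_numeral_reduce)
    also have "4 * ?r ^ 4 - 5 * x\<^sup>2 = - (x\<^sup>2 + 4 * (real n)\<^sup>2)" unfolding lg_r_pow4 by simp
    also have "(x * - (x\<^sup>2 + 4 * (real n)\<^sup>2) / (4 * ?r ^ 9) + - (?r ^ 4) / (x * ?r)) = - (?r ^ 2 / x + lg_q n x) * ?r"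
      unfolding lg_q_def using r x by (simp add: field_simps power_numeral_reduce)
    finally show ?thesis by (simp add: lg_W_def)
  qed
  ultimately show ?thesis by (simp add: lg_V_def[abs_def])
qed

lemma DERIV_lg_P:
  "(lg_P n has_real_derivative lg_q n x * lg_W n x * sin (lg_zeta n x)) (at x)"
proof -
  have "((\<lambda>x. lg_W n x * cos (lg_zeta n x) - lg_V n x * sin (lg_zeta n x)) has_real_derivative
    lg_q n x * lg_W n x * sin (lg_zeta n x)) (at x)"
    by (rule derivative_eq_intros DERIV_lg_W DERIV_lg_V DERIV_lg_zeta refl)+ (simp add: algebra_simps)
  then show ?thesis by (simp add: lg_P_def[abs_def])
qed

lemma DERIV_lg_R:
  "(lg_R n has_real_derivative - lg_q n x * lg_W n x * cos (lg_zeta n x)) (at x)"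
proof -
  have "((\<lambda>x. lg_W n x * sin (lg_zeta n x) + lg_V n x * cos (lg_zeta n x)) has_real_derivative
    - lg_q n x * lg_W n x * cos (lg_zeta n x)) (at x)"
    by (rule derivative_eq_intros DERIV_lg_W DERIV_lg_V DERIV_lg_zeta refl)+ (simp add: algebra_simps)
  then show ?thesis by (simp add: lg_R_def[abs_def])
qed

end

section \<open>Convergence of slowly moving plane curves\<close>

lemma mono_bounded_tendsto_at_top:
  fixes h :: "real \<Rightarrow> real"
  assumes mono: "\<And>x y. x0 \<le> x \<Longrightarrow> x \<le> y \<Longrightarrow> h x \<le> h y" and bd: "\<And>x. x0 \<le> x \<Longrightarrow> h x \<le> B"
  shows "\<exists>L. (h \<longlongrightarrow> L) at_top"
proof (intro exI order_tendstoI)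
  let ?L = "Sup (h ` {x0..})"
  have bdd: "bdd_above (h ` {x0..})" using bd by (auto simp: bdd_above_def)
  fix a
  show "eventually (\<lambda>x. a < h x) at_top" if less: "a < ?L"
  proof -
    have "a < Sup (h ` {x0..}) \<longleftrightarrow> (\<exists>y\<in>h ` {x0..}. a < y)"
      by (rule less_cSup_iff) (use bdd in auto)
    then obtain x1 where "x1 \<ge> x0" "a < h x1"
      using less by blast
    then show ?thesis
      using mono by (intro eventually_at_top_linorderI[of x1]) (rule less_le_trans)
  qed
  show "eventually (\<lambda>x. h x < a) at_top" if "?L < a"
  proof (rule eventually_at_top_linorderI[of x0])
    fix x assume "x0 \<le> x"
    then have "h x \<le> ?L" by (intro cSUP_upper[OF _ bdd]) simp
    with that show "h x < a" by simp
  qed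
qed

text \<open>A Gronwall argument for a plane curve whose speed is at most \<open>K / x\<^sup>2\<close> times its modulus.\<close>

locale slow_curve =
  fixes P R P' R' :: "real \<Rightarrow> real" and K x0 :: real
  assumes x0: "x0 > 0" and K: "K \<ge> 0"
    and dP: "\<And>x. x \<ge> x0 \<Longrightarrow> (P has_real_derivative P' x) (at x)"
    and dR: "\<And>x. x \<ge> x0 \<Longrightarrow> (R has_real_derivative R' x) (at x)"
    and bP: "\<And>x. x \<ge> x0 \<Longrightarrow> \<bar>P' x\<bar> \<le> K / x\<^sup>2 * sqrt ((P x)\<^sup>2 + (R x)\<^sup>2)"
    and bR: "\<And>x. x \<ge> x0 \<Longrightarrow> \<bar>R' x\<bar> \<le> K / x\<^sup>2 * sqrt ((P x)\<^sup>2 + (R x)\<^sup>2)"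
begin

definition N where "N x = (P x)\<^sup>2 + (R x)\<^sup>2"

lemma N_nonneg: "N x \<ge> 0" by (simp add: N_def)

lemma DERIV_N: "x \<ge> x0 \<Longrightarrow> (N has_real_derivative 2 * P x * P' x + 2 * R x * R' x) (at x)"
  unfolding N_def[abs_def] by (auto intro!: derivative_eq_intros dP dR)

lemma bound_DERIV_N:
  assumes "x \<ge> x0"
  shows "\<bar>2 * P x * P' x + 2 * R x * R' x\<bar> \<le> 4 * K / x\<^sup>2 * N x"
proof -
  let ?n = "sqrt (N x)"
  have P: "\<bar>P x\<bar> \<le> ?n" and R: "\<bar>R x\<bar> \<le> ?n"
    by (auto simp: N_def)
  have "\<bar>P x * P' x\<bar> \<le> ?n * (K / x\<^sup>2 * ?n)"
    unfolding abs_mult using bP[OF assms] P K by (intro mult_mono) (auto simp: N_def)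
  moreover have "\<bar>R x * R' x\<bar> \<le> ?n * (K / x\<^sup>2 * ?n)"
    unfolding abs_mult using bR[OF assms] R K by (intro mult_mono) (auto simp: N_def)
  moreover have "?n * (K / x\<^sup>2 * ?n) = K / x\<^sup>2 * N x"
    using N_nonneg[of x] by simp
  moreover have "4 * K / x\<^sup>2 * N x = 4 * (K / x\<^sup>2 * N x)" by simp
  ultimately show ?thesis by linarith
qed

text \<open>Gronwall as a monotonicity statement: \<open>exp (- 4 * K / x)\<close> has logarithmic
  derivative 4K/x^2, which outweighs the fastest decay that \<open>bound_DERIV_N\<close> permits.
  \<open>N_decr\<close> is the mirror image for growth.\<close>

lemma N_incr:
  assumes "x0 \<le> x" "x \<le> y"
  shows "N x * exp (- 4 * K / x) \<le> N y * exp (- 4 * K / y)"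
proof (rule DERIV_nonneg_imp_nondecreasing[OF assms(2)])
  fix t assume t: "x \<le> t" "t \<le> y"
  then have t0: "t \<ge> x0" "t > 0" using assms x0 by auto
  let ?N' = "2 * P t * P' t + 2 * R t * R' t"
  have "((\<lambda>t. N t * exp (- 4 * K / t)) has_real_derivative (?N' + 4 * K / t\<^sup>2 * N t) * exp (- 4 * K / t)) (at t)"
    using t0 by (auto intro!: derivative_eq_intros DERIV_N simp: field_simps power2_eq_square)
  moreover have "(?N' + 4 * K / t\<^sup>2 * N t) * exp (- 4 * K / t) \<ge> 0"
    using bound_DERIV_N[OF t0(1)] by (intro mult_nonneg_nonneg) (auto simp: abs_le_iff)
  ultimately show "\<exists>y. ((\<lambda>t. N t * exp (- 4 * K / t)) has_real_derivative y) (at t) \<and> 0 \<le> y"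
    by blast
qed

lemma N_decr:
  assumes "x0 \<le> x" "x \<le> y"
  shows "N y * exp (4 * K / y) \<le> N x * exp (4 * K / x)"
proof (rule DERIV_nonpos_imp_nonincreasing[OF assms(2)])
  fix t assume t: "x \<le> t" "t \<le> y"
  then have t0: "t \<ge> x0" "t > 0" using assms x0 by auto
  let ?N' = "2 * P t * P' t + 2 * R t * R' t"
  have "((\<lambda>t. N t * exp (4 * K / t)) has_real_derivative (?N' - 4 * K / t\<^sup>2 * N t) * exp (4 * K / t)) (at t)"
    using t0 by (auto intro!: derivative_eq_intros DERIV_N simp: field_simps power2_eq_square)
  moreover have "(?N' - 4 * K / t\<^sup>2 * N t) * exp (4 * K / t) \<le> 0"
    using bound_DERIV_N[OF t0(1)] by (intro mult_nonpos_nonneg) (auto simp: abs_le_iff)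
  ultimately show "\<exists>y. ((\<lambda>t. N t * exp (4 * K / t)) has_real_derivative y) (at t) \<and> y \<le> 0"
    by blast
qed

lemma N_le:
  assumes "x0 \<le> x" "x \<le> y"
  shows "N y \<le> N x * exp (4 * K / x)"
proof -
  have "N y * 1 \<le> N y * exp (4 * K / y)"
    using K x0 assms N_nonneg by (intro mult_left_mono) auto
  with N_decr[OF assms] show ?thesis by simp
qed

text \<open>K M / x has derivative - K M / x^2, the negative of the speed bound; adding or
  subtracting it makes each coordinate monotone.\<close>

lemma comparison:
  assumes "x0 \<le> x" "x \<le> y" and M: "\<And>t. x \<le> t \<Longrightarrow> t \<le> y \<Longrightarrow> N t \<le> M\<^sup>2" "M \<ge> 0"
  shows "P x + K * M / x \<ge> P y + K * M / y" "P x - K * M / x \<le> P y - K * M / y"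
    and "R x + K * M / x \<ge> R y + K * M / y" "R x - K * M / x \<le> R y - K * M / y"
proof -
  have *: "F x + K * M / x \<ge> F y + K * M / y \<and> F x - K * M / x \<le> F y - K * M / y"
    if dF: "\<And>x. x \<ge> x0 \<Longrightarrow> (F has_real_derivative F' x) (at x)"
    and bF: "\<And>x. x \<ge> x0 \<Longrightarrow> \<bar>F' x\<bar> \<le> K / x\<^sup>2 * sqrt (N x)" for F F'
  proof -
    have b: "\<bar>F' t\<bar> \<le> K * M / t\<^sup>2" if "x \<le> t" "t \<le> y" for t
    proof -
      have "sqrt (N t) \<le> M" using M that by (intro real_le_lsqrt) auto
      then have "K / t\<^sup>2 * sqrt (N t) \<le> K / t\<^sup>2 * M" using K by (intro mult_left_mono) auto
      then show ?thesis using bF[of t] that assms by simp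
    qed
    have "F x + K * M / x \<ge> F y + K * M / y"
    proof (rule DERIV_nonpos_imp_nonincreasing[OF assms(2)])
      fix t assume t: "x \<le> t" "t \<le> y"
      then have "((\<lambda>x. F x + K * M / x) has_real_derivative (F' t - K * M / t\<^sup>2)) (at t)"
        using assms x0 by (auto intro!: derivative_eq_intros dF simp: power2_eq_square)
      then show "\<exists>y. ((\<lambda>x. F x + K * M / x) has_real_derivative y) (at t) \<and> y \<le> 0"
        using b[OF t] by (auto simp: abs_le_iff)
    qed
    moreover have "F x - K * M / x \<le> F y - K * M / y"
    proof (rule DERIV_nonneg_imp_nondecreasing[OF assms(2)])
      fix t assume t: "x \<le> t" "t \<le> y"
      then have "((\<lambda>x. F x - K * M / x) has_real_derivative (F' t + K * M / t\<^sup>2)) (at t)"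
        using assms x0 by (auto intro!: derivative_eq_intros dF simp: power2_eq_square)
      then show "\<exists>y. ((\<lambda>x. F x - K * M / x) has_real_derivative y) (at t) \<and> 0 \<le> y"
        using b[OF t] by (auto simp: abs_le_iff)
    qed
    ultimately show ?thesis by simp
  qed
  from *[OF dP bP[folded N_def]] show "P x + K * M / x \<ge> P y + K * M / y" "P x - K * M / x \<le> P y - K * M / y" by auto
  from *[OF dR bR[folded N_def]] show "R x + K * M / x \<ge> R y + K * M / y" "R x - K * M / x \<le> R y - K * M / y" by auto
qed

lemma limit_exists: "\<exists>A. (P \<longlongrightarrow> A) at_top" "\<exists>B. (R \<longlongrightarrow> B) at_top"
proof -
  define M where "M = sqrt (N x0 * exp (4 * K / x0))"
  have M0: "M \<ge> 0" by (simp add: M_def N_nonneg)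
  have M: "N t \<le> M\<^sup>2" if "x0 \<le> t" for t
    using N_le[OF order_refl that] by (simp add: M_def N_nonneg)
  have lim: "((\<lambda>x. K * M / x) \<longlongrightarrow> 0) at_top" by real_asymp
  have bd: "\<bar>P t\<bar> \<le> M" "\<bar>R t\<bar> \<le> M" if "x0 \<le> t" for t
  proof -
    have "(P t)\<^sup>2 \<le> N t" "(R t)\<^sup>2 \<le> N t" by (simp_all add: N_def)
    with M[OF that] have "(P t)\<^sup>2 \<le> M\<^sup>2" "(R t)\<^sup>2 \<le> M\<^sup>2" by linarith+
    with M0 show "\<bar>P t\<bar> \<le> M" "\<bar>R t\<bar> \<le> M"
      unfolding abs_le_square_iff[symmetric] by simp_all
  qed
  have pos: "K * M / t \<ge> 0" if "x0 \<le> t" for t using K M0 x0 that by simp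
  have step: "\<exists>A. (F \<longlongrightarrow> A) at_top"
    if mono: "\<And>x y. x0 \<le> x \<Longrightarrow> x \<le> y \<Longrightarrow> F x - K * M / x \<le> F y - K * M / y"
    and bdF: "\<And>x. x0 \<le> x \<Longrightarrow> \<bar>F x\<bar> \<le> M" for F
  proof -
    have "F x - K * M / x \<le> M" if "x0 \<le> x" for x
      using bdF[OF that] pos[OF that] by linarith
    with mono obtain A where "((\<lambda>x. F x - K * M / x) \<longlongrightarrow> A) at_top"
      using mono_bounded_tendsto_at_top[of x0 "\<lambda>x. F x - K * M / x" M] by blast
    from tendsto_add[OF this lim] show ?thesis by auto
  qed
  show "\<exists>A. (P \<longlongrightarrow> A) at_top"
    by (rule step, rule comparison(2)) (auto simp: M M0 bd)
  show "\<exists>A. (R \<longlongrightarrow> A) at_top"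
    by (rule step, rule comparison(4)) (auto simp: M M0 bd)
qed

lemma dist_limit_le:
  assumes x: "x0 \<le> x" and M: "\<And>t. x \<le> t \<Longrightarrow> N t \<le> M\<^sup>2" "M \<ge> 0"
    and A: "(P \<longlongrightarrow> A) at_top" and B: "(R \<longlongrightarrow> B) at_top"
  shows "\<bar>P x - A\<bar> \<le> K * M / x" "\<bar>R x - B\<bar> \<le> K * M / x"
proof -
  have lim: "((\<lambda>x. K * M / x) \<longlongrightarrow> 0) at_top" by real_asymp
  note comp = comparison[OF x _ M(1) M(2)]
  have "P x + K * M / x \<ge> A"
    using tendsto_add[OF A lim] comp(1)
    by (intro tendsto_upperbound[of "\<lambda>y. P y + K * M / y" _ at_top]) (auto intro!: eventually_at_top_linorderI[of x])
  moreover have "P x - K * M / x \<le> A"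
    using tendsto_diff[OF A lim] comp(2)
    by (intro tendsto_lowerbound[of "\<lambda>y. P y - K * M / y" _ at_top]) (auto intro!: eventually_at_top_linorderI[of x])
  ultimately show "\<bar>P x - A\<bar> \<le> K * M / x" by (simp add: abs_le_iff)
  have "R x + K * M / x \<ge> B"
    using tendsto_add[OF B lim] comp(3)
    by (intro tendsto_upperbound[of "\<lambda>y. R y + K * M / y" _ at_top]) (auto intro!: eventually_at_top_linorderI[of x])
  moreover have "R x - K * M / x \<le> B"
    using tendsto_diff[OF B lim] comp(4)
    by (intro tendsto_lowerbound[of "\<lambda>y. R y - K * M / y" _ at_top]) (auto intro!: eventually_at_top_linorderI[of x])
  ultimately show "\<bar>R x - B\<bar> \<le> K * M / x" by (simp add: abs_le_iff)
qed

text \<open>Gronwall read backwards from infinity. The bound involves only the endpoint of the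
  curve, and \<open>lg_limits\<close> will show that all orders share one endpoint; this is the
  origin of the uniformity in n.\<close>

lemma N_le_limit:
  assumes "x0 \<le> x" and A: "(P \<longlongrightarrow> A) at_top" and B: "(R \<longlongrightarrow> B) at_top"
  shows "N x \<le> exp (4 * K / x) * (A\<^sup>2 + B\<^sup>2)"
proof -
  have "((\<lambda>y. exp (- 4 * K / y)) \<longlongrightarrow> 1) at_top" by real_asymp
  moreover have "(N \<longlongrightarrow> A\<^sup>2 + B\<^sup>2) at_top"
    unfolding N_def[abs_def] by (intro tendsto_intros A B)
  ultimately have "((\<lambda>y. N y * exp (- 4 * K / y)) \<longlongrightarrow> (A\<^sup>2 + B\<^sup>2) * 1) at_top"
    by (intro tendsto_intros)
  then have "N x * exp (- 4 * K / x) \<le> (A\<^sup>2 + B\<^sup>2) * 1"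
    using N_incr[OF assms(1)]
    by (intro tendsto_lowerbound[of _ _ at_top]) (auto intro!: eventually_at_top_linorderI[of x])
  then show ?thesis by (simp add: exp_minus field_simps)
qed

end

section \<open>Uniform asymptotics\<close>

lemma lg_W_le: "\<bar>lg_W n x\<bar> \<le> sqrt ((lg_P n x)\<^sup>2 + (lg_R n x)\<^sup>2)"
  unfolding lg_norm by (rule real_le_rsqrt) simp

text \<open>Isolates the analytic input |\<open>lg_q\<close>| \<le> K/x^2, so that order 0 can be
  run with the sharp K = 1/4 and general orders with a constant depending on a alone.\<close>

lemma slow_curve_lgI:
  assumes "x0 > 0" "x0 \<ge> a * real n" "a > 1" "K \<ge> 0"
    and q: "\<And>x. x \<ge> x0 \<Longrightarrow> \<bar>lg_q n x\<bar> \<le> K / x\<^sup>2"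
  shows "slow_curve (lg_P n) (lg_R n) (\<lambda>x. lg_q n x * lg_W n x * sin (lg_zeta n x))
     (\<lambda>x. - lg_q n x * lg_W n x * cos (lg_zeta n x)) K x0"
proof
  fix x assume x: "x \<ge> x0"
  have "real n < x"
  proof (cases "n = 0")
    case False
    with assms have "1 * real n < a * real n" by (intro mult_strict_right_mono) auto
    with assms x show ?thesis by linarith
  qed (use assms x in auto)
  then show "(lg_P n has_real_derivative lg_q n x * lg_W n x * sin (lg_zeta n x)) (at x)"
    "(lg_R n has_real_derivative - lg_q n x * lg_W n x * cos (lg_zeta n x)) (at x)"
    by (rule DERIV_lg_P DERIV_lg_R)+
  have *: "\<bar>lg_q n x * lg_W n x\<bar> * \<bar>t\<bar> \<le> K / x\<^sup>2 * sqrt ((lg_P n x)\<^sup>2 + (lg_R n x)\<^sup>2)" if "\<bar>t\<bar> \<le> 1" for t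
  proof -
    have "\<bar>lg_q n x * lg_W n x\<bar> * \<bar>t\<bar> \<le> \<bar>lg_q n x * lg_W n x\<bar> * 1"
      using that by (intro mult_left_mono) auto
    also have "\<dots> \<le> K / x\<^sup>2 * sqrt ((lg_P n x)\<^sup>2 + (lg_R n x)\<^sup>2)"
      unfolding abs_mult mult_1_right using assms(4) by (intro mult_mono q[OF x] lg_W_le) auto
    finally show ?thesis .
  qed
  show "\<bar>lg_q n x * lg_W n x * sin (lg_zeta n x)\<bar> \<le> K / x\<^sup>2 * sqrt ((lg_P n x)\<^sup>2 + (lg_R n x)\<^sup>2)"
    "\<bar>- lg_q n x * lg_W n x * cos (lg_zeta n x)\<bar> \<le> K / x\<^sup>2 * sqrt ((lg_P n x)\<^sup>2 + (lg_R n x)\<^sup>2)"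
    using *[of "sin (lg_zeta n x)"] *[of "cos (lg_zeta n x)"] by (simp_all add: abs_mult)
qed (use assms in auto)

lemma lg_r_0: "x \<ge> 0 \<Longrightarrow> lg_r 0 x = sqrt x"
  by (simp add: lg_r_def)

lemma lg_zeta_0: "x \<ge> 0 \<Longrightarrow> lg_zeta 0 x = x"
  by (simp add: lg_zeta_def)

lemma slow_curve_lg_0:
  assumes "x0 > 0"
  shows "slow_curve (lg_P 0) (lg_R 0) (\<lambda>x. lg_q 0 x * lg_W 0 x * sin (lg_zeta 0 x))
     (\<lambda>x. - lg_q 0 x * lg_W 0 x * cos (lg_zeta 0 x)) (1/4) x0"
proof (rule slow_curve_lgI[where a=2])
  fix x assume "x \<ge> x0"
  with assms have x: "x > 0" by simp
  have "lg_r 0 x ^ 10 = (lg_r 0 x ^ 2) ^ 5" by simp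
  also have "\<dots> = x ^ 5" using x by (simp add: lg_r_0)
  finally show "\<bar>lg_q 0 x\<bar> \<le> 1/4 / x\<^sup>2"
    using x by (simp add: lg_q_def field_simps power_numeral_reduce)
qed (use assms in auto)

text \<open>From n \<le> x/a follow \<open>lg_r\<close>^2 \<ge> sqrt(1 - 1/a^2) x and x^2 + 4 n^2
  \<le> 5 x^2. The resulting constant is free of n and blows up as a approaches the turning point
  1.\<close>

lemma slow_curve_lg:
  assumes a: "a > 1" and x0: "x0 > 0" "x0 \<ge> a * real n"
  shows "slow_curve (lg_P n) (lg_R n) (\<lambda>x. lg_q n x * lg_W n x * sin (lg_zeta n x))
     (\<lambda>x. - lg_q n x * lg_W n x * cos (lg_zeta n x)) (5 / (4 * sqrt (1 - 1 / a\<^sup>2) ^ 5)) x0"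
proof (rule slow_curve_lgI[OF x0 a])
  let ?k = "sqrt (1 - 1 / a\<^sup>2)"
  have "1 < a\<^sup>2" using a by simp
  then have k: "?k > 0" by (simp add: divide_simps)
  then show "0 \<le> 5 / (4 * ?k ^ 5)" by simp
  fix x assume "x \<ge> x0"
  with x0 have x: "x > 0" "x \<ge> a * real n" by auto
  have n: "real n \<le> x / a" using x a by (simp add: field_simps)
  have n2: "(real n)\<^sup>2 \<le> (x / a)\<^sup>2" using n by (intro power_mono) auto
  have xn: "(real n)\<^sup>2 \<le> x\<^sup>2"
  proof -
    have "x / a \<le> x" using x a by (simp add: field_simps)
    with n show ?thesis by (intro power_mono) auto
  qed
  have "?k * x \<le> lg_r n x ^ 2"
  proof -
    have "?k * x = sqrt ((1 - 1 / a\<^sup>2) * x\<^sup>2)"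
      using x by (simp add: real_sqrt_mult)
    also have "\<dots> \<le> sqrt (x\<^sup>2 - (real n)\<^sup>2)"
      using n2 by (intro real_sqrt_le_mono) (simp add: algebra_simps power_divide)
    also have "\<dots> = lg_r n x ^ 2" using xn by (simp add: lg_r_def)
    finally show ?thesis .
  qed
  then have "(?k * x) ^ 5 \<le> (lg_r n x ^ 2) ^ 5"
    using k x by (intro power_mono) auto
  then have r: "?k ^ 5 * x ^ 5 \<le> lg_r n x ^ 10" by (simp add: power_mult_distrib)
  have "\<bar>lg_q n x\<bar> = x * (x\<^sup>2 + 4 * (real n)\<^sup>2) / (4 * lg_r n x ^ 10)"
    using x by (simp add: lg_q_def)
  also have "\<dots> \<le> x * (5 * x\<^sup>2) / (4 * (?k ^ 5 * x ^ 5))"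
    using x k r xn by (intro frac_le mult_left_mono) auto
  also have "\<dots> = 5 / (4 * ?k ^ 5) / x\<^sup>2"
  proof -
    have "x * (5 * x\<^sup>2) / (4 * (c * x ^ 5)) = 5 / (4 * c) / x\<^sup>2" if "c > 0" for c
      using x that by (simp add: field_simps power_numeral_reduce)
    then show ?thesis using k by simp
  qed
  finally show "\<bar>lg_q n x\<bar> \<le> 5 / (4 * ?k ^ 5) / x\<^sup>2" .
qed

section \<open>Asymptotics at fixed order\<close>

definition asympt :: "(real \<Rightarrow> real) \<Rightarrow> (real \<Rightarrow> real) \<Rightarrow> bool" where
  "asympt f g \<longleftrightarrow> ((\<lambda>x. f x - g x) \<longlongrightarrow> 0) at_top"

lemma asympt_refl [simp]: "asympt f f" by (simp add: asympt_def)

lemma asympt_cong: "eventually (\<lambda>x. f x = f' x) at_top \<Longrightarrow> asympt f g \<longleftrightarrow> asympt f' g"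
  unfolding asympt_def by (rule tendsto_cong) (auto elim: eventually_mono)

lemma asympt_add: "asympt f g \<Longrightarrow> asympt f' g' \<Longrightarrow> asympt (\<lambda>x. f x + f' x) (\<lambda>x. g x + g' x)"
  unfolding asympt_def by (drule (1) tendsto_add) (simp add: algebra_simps)

lemma asympt_diff: "asympt f g \<Longrightarrow> asympt f' g' \<Longrightarrow> asympt (\<lambda>x. f x - f' x) (\<lambda>x. g x - g' x)"
  unfolding asympt_def by (drule (1) tendsto_diff) (simp add: algebra_simps)

lemma tendsto_0_mult_bounded:
  fixes f g :: "real \<Rightarrow> real"
  assumes "(f \<longlongrightarrow> 0) at_top" "\<And>x. \<bar>g x\<bar> \<le> M"
  shows "((\<lambda>x. f x * g x) \<longlongrightarrow> 0) at_top"
proof (rule Lim_null_comparison)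
  show "eventually (\<lambda>x. norm (f x * g x) \<le> \<bar>f x\<bar> * M) at_top"
    using assms(2) by (auto simp: abs_mult intro!: mult_left_mono always_eventually)
  show "((\<lambda>x. \<bar>f x\<bar> * M) \<longlongrightarrow> 0) at_top"
    using assms(1) by (intro tendsto_mult_left_zero tendsto_rabs_zero)
qed

lemma asympt_mult:
  assumes "asympt f g" "asympt f' g'" "\<And>x. \<bar>g x\<bar> \<le> M" "\<And>x. \<bar>g' x\<bar> \<le> M'"
  shows "asympt (\<lambda>x. f x * f' x) (\<lambda>x. g x * g' x)"
proof -
  have "((\<lambda>x. (f x - g x) * (f' x - g' x) + (f x - g x) * g' x + (f' x - g' x) * g x) \<longlongrightarrow> 0 * 0 + 0 + 0) at_top"
    using assms unfolding asympt_def by (intro tendsto_intros tendsto_0_mult_bounded) auto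
  then show ?thesis unfolding asympt_def by (simp add: algebra_simps)
qed

lemma asympt_const: "asympt f (\<lambda>_. c) \<longleftrightarrow> (f \<longlongrightarrow> c) at_top"
  unfolding asympt_def using LIM_zero_iff by blast

lemma abs_cos_sin_combination_le: "\<bar>A * cos t + B * sin t\<bar> \<le> \<bar>A\<bar> + \<bar>B\<bar>" for A B t :: real
proof -
  have "\<bar>A * cos t\<bar> \<le> \<bar>A\<bar> * 1" "\<bar>B * sin t\<bar> \<le> \<bar>B\<bar> * 1"
    unfolding abs_mult by (intro mult_left_mono; simp)+
  then show ?thesis by linarith
qed

text \<open>Leading term of sqrt x J_n(x); the shift n pi/2 is the limit of x -
  \<open>lg_zeta n x\<close>.\<close>

definition wave :: "real \<Rightarrow> real \<Rightarrow> nat \<Rightarrow> real \<Rightarrow> real" where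
  "wave A B n x = A * cos (x - real n * (pi / 2)) + B * sin (x - real n * (pi / 2))"

lemma wave_bound: "\<bar>wave A B n x\<bar> \<le> \<bar>A\<bar> + \<bar>B\<bar>"
  unfolding wave_def by (rule abs_cos_sin_combination_le)

lemma wave_Suc: "wave A B (Suc n) x = A * sin (x - real n * (pi / 2)) - B * cos (x - real n * (pi / 2))"
proof -
  have *: "x - real (Suc n) * (pi / 2) = (x - real n * (pi / 2)) - pi / 2" by (simp add: algebra_simps)
  show ?thesis unfolding wave_def * cos_diff[of _ "pi / 2"] sin_diff[of _ "pi / 2"] by simp
qed

lemma wave_Suc_Suc: "wave A B (Suc (Suc n)) x = - wave A B n x"
proof -
  have *: "x - real (Suc (Suc n)) * (pi / 2) = (x - real n * (pi / 2)) - pi" by (simp add: algebra_simps)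
  show ?thesis unfolding wave_def * cos_diff[of _ pi] sin_diff[of _ pi] by simp
qed

lemma asympt_lg_zeta:
  "asympt (\<lambda>x. cos (lg_zeta n x)) (\<lambda>x. cos (x - real n * (pi / 2)))"
  "asympt (\<lambda>x. sin (lg_zeta n x)) (\<lambda>x. sin (x - real n * (pi / 2)))"
proof -
  let ?d = "\<lambda>x. lg_zeta n x - (x - real n * (pi / 2))"
  have "((\<lambda>x. arccos (real n / x)) \<longlongrightarrow> arccos 0) at_top"
    by (rule isCont_tendsto_compose[OF isCont_arccos]) (auto, real_asymp)
  then have "((\<lambda>x. (sqrt (x\<^sup>2 - (real n)\<^sup>2) - x) - real n * (arccos (real n / x) - pi / 2)) \<longlongrightarrow> 0 - real n * (arccos 0 - pi / 2)) at_top"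
    by (intro tendsto_intros) real_asymp
  then have d: "(?d \<longlongrightarrow> 0) at_top"
    by (simp add: lg_zeta_def algebra_simps)
  have c: "asympt (\<lambda>x. cos (?d x)) (\<lambda>_. 1)" and s: "asympt (\<lambda>x. sin (?d x)) (\<lambda>_. 0)"
    unfolding asympt_const using tendsto_cos[OF d] tendsto_sin[OF d] by simp_all
  have e: "lg_zeta n x = (x - real n * (pi / 2)) + ?d x" for x by simp
  show "asympt (\<lambda>x. cos (lg_zeta n x)) (\<lambda>x. cos (x - real n * (pi / 2)))"
    by (subst e, subst cos_add)
       (use asympt_diff[OF asympt_mult[OF asympt_refl c] asympt_mult[OF asympt_refl s],
          of "\<lambda>x. cos (x - real n * (pi / 2))" 1 1 "\<lambda>x. sin (x - real n * (pi / 2))" 1 1] in simp)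
  show "asympt (\<lambda>x. sin (lg_zeta n x)) (\<lambda>x. sin (x - real n * (pi / 2)))"
    by (subst e, subst sin_add)
       (use asympt_add[OF asympt_mult[OF asympt_refl c] asympt_mult[OF asympt_refl s],
          of "\<lambda>x. sin (x - real n * (pi / 2))" 1 1 "\<lambda>x. cos (x - real n * (pi / 2))" 1 1] in simp)
qed

text \<open>The induction over the order needs both J_0 and J_1 to start. J_1 is recovered from
  \<open>lg_V\<close>, which for order 0 equals sqrt x (J_0 / (2x) - J_1).\<close>

lemma bessel_asympt_0:
  assumes A: "(lg_P 0 \<longlongrightarrow> A) at_top" and B: "(lg_R 0 \<longlongrightarrow> B) at_top"
  shows "asympt (\<lambda>x. sqrt x * bessel 0 x) (wave A B 0)" "asympt (\<lambda>x. sqrt x * bessel (Suc 0) x) (wave A B (Suc 0))"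
proof -
  note PR = A[folded asympt_const] B[folded asympt_const]
  have "asympt (\<lambda>x. lg_P 0 x * cos x + lg_R 0 x * sin x) (\<lambda>x. A * cos x + B * sin x)"
    by (intro asympt_add asympt_mult[OF PR(1) asympt_refl, of "\<bar>A\<bar>" _ 1] asympt_mult[OF PR(2) asympt_refl, of "\<bar>B\<bar>" _ 1]) auto
  moreover have "eventually (\<lambda>x. lg_P 0 x * cos x + lg_R 0 x * sin x = sqrt x * bessel 0 x) at_top"
    using eventually_ge_at_top[of 0]
  proof eventually_elim
    case (elim x)
    show ?case using lg_W_eq[of 0 x] elim by (simp add: lg_zeta_0 lg_W_def lg_r_0)
  qed
  ultimately have J0: "asympt (\<lambda>x. sqrt x * bessel 0 x) (\<lambda>x. A * cos x + B * sin x)"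
    by (simp add: asympt_cong)
  then show "asympt (\<lambda>x. sqrt x * bessel 0 x) (wave A B 0)"
    by (simp add: wave_def[abs_def])
  have "asympt (\<lambda>x. 1 / (2 * x)) (\<lambda>_. 0)" unfolding asympt_const by real_asymp
  from asympt_mult[OF this J0, of 0 "\<bar>A\<bar> + \<bar>B\<bar>"]
  have "asympt (\<lambda>x. 1 / (2 * x) * (sqrt x * bessel 0 x)) (\<lambda>_. 0)"
    using abs_cos_sin_combination_le by simp
  moreover have "asympt (\<lambda>x. lg_P 0 x * sin x - lg_R 0 x * cos x) (\<lambda>x. A * sin x - B * cos x)"
    by (intro asympt_diff asympt_mult[OF PR(1) asympt_refl, of "\<bar>A\<bar>" _ 1] asympt_mult[OF PR(2) asympt_refl, of "\<bar>B\<bar>" _ 1]) auto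
  ultimately have "asympt (\<lambda>x. 1 / (2 * x) * (sqrt x * bessel 0 x) + (lg_P 0 x * sin x - lg_R 0 x * cos x)) (\<lambda>x. 0 + (A * sin x - B * cos x))"
    by (rule asympt_add)
  moreover have "eventually (\<lambda>x. 1 / (2 * x) * (sqrt x * bessel 0 x) + (lg_P 0 x * sin x - lg_R 0 x * cos x) = sqrt x * bessel (Suc 0) x) at_top"
    using eventually_gt_at_top[of 0]
  proof eventually_elim
    case (elim x)
    have "lg_P 0 x * sin x - lg_R 0 x * cos x = - lg_V 0 x * ((cos x)\<^sup>2 + (sin x)\<^sup>2)"
      using elim unfolding lg_P_def lg_R_def by (simp only: lg_zeta_0 less_imp_le) algebra
    also have "\<dots> = - lg_V 0 x" by simp
    also have "lg_V 0 x = (x\<^sup>2 / (2 * sqrt x ^ 5)) * bessel 0 x - x / sqrt x * bessel (Suc 0) x"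
      using elim by (simp add: lg_V_def lg_r_0)
    also have "x\<^sup>2 / (2 * sqrt x ^ 5) = 1 / (2 * x) * sqrt x"
    proof -
      have "s ^ 5 = s\<^sup>2 * s\<^sup>2 * s" for s :: real by (simp add: power_numeral_reduce)
      then have "sqrt x ^ 5 = (sqrt x)\<^sup>2 * (sqrt x)\<^sup>2 * sqrt x" .
      also have "(sqrt x)\<^sup>2 = x" using elim by simp
      finally have s5: "sqrt x ^ 5 = x * x * sqrt x" .
      have gen: "x\<^sup>2 / (2 * (x * x * s)) = 1 / (2 * x) * s" if "s > 0" "x = s * s" for s
        using that by (simp add: field_simps power2_eq_square)
      show ?thesis unfolding s5 by (rule gen) (use elim in simp_all)
    qed
    also have "x / sqrt x = sqrt x" using elim by (simp add: real_div_sqrt)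
    finally show ?case by (simp add: algebra_simps)
  qed
  ultimately show "asympt (\<lambda>x. sqrt x * bessel (Suc 0) x) (wave A B (Suc 0))"
    using wave_Suc[of A B 0] by (simp add: asympt_cong ext[of "wave A B (Suc 0)", OF wave_Suc])
qed

text \<open>Two consecutive orders are carried because the recurrence is of second order. Its factor
  2(n+1)/x tends to 0, so J_{n+2} behaves like - J_n, matching \<open>wave_Suc_Suc\<close>.\<close>

lemma bessel_asympt:
  assumes "(lg_P 0 \<longlongrightarrow> A) at_top" "(lg_R 0 \<longlongrightarrow> B) at_top"
  shows "asympt (\<lambda>x. sqrt x * bessel n x) (wave A B n) \<and> asympt (\<lambda>x. sqrt x * bessel (Suc n) x) (wave A B (Suc n))"
proof (induction n)
  case 0
  show ?case using bessel_asympt_0[OF assms] by simp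
next
  case (Suc n)
  have "asympt (\<lambda>x. 2 * (real n + 1) / x) (\<lambda>_. 0)" unfolding asympt_const by real_asymp
  from asympt_mult[OF this, of "\<lambda>x. sqrt x * bessel (Suc n) x" "wave A B (Suc n)" 0 "\<bar>A\<bar> + \<bar>B\<bar>"]
  have "asympt (\<lambda>x. 2 * (real n + 1) / x * (sqrt x * bessel (Suc n) x)) (\<lambda>_. 0)"
    using Suc wave_bound by simp
  then have "asympt (\<lambda>x. 2 * (real n + 1) / x * (sqrt x * bessel (Suc n) x) - sqrt x * bessel n x) (\<lambda>x. 0 - wave A B n x)"
    using Suc by (intro asympt_diff) auto
  moreover have "eventually (\<lambda>x. 2 * (real n + 1) / x * (sqrt x * bessel (Suc n) x) - sqrt x * bessel n x = sqrt x * bessel (Suc (Suc n)) x) at_top"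
    using eventually_gt_at_top[of 0] by eventually_elim (simp add: bessel_rec algebra_simps)
  ultimately have "asympt (\<lambda>x. sqrt x * bessel (Suc (Suc n)) x) (\<lambda>x. - wave A B n x)"
    by (simp add: asympt_cong)
  then show ?case using Suc wave_Suc_Suc[of A B n] by presburger
qed

text \<open>For fixed n and x tending to infinity the recurrences determine J_n from J_0 and J_1,
  and rotating the wave back by the phase leaves A and B by cos^2 + sin^2 = 1. So all the curves end
  at one point.\<close>

lemma lg_limits:
  assumes "(lg_P 0 \<longlongrightarrow> A) at_top" "(lg_R 0 \<longlongrightarrow> B) at_top"
  shows "(lg_P n \<longlongrightarrow> A) at_top" "(lg_R n \<longlongrightarrow> B) at_top"
proof -
  let ?c = "\<lambda>x. cos (x - real n * (pi / 2))" and ?s = "\<lambda>x. sin (x - real n * (pi / 2))"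
  note J = bessel_asympt[OF assms, of n]
  note w = wave_bound[of A B n] wave_bound[of A B "Suc n"]
  have c1: "asympt (\<lambda>x. lg_r n x / sqrt x) (\<lambda>_. 1)"
    unfolding asympt_const lg_r_def by real_asymp
  have c2: "asympt (\<lambda>x. (x\<^sup>2 / (2 * lg_r n x ^ 5) + real n / lg_r n x) / sqrt x) (\<lambda>_. 0)"
    unfolding asympt_const lg_r_def by real_asymp
  have c3: "asympt (\<lambda>x. x / lg_r n x / sqrt x) (\<lambda>_. 1)"
    unfolding asympt_const lg_r_def by real_asymp
  have "asympt (\<lambda>x. lg_r n x / sqrt x * (sqrt x * bessel n x)) (\<lambda>x. 1 * wave A B n x)"
    by (rule asympt_mult[OF c1 _ _ w(1)]) (use J in auto)
  moreover have "eventually (\<lambda>x. lg_r n x / sqrt x * (sqrt x * bessel n x) = lg_W n x) at_top"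
    using eventually_gt_at_top[of 0] by eventually_elim (simp add: lg_W_def)
  ultimately have W: "asympt (lg_W n) (wave A B n)" by (simp add: asympt_cong)
  have "asympt (\<lambda>x. (x\<^sup>2 / (2 * lg_r n x ^ 5) + real n / lg_r n x) / sqrt x * (sqrt x * bessel n x)
           - x / lg_r n x / sqrt x * (sqrt x * bessel (Suc n) x)) (\<lambda>x. 0 * wave A B n x - 1 * wave A B (Suc n) x)"
    by (intro asympt_diff asympt_mult[OF c2 _ _ w(1)] asympt_mult[OF c3 _ _ w(2)]) (use J in auto)
  moreover have "eventually (\<lambda>x. (x\<^sup>2 / (2 * lg_r n x ^ 5) + real n / lg_r n x) / sqrt x * (sqrt x * bessel n x)
           - x / lg_r n x / sqrt x * (sqrt x * bessel (Suc n) x) = lg_V n x) at_top"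
    using eventually_gt_at_top[of 0] by eventually_elim (simp add: lg_V_def)
  ultimately have V: "asympt (lg_V n) (\<lambda>x. - wave A B (Suc n) x)" by (simp add: asympt_cong)
  have w2: "\<bar>- wave A B (Suc n) x\<bar> \<le> \<bar>A\<bar> + \<bar>B\<bar>" for x using w(2) by simp
  have "asympt (\<lambda>x. lg_W n x * cos (lg_zeta n x) - lg_V n x * sin (lg_zeta n x))
      (\<lambda>x. wave A B n x * ?c x - (- wave A B (Suc n) x) * ?s x)"
    by (intro asympt_diff asympt_mult[where M' = 1, OF W asympt_lg_zeta(1) w(1)]
          asympt_mult[where M' = 1, OF V asympt_lg_zeta(2) w2]) simp_all
  moreover have "wave A B n x * ?c x - (- wave A B (Suc n) x) * ?s x = A" for x
  proof -
    have "wave A B n x * ?c x - (- wave A B (Suc n) x) * ?s x = A * ((?c x)\<^sup>2 + (?s x)\<^sup>2)"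
      unfolding wave_Suc unfolding wave_def by algebra
    then show ?thesis by simp
  qed
  ultimately show "(lg_P n \<longlongrightarrow> A) at_top"
    by (simp add: lg_P_def[abs_def] asympt_const)
  have "asympt (\<lambda>x. lg_W n x * sin (lg_zeta n x) + lg_V n x * cos (lg_zeta n x))
      (\<lambda>x. wave A B n x * ?s x + (- wave A B (Suc n) x) * ?c x)"
    by (intro asympt_add asympt_mult[where M' = 1, OF W asympt_lg_zeta(2) w(1)]
          asympt_mult[where M' = 1, OF V asympt_lg_zeta(1) w2]) simp_all
  moreover have "wave A B n x * ?s x + (- wave A B (Suc n) x) * ?c x = B" for x
  proof -
    have "wave A B n x * ?s x + (- wave A B (Suc n) x) * ?c x = B * ((?c x)\<^sup>2 + (?s x)\<^sup>2)"
      unfolding wave_Suc unfolding wave_def by algebra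
    then show ?thesis by simp
  qed
  ultimately show "(lg_R n \<longlongrightarrow> B) at_top"
    by (simp add: lg_R_def[abs_def] asympt_const)
qed

section \<open>Nonvanishing of the cosine coefficient\<close>

lemma bessel_0_1_bound: "(bessel 0 x)\<^sup>2 + (bessel (Suc 0) x)\<^sup>2 \<le> 1"
  using clifford_energy_antimono[of 0 "x\<^sup>2 / 4" 0]
  by (simp add: bessel_def power_mult_distrib power_divide)

text \<open>The true value is about -0.304; this slack allows rational bounds for pi and five terms
  of the alternating series.\<close>

lemma bessel_0_pi: "bessel 0 pi \<le> - 1 / 4"
proof -
  define y where "y = pi\<^sup>2 / 4"
  have "157/50 < pi" "pi < 63/20"
    using pi_approx by simp_all
  then have "(157/50)\<^sup>2 < pi\<^sup>2" "pi\<^sup>2 < (63/20)\<^sup>2" by (auto intro!: power_strict_mono)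
  then have y: "246/100 < y" "y < 249/100" by (auto simp: y_def power2_eq_square)
  define a where "a m = y ^ m / (fact m * fact m)" for m
  have a_pos: "a m \<ge> 0" for m using y by (simp add: a_def)
  have a_anti: "a (Suc m + 4) \<le> a (m + 4)" for m
  proof -
    have "a (Suc k) = a k * (y / ((real k + 1) * (real k + 1)))" for k
    proof -
      have "fact (Suc k) = (real k + 1) * fact k" by (simp add: algebra_simps)
      then show ?thesis unfolding a_def by (simp only: power_Suc times_divide_times_eq mult_ac)
    qed
    from this[of "m + 4"] have "a (Suc (m + 4)) = a (m + 4) * (y / ((real m + 5) * (real m + 5)))"
      by (simp add: add_ac)
    also have "y \<le> (real m + 5) * (real m + 5)"
      using y mult_mono[of 5 "real m + 5" 5 "real m + 5"] by simp
    then have "a (m + 4) * (y / ((real m + 5) * (real m + 5))) \<le> a (m + 4) * 1"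
      using a_pos by (intro mult_left_mono) (auto simp: divide_le_eq_1)
    finally show ?thesis by simp
  qed
  have s: "(\<lambda>m. (-1) ^ m * a m) sums clifford 0 y"
    using clifford_sums[of 0 y] by (simp add: a_def)
  then have sm: "summable (\<lambda>m. (-1) ^ m * a m)" by (rule sums_summable)
  have "(\<lambda>m. (-1) ^ m * a m) \<longlonglongrightarrow> 0" by (rule summable_LIMSEQ_zero[OF sm])
  then have "(\<lambda>m. \<bar>(-1) ^ m * a m\<bar>) \<longlonglongrightarrow> 0" by (rule tendsto_rabs_zero)
  then have "a \<longlonglongrightarrow> 0" using a_pos by (simp add: abs_mult)
  then have lim: "(\<lambda>m. a (m + 4)) \<longlonglongrightarrow> 0" by (rule LIMSEQ_ignore_initial_segment)
  \<comment> \<open>A tail that starts at an even index is at most its first term. From there on the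
    ratio y/(m+5)^2 of consecutive terms is below 1.\<close>
  have "(\<Sum>m. (-1) ^ m * a (m + 4)) \<le> (\<Sum>i<2 * 0 + 1. (-1) ^ i * a (i + 4))"
    by (rule summable_Leibniz'(4)[where a = "\<lambda>m. a (m + 4)"]) (rule lim a_pos a_anti)+
  then have tail: "(\<Sum>m. (-1) ^ (m + 4) * a (m + 4)) \<le> a 4"
    by (simp add: power_add)
  have "clifford 0 y = (\<Sum>m. (-1) ^ (m + 4) * a (m + 4)) + (\<Sum>m<4. (-1) ^ m * a m)"
    using suminf_split_initial_segment[OF sm, of 4] s sums_unique by metis
  also have "\<dots> \<le> a 4 + (\<Sum>m<4. (-1) ^ m * a m)" using tail by simp
  also have "\<dots> = 1 - y + y ^ 2 / 4 - y ^ 3 / 36 + y ^ 4 / 576"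
    by (simp add: a_def numeral_eq_Suc field_simps)
  also have "\<dots> \<le> - 1 / 4"
  proof -
    have y2: "y\<^sup>2 \<le> (249/100)\<^sup>2" using y by (intro power_mono) auto
    have "y ^ 3 \<ge> (246/100) ^ 3" using y by (intro power_mono) auto
    moreover have "y ^ 4 \<le> (249/100) ^ 4" using y by (intro power_mono) auto
    ultimately show ?thesis using y y2 by (simp add: field_simps power_numeral_reduce)
  qed
  finally show ?thesis by (simp add: bessel_def y_def)
qed

text \<open>
  At \<open>x = \<pi>\<close> one has \<open>P = - sqrt \<pi> J\<^sub>0(\<pi>) \<ge> sqrt \<pi> / 4\<close>, while the total variation of the curve on
  \<open>[\<pi>, \<infinity>)\<close> is below \<open>sqrt \<pi> / 4\<close>.
\<close>

lemma lg_P_limit_nonzero: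
  assumes "(lg_P 0 \<longlongrightarrow> A) at_top" "(lg_R 0 \<longlongrightarrow> B) at_top"
  shows "A \<noteq> 0"
proof -
  interpret slow_curve "lg_P 0" "lg_R 0" "\<lambda>x. lg_q 0 x * lg_W 0 x * sin (lg_zeta 0 x)"
     "\<lambda>x. - lg_q 0 x * lg_W 0 x * cos (lg_zeta 0 x)" "1/4" pi
    by (rule slow_curve_lg_0) simp
  let ?J = "bessel 0 pi" and ?K = "bessel (Suc 0) pi"
  have W: "lg_W 0 pi = sqrt pi * ?J" by (simp add: lg_W_def lg_r_0)
  have V: "lg_V 0 pi = sqrt pi * (1 / (2 * pi) * ?J - ?K)"
  proof -
    have "sqrt pi ^ 5 = (sqrt pi)\<^sup>2 * (sqrt pi)\<^sup>2 * sqrt pi" by (simp add: power_numeral_reduce)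
    then have "sqrt pi ^ 5 = pi * pi * sqrt pi" by simp
    then have s5: "sqrt pi ^ 5 = pi * pi * sqrt pi" .
    have gen: "pi\<^sup>2 / (2 * (pi * pi * s)) = s * (1 / (2 * pi))" "pi / s = s" if "s > 0" "pi = s * s" for s
      using that by (simp_all add: field_simps power2_eq_square)
    have *: "pi\<^sup>2 / (2 * sqrt pi ^ 5) = sqrt pi * (1 / (2 * pi))" "pi / sqrt pi = sqrt pi"
      unfolding s5 by (rule gen; simp)+
    have "lg_V 0 pi = pi\<^sup>2 / (2 * sqrt pi ^ 5) * ?J - pi / sqrt pi * ?K"
      by (simp add: lg_V_def lg_r_0)
    then show ?thesis unfolding * by (simp add: algebra_simps)
  qed
  have JK: "?J\<^sup>2 + ?K\<^sup>2 \<le> 1" by (rule bessel_0_1_bound)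
  have "pi > 3" using pi_gt3 .
  \<comment> \<open>With e = 1/(2 pi) \<le> 1/6 and J_0^2 + J_1^2 \<le> 1 the bracket is at most 1 +
    1/36 + 1/6.\<close>
  have N: "N pi \<le> pi * (5/4)"
  proof -
    have "N pi = pi * (?J\<^sup>2 + (1 / (2 * pi) * ?J - ?K)\<^sup>2)"
      unfolding N_def lg_norm W V by (simp only: power_mult_distrib) (simp add: distrib_left)
    also have "?J\<^sup>2 + (1 / (2 * pi) * ?J - ?K)\<^sup>2 \<le> 5/4"
    proof -
      define e where "e = 1 / (2 * pi)"
      have e: "0 \<le> e" "e \<le> 1/6" using \<open>pi > 3\<close> by (auto simp: e_def field_simps)
      have jk: "- 2 * (?J * ?K) \<le> ?J\<^sup>2 + ?K\<^sup>2"
        using sum_squares_ge_zero[of "?J + ?K" 0] by (simp add: power2_eq_square algebra_simps)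
      have "?J\<^sup>2 + (e * ?J - ?K)\<^sup>2 = (?J\<^sup>2 + ?K\<^sup>2) + e\<^sup>2 * ?J\<^sup>2 + e * (- 2 * (?J * ?K))"
        by (simp add: power2_eq_square algebra_simps)
      also have "\<dots> \<le> 1 + (1/6)\<^sup>2 * 1 + 1/6 * 1"
      proof -
        have "e * (- 2 * (?J * ?K)) \<le> e * 1" using jk JK e by (intro mult_left_mono) linarith+
        then have "e * (- 2 * (?J * ?K)) \<le> 1/6 * 1" using e by linarith
        moreover have "?J\<^sup>2 \<le> 1" using JK zero_le_power2[of ?K] by linarith
        then have "e\<^sup>2 * ?J\<^sup>2 \<le> (1/6)\<^sup>2 * 1" using e by (intro mult_mono power_mono) auto
        ultimately show ?thesis using JK by linarith
      qed
      also have "\<dots> \<le> 5/4" by (simp add: power2_eq_square)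
      finally show ?thesis by (simp add: e_def)
    qed
    finally show ?thesis by simp
  qed
  \<comment> \<open>Here 4 K = 1, so the Gronwall factor is exp(1/pi) \<le> 7/4; and 5/4 times 7/4
    is 35/16, below (13/8)^2.\<close>
  have M: "N t \<le> (sqrt pi * (13/8))\<^sup>2" if "pi \<le> t" for t
  proof -
    have "exp (1 / pi) \<le> exp (1 / 2)" using \<open>pi > 3\<close> by (simp add: field_simps)
    also have "\<dots> \<le> 1 + 1 / 2 + (1 / 2)\<^sup>2" by (rule exp_bound) auto
    finally have e: "exp (1 / pi) \<le> 7 / 4" by (simp add: power2_eq_square)
    have "N t \<le> N pi * exp (1 / pi)" using N_le[OF order_refl that] by simp
    also have "\<dots> \<le> pi * (5/4) * (7/4)" using N e N_nonneg[of pi] by (intro mult_mono) auto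
    also have "\<dots> \<le> pi * (13/8)\<^sup>2" by (simp add: power2_eq_square)
    also have "\<dots> = (sqrt pi * (13/8))\<^sup>2" by (simp only: power_mult_distrib) simp
    finally show ?thesis .
  qed
  \<comment> \<open>The bound K M / pi is sqrt pi * 13 / (32 pi), less than sqrt pi / 4 because 13 <
    8 pi.\<close>
  have "\<bar>lg_P 0 pi - A\<bar> \<le> 1/4 * (sqrt pi * (13/8)) / pi"
    by (rule dist_limit_le(1)[OF order_refl M _ assms]) auto
  also have "\<dots> = sqrt pi * (13 / (32 * pi))" by simp
  also have "\<dots> < sqrt pi * (1/4)" using \<open>pi > 3\<close> by (intro mult_strict_left_mono) (auto simp: field_simps)
  also have "sqrt pi * (1/4) \<le> lg_P 0 pi"
    using bessel_0_pi mult_left_mono[of "1/4" "- ?J" "sqrt pi"] by (simp add: lg_P_def W lg_zeta_0)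
  finally show ?thesis by auto
qed

text \<open>The order of quantifiers matters: A and B are fixed once and for all, and C depends on a
  alone, because K depends only on a, and M only on K, A and B.\<close>

lemma lg_W_approx:
  obtains A B where "A \<noteq> 0" "\<And>n. (lg_P n \<longlongrightarrow> A) at_top" "\<And>n. (lg_R n \<longlongrightarrow> B) at_top"
    "\<And>a. a > 1 \<Longrightarrow> \<exists>C>0. \<forall>n x. x \<ge> 1 \<longrightarrow> x \<ge> a * real n \<longrightarrow>
       \<bar>lg_W n x - (A * cos (lg_zeta n x) + B * sin (lg_zeta n x))\<bar> \<le> C / x"
proof -
  interpret s0: slow_curve "lg_P 0" "lg_R 0" "\<lambda>x. lg_q 0 x * lg_W 0 x * sin (lg_zeta 0 x)"
     "\<lambda>x. - lg_q 0 x * lg_W 0 x * cos (lg_zeta 0 x)" "1/4" 1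
    by (rule slow_curve_lg_0) simp
  obtain A B where AB: "(lg_P 0 \<longlongrightarrow> A) at_top" "(lg_R 0 \<longlongrightarrow> B) at_top"
    using s0.limit_exists by blast
  note lim = lg_limits[OF AB]
  have "\<exists>C>0. \<forall>n x. x \<ge> 1 \<longrightarrow> x \<ge> a * real n \<longrightarrow>
       \<bar>lg_W n x - (A * cos (lg_zeta n x) + B * sin (lg_zeta n x))\<bar> \<le> C / x" if a: "a > 1" for a
  proof -
    define K where "K = 5 / (4 * sqrt (1 - 1 / a\<^sup>2) ^ 5)"
    define M where "M = sqrt (exp (4 * K) * (A\<^sup>2 + B\<^sup>2))"
    have A0: "A \<noteq> 0" by (rule lg_P_limit_nonzero[OF AB])
    have "1 < a\<^sup>2" using a by simp
    then have K: "K > 0" by (simp add: K_def divide_simps)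
    have M0: "M > 0" using A0 by (simp add: M_def sum_power2_gt_zero_iff)
    have "\<bar>lg_W n x - (A * cos (lg_zeta n x) + B * sin (lg_zeta n x))\<bar> \<le> 2 * K * M / x"
      if x: "x \<ge> 1" "x \<ge> a * real n" for n x
    proof -
      \<comment> \<open>The curve is started at the very point x under consideration, so that
        \<open>dist_limit_le\<close> yields K M / x there.\<close>
      interpret slow_curve "lg_P n" "lg_R n" "\<lambda>x. lg_q n x * lg_W n x * sin (lg_zeta n x)"
        "\<lambda>x. - lg_q n x * lg_W n x * cos (lg_zeta n x)" K x
        unfolding K_def by (rule slow_curve_lg) (use a x in auto)
      have N: "N t \<le> M\<^sup>2" if "x \<le> t" for t
      proof -
        have "N t \<le> exp (4 * K / t) * (A\<^sup>2 + B\<^sup>2)" by (rule N_le_limit[OF that lim])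
        also have "4 * K / t \<le> 4 * K" using K x that by (simp add: field_simps mult_le_cancel_left1)
        then have "exp (4 * K / t) * (A\<^sup>2 + B\<^sup>2) \<le> exp (4 * K) * (A\<^sup>2 + B\<^sup>2)"
          by (intro mult_right_mono) auto
        finally show ?thesis by (simp add: M_def)
      qed
      note d = dist_limit_le[OF order_refl N less_imp_le[OF M0] lim]
      have "lg_W n x - (A * cos (lg_zeta n x) + B * sin (lg_zeta n x))
         = (lg_P n x - A) * cos (lg_zeta n x) + (lg_R n x - B) * sin (lg_zeta n x)"
        unfolding lg_W_eq by (simp add: algebra_simps)
      also have "\<bar>\<dots>\<bar> \<le> \<bar>lg_P n x - A\<bar> + \<bar>lg_R n x - B\<bar>" by (rule abs_cos_sin_combination_le)
      also have "\<dots> \<le> 2 * K * M / x" using d by simp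
      finally show ?thesis .
    qed
    then show ?thesis using K M0 by (intro exI[of _ "2 * K * M"]) auto
  qed
  with lg_P_limit_nonzero[OF AB] lim show ?thesis using that by blast
qed

text \<open>At a double zero the energy of \<open>clifford_energy_antimono\<close> is 0; being
  nonnegative and decreasing it stays 0, so J_l vanishes from there on, contrary to the limit A
  \<noteq> 0. This takes the place of uniqueness for the differential equation, and positivity of w
  keeps the second summand of the energy definite.\<close>

lemma clifford_simple_zero:
  assumes "w > 0" "clifford l w = 0"
  shows "clifford (Suc l) w \<noteq> 0"
proof
  assume 0: "clifford (Suc l) w = 0"
  have z: "clifford l y = 0 \<and> clifford (Suc l) y = 0" if "y \<ge> w" for y
  proof -
    have "(clifford l y)\<^sup>2 + y * (clifford (Suc l) y)\<^sup>2 \<le> 0"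
      using clifford_energy_antimono[of w y l] assms that 0 by simp
    moreover have "(clifford l y)\<^sup>2 \<ge> 0" "y * (clifford (Suc l) y)\<^sup>2 \<ge> 0" using assms that by auto
    ultimately have "(clifford l y)\<^sup>2 = 0" "y * (clifford (Suc l) y)\<^sup>2 = 0" by linarith+
    then show ?thesis using assms that by auto
  qed
  obtain A where A: "A \<noteq> 0" "(lg_P l \<longlongrightarrow> A) at_top" using lg_W_approx by metis
  have "eventually (\<lambda>x. lg_P l x = 0) at_top"
  proof (rule eventually_at_top_linorderI[of "max 1 (4 * w)"])
    fix x assume "max 1 (4 * w) \<le> x"
    then have "w \<le> x\<^sup>2 / 4" using mult_mono[of 1 x "4 * w" x] assms by (simp add: power2_eq_square)
    from z[OF this] show "lg_P l x = 0" by (simp add: lg_P_def lg_W_def lg_V_def bessel_def)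
  qed
  then have "(lg_P l \<longlongrightarrow> 0) at_top" by (rule tendsto_eventually)
  with A show False using tendsto_unique trivial_limit_at_top_linorder by blast
qed

text \<open>Infinitely many zeros would accumulate at a zero, positive because C_l(0) = 1/l!, and
  near a simple zero the difference quotient is nonzero.\<close>

lemma finite_clifford_zeros: "finite {y. 0 \<le> y \<and> y \<le> M \<and> clifford l y = 0}" (is "finite ?Z")
proof (rule ccontr)
  assume inf: "infinite ?Z"
  have "compact {0..M}" by simp
  then obtain w where w: "w \<in> {0..M}" "w islimpt ?Z"
    using inf unfolding compact_eq_Bolzano_Weierstrass by (metis (no_types, lifting) atLeastAtMost_iff mem_Collect_eq subsetI)
  have "continuous_on {0..M} (clifford l)" by (intro continuous_intros)
  then have "closed {y \<in> {0..M}. clifford l y = 0}" by (intro continuous_closed_preimage_constant) auto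
  moreover have "{y \<in> {0..M}. clifford l y = 0} = ?Z" by auto
  ultimately have "w \<in> ?Z" using w(2) closed_limpt by metis
  then have 0: "clifford l w = 0" "w \<noteq> 0" by auto
  then have D: "clifford (Suc l) w \<noteq> 0" using clifford_simple_zero[of w l] w(1) by simp
  have "(clifford l has_real_derivative - clifford (Suc l) w * 1) (at w)"
    by (rule clifford_has_real_derivative[OF DERIV_ident])
  then have "((\<lambda>y. (clifford l y - clifford l w) / (y - w)) \<longlongrightarrow> - clifford (Suc l) w) (at w)"
    by (simp add: has_field_derivative_iff)
  then have "eventually (\<lambda>y. (clifford l y - clifford l w) / (y - w) \<noteq> 0) (at w)"
    by (rule tendsto_imp_eventually_ne) (use D in simp)
  then have "eventually (\<lambda>y. y \<notin> ?Z) (at w)" by eventually_elim (use 0 in auto)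
  with w(2) show False unfolding islimpt_iff_eventually by blast
qed

lemma continuous_on_bessel: "continuous_on S (bessel n)"
  unfolding bessel_def[abs_def] by (intro continuous_intros) auto

lemma ex_zero_between:
  fixes f :: "real \<Rightarrow> real"
  assumes "continuous_on UNIV f" "f x * f y < 0"
  shows "\<exists>z. min x y \<le> z \<and> z \<le> max x y \<and> f z = 0"
proof -
  have c: "connected (f ` {min x y..max x y})"
    by (intro connected_continuous_image continuous_on_subset[OF assms(1)]) auto
  have "f x \<in> f ` {min x y..max x y}" "f y \<in> f ` {min x y..max x y}" by auto
  moreover have "f x \<le> 0 \<and> 0 \<le> f y \<or> f y \<le> 0 \<and> 0 \<le> f x"
    using assms(2) by (auto simp: mult_less_0_iff)
  ultimately have "0 \<in> f ` {min x y..max x y}"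
    using c unfolding connected_iff_interval by blast
  then show ?thesis by auto
qed

lemma cos_npi_real: "cos (real k * pi + d) = (-1) ^ k * cos d" "sin (real k * pi + d) = (-1) ^ k * sin d"
  by (simp_all add: cos_add sin_add)

lemma alternating_sign:
  fixes A r1 r2 J1 J2 :: real
  assumes "r1 > 0" "r2 > 0" "\<bar>r1 * J1 - A * (-1) ^ m\<bar> < \<bar>A\<bar>" "\<bar>r2 * J2 - A * (-1) ^ Suc m\<bar> < \<bar>A\<bar>"
  shows "J1 * J2 < 0"
proof -
  define B where "B = A * (-1) ^ m"
  have B: "\<bar>B\<bar> = \<bar>A\<bar>" by (simp add: B_def abs_mult)
  have "\<bar>r1 * J1 - B\<bar> < \<bar>B\<bar>" "\<bar>r2 * J2 + B\<bar> < \<bar>B\<bar>"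
    using assms(3,4) unfolding B by (simp_all add: B_def)
  then have "r1 * J1 > 0 \<and> r2 * J2 < 0 \<or> r1 * J1 < 0 \<and> r2 * J2 > 0" by linarith
  then show ?thesis using assms(1,2)
    by (auto simp: zero_less_mult_iff mult_less_0_iff)
qed

text \<open>At x = n pi/2 + i pi the wave equals (-1)^i A, and eventually the error is below |A|;
  hence J_n changes sign between consecutive such points.\<close>

lemma bessel_zeros_unbounded: "\<exists>x>X. bessel n x = 0"
proof -
  obtain A B where AB: "A \<noteq> 0" "\<And>n. (lg_P n \<longlongrightarrow> A) at_top" "\<And>n. (lg_R n \<longlongrightarrow> B) at_top"
    using lg_W_approx by metis
  have "asympt (\<lambda>x. sqrt x * bessel n x) (wave A B n)" using bessel_asympt[OF AB(2,3)] by simp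
  then have "eventually (\<lambda>x. dist (sqrt x * bessel n x - wave A B n x) 0 < \<bar>A\<bar>) at_top"
    unfolding asympt_def using AB(1) tendstoD by force
  then obtain X0 where X0: "\<And>x. x \<ge> X0 \<Longrightarrow> \<bar>sqrt x * bessel n x - wave A B n x\<bar> < \<bar>A\<bar>"
    by (auto simp: eventually_at_top_linorder)
  obtain k :: nat where k: "real k > max X0 (max 0 X)" using reals_Archimedean2 by blast
  define x where "x i = real n * (pi / 2) + real i * pi" for i
  have x_gt: "x i > max X0 (max 0 X)" if "i \<ge> k" for i
  proof -
    have "real k * 1 \<le> real i * pi" using pi_gt3 that by (intro mult_mono) auto
    then have "real k \<le> real i * pi" by simp
    moreover have "real n * (pi / 2) \<ge> 0" by simp
    ultimately show ?thesis unfolding x_def using k by linarith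
  qed
  have w: "wave A B n (x i) = A * (-1) ^ i" for i
    unfolding wave_def x_def using cos_npi_real[of i 0] by simp
  have "\<bar>sqrt (x i) * bessel n (x i) - A * (-1) ^ i\<bar> < \<bar>A\<bar>" if "i \<ge> k" for i
    using X0[of "x i"] x_gt[OF that] unfolding w by linarith
  then have "bessel n (x k) * bessel n (x (Suc k)) < 0"
    using x_gt[of k] x_gt[of "Suc k"]
    by (intro alternating_sign[of "sqrt (x k)" "sqrt (x (Suc k))" _ A k]) (simp_all del: power_Suc)
  from ex_zero_between[OF continuous_on_bessel this] obtain z where "min (x k) (x (Suc k)) \<le> z" "bessel n z = 0" by blast
  with x_gt[of k] x_gt[of "Suc k"] show ?thesis by (intro exI[of _ z]) auto
qed

section \<open>Zeros of J_n relative to the ray x = a n\<close>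

lemma lg_zeta_scale:
  assumes "n > 0"
  shows "lg_zeta n (a * real n) = real n * lg_zeta 1 a"
proof -
  have "(a * real n)\<^sup>2 - (real n)\<^sup>2 = (real n)\<^sup>2 * (a\<^sup>2 - 1)" by (simp add: power_mult_distrib algebra_simps)
  then have "sqrt ((a * real n)\<^sup>2 - (real n)\<^sup>2) = real n * sqrt (a\<^sup>2 - 1)" by (simp add: real_sqrt_mult)
  then show ?thesis using assms by (simp add: lg_zeta_def algebra_simps)
qed

lemma continuous_on_lg_zeta: "real n < u \<Longrightarrow> continuous_on {u..v} (lg_zeta n)"
  by (rule DERIV_continuous_on) (rule has_field_derivative_at_within[OF DERIV_lg_zeta], simp)

lemma lg_zeta_strict_mono:
  assumes "real n < x" "x < y"
  shows "lg_zeta n x < lg_zeta n y"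
proof (rule DERIV_pos_imp_increasing[OF assms(2)])
  fix t assume "x \<le> t"
  then have t: "real n < t" using assms by simp
  show "\<exists>D. (lg_zeta n has_real_derivative D) (at t) \<and> 0 < D"
    using DERIV_lg_zeta[OF t] lg_r_pos[OF t] lg_x_pos[OF t]
    by (intro exI[of _ "lg_r n t ^ 2 / t"]) auto
qed

text \<open>The phase speed \<open>lg_r\<close>^2 / x = sqrt(1 - n^2/x^2) lies between 0 and 1. This
  turns closeness of a zero to a n into closeness of phases.\<close>

lemma lg_zeta_dist:
  assumes "real n < x" "real n < y"
  shows "\<bar>lg_zeta n x - lg_zeta n y\<bar> \<le> \<bar>x - y\<bar>"
proof -
  have *: "\<bar>lg_zeta n v - lg_zeta n u\<bar> \<le> v - u" if uv: "real n < u" "u < v" for u v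
  proof -
    have "lg_zeta n v - v \<le> lg_zeta n u - u"
    proof (rule DERIV_nonpos_imp_nonincreasing[where f = "\<lambda>t. lg_zeta n t - t"])
      fix t assume "u \<le> t" "t \<le> v"
      then have t: "real n < t" using uv by simp
      have "lg_r n t ^ 2 \<le> sqrt (t\<^sup>2)" unfolding lg_r_sq[OF t] by (intro real_sqrt_le_mono) simp
      then have "lg_r n t ^ 2 / t - 1 \<le> 0" using lg_x_pos[OF t] by simp
      then show "\<exists>D. ((\<lambda>t. lg_zeta n t - t) has_real_derivative D) (at t) \<and> D \<le> 0"
        using DERIV_diff[OF DERIV_lg_zeta[OF t] DERIV_ident] by blast
    qed (use uv in simp)
    moreover have "lg_zeta n u < lg_zeta n v" using lg_zeta_strict_mono uv by blast
    ultimately show ?thesis by simp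
  qed
  show ?thesis
    using *[of x y] *[of y x] assms by (cases x y rule: linorder_cases) auto
qed

lemma lg_zeta_1_1: "lg_zeta 1 1 = 0" by (simp add: lg_zeta_def)

text \<open>Includes the turning point 1, which \<open>DERIV_lg_zeta\<close> excludes.\<close>

lemma continuous_on_lg_zeta_1: "continuous_on {1..v} (lg_zeta 1)"
  unfolding lg_zeta_def[abs_def] by (intro continuous_intros) (auto simp: field_simps intro: order_trans[of _ 0])

lemma lg_zeta_1_mono: "1 \<le> b \<Longrightarrow> lg_zeta 1 1 \<le> lg_zeta 1 b"
proof (rule DERIV_nonneg_imp_increasing_open[where f = "lg_zeta 1"])
  show "\<exists>y. (lg_zeta 1 has_real_derivative y) (at t) \<and> 0 \<le> y" if "1 < t" for t
    using DERIV_lg_zeta[of 1 t] that by (intro exI[of _ "lg_r 1 t ^ 2 / t"]) auto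
qed (auto simp: continuous_on_lg_zeta_1 simp del: One_nat_def)

text \<open>Serves unboundedness from below: zeros below a n with a < \<alpha> give very negative
  eigenvalues. Between b n and a n, with 1 < b < a, the phase grows linearly in n, so it passes two
  consecutive multiples of pi, where J_n has the signs of A and - A in some order.\<close>

lemma bessel_zero_le:
  assumes a: "a > 1"
  shows "\<exists>N. \<forall>n\<ge>N. \<exists>x. 0 < x \<and> x \<le> a * real n \<and> bessel n x = 0"
proof -
  obtain A B where A: "A \<noteq> 0" and ap: "\<And>a. a > 1 \<Longrightarrow> \<exists>C>0. \<forall>n x. x \<ge> 1 \<longrightarrow> x \<ge> a * real n \<longrightarrow>
       \<bar>lg_W n x - (A * cos (lg_zeta n x) + B * sin (lg_zeta n x))\<bar> \<le> C / x"
    using lg_W_approx by metis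
  define b where "b = (1 + a) / 2"
  have b: "1 < b" "b < a" using a by (auto simp: b_def)
  obtain C where C: "C > 0" "\<And>n x. x \<ge> 1 \<Longrightarrow> x \<ge> b * real n \<Longrightarrow>
       \<bar>lg_W n x - (A * cos (lg_zeta n x) + B * sin (lg_zeta n x))\<bar> \<le> C / x"
    using ap[OF b(1)] by blast
  define g where "g = lg_zeta 1 a - lg_zeta 1 b"
  have g: "g > 0" unfolding g_def using lg_zeta_strict_mono[of 1 b a] b by simp
  \<comment> \<open>The bound 3 pi / g makes the phase interval longer than 3 pi, room for k pi and
    (k+1) pi; C / |A| pushes the error C / x below |A|.\<close>
  obtain N :: nat where N: "real N > max 1 (max (3 * pi / g) (C / \<bar>A\<bar>))" using reals_Archimedean2 by blast
  have "\<exists>x. 0 < x \<and> x \<le> a * real n \<and> bessel n x = 0" if n: "n \<ge> N" for n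
  proof -
    have nN: "real n > 1" "real n > 3 * pi / g" "real n > C / \<bar>A\<bar>" using n N by linarith+
    have bn: "real n < b * real n" "b * real n < a * real n" using b nN(1) by (auto simp: mult_less_cancel_right1)
    have len: "lg_zeta n (a * real n) - lg_zeta n (b * real n) > 3 * pi"
      using nN g by (simp add: lg_zeta_scale g_def field_simps)
    have "lg_zeta 1 1 \<le> lg_zeta 1 b"
      by (rule lg_zeta_1_mono) (use b in auto)
    then have pos: "lg_zeta n (b * real n) \<ge> 0"
      using nN by (simp add: lg_zeta_scale lg_zeta_1_1 del: One_nat_def)
    define k where "k = nat \<lceil>lg_zeta n (b * real n) / pi\<rceil>"
    have k1: "lg_zeta n (b * real n) \<le> real k * pi" and k2: "real k * pi \<le> lg_zeta n (b * real n) + pi"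
    proof -
      have "real k = of_int \<lceil>lg_zeta n (b * real n) / pi\<rceil>" using pos by (simp add: k_def)
      then have "lg_zeta n (b * real n) / pi \<le> real k" "real k \<le> lg_zeta n (b * real n) / pi + 1" by linarith+
      then show "lg_zeta n (b * real n) \<le> real k * pi" "real k * pi \<le> lg_zeta n (b * real n) + pi"
        by (simp_all add: field_simps)
    qed
    have "\<exists>x. b * real n \<le> x \<and> x \<le> a * real n \<and> lg_zeta n x = real i * pi" if "i = k \<or> i = Suc k" for i
      by (rule IVT') (use that k1 k2 len bn in \<open>auto simp: algebra_simps intro!: continuous_on_lg_zeta\<close>)
    then obtain x1 x2 where x1: "b * real n \<le> x1" "x1 \<le> a * real n" "lg_zeta n x1 = real k * pi"
      and x2: "b * real n \<le> x2" "x2 \<le> a * real n" "lg_zeta n x2 = real (Suc k) * pi" by blast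
    have W: "lg_r n x > 0" "\<bar>lg_r n x * bessel n x - A * (-1) ^ i\<bar> < \<bar>A\<bar>"
      if x: "b * real n \<le> x" "lg_zeta n x = real i * pi" for x i
    proof -
      have xn: "x > real n" using bn x by simp
      then show "lg_r n x > 0" by (rule lg_r_pos)
      have "\<bar>lg_W n x - (A * cos (lg_zeta n x) + B * sin (lg_zeta n x))\<bar> \<le> C / x"
        using xn nN x by (intro C) auto
      also have "\<dots> < \<bar>A\<bar>"
      proof -
        have "C < \<bar>A\<bar> * real n" using nN(3) A by (simp add: field_simps)
        also have "\<dots> \<le> \<bar>A\<bar> * x" using xn by (intro mult_left_mono) auto
        finally show ?thesis using xn nN(1) by (simp add: field_simps)
      qed
      finally show "\<bar>lg_r n x * bessel n x - A * (-1) ^ i\<bar> < \<bar>A\<bar>"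
        using cos_npi_real[of i 0] unfolding x(2) lg_W_def by simp
    qed
    have "bessel n x1 * bessel n x2 < 0"
      by (rule alternating_sign[OF W(1)[OF x1(1,3)] W(1)[OF x2(1,3)] W(2)[OF x1(1,3)] W(2)[OF x2(1,3)]])
    from ex_zero_between[OF continuous_on_bessel this]
    obtain z where z: "min x1 x2 \<le> z" "z \<le> max x1 x2" "bessel n z = 0" by blast
    have "0 < x1" "0 < x2" using x1(1) x2(1) bn(1) nN(1) by linarith+
    then have "0 < min x1 x2" by simp
    moreover have "max x1 x2 \<le> a * real n" using x1 x2 by simp
    ultimately show ?thesis using z by (intro exI[of _ z]) linarith
  qed
  then show ?thesis by blast
qed

lemma bessel_zero_gap:
  assumes a: "a > 1" and m: "lg_zeta 1 a = real m * pi"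
  shows "\<exists>c>0. \<exists>N. \<forall>n\<ge>N. \<forall>x>0. bessel n x = 0 \<longrightarrow> \<bar>x - a * real n\<bar> \<ge> c"
proof -
  obtain A B where A: "A \<noteq> 0" and ap: "\<And>a. a > 1 \<Longrightarrow> \<exists>C>0. \<forall>n x. x \<ge> 1 \<longrightarrow> x \<ge> a * real n \<longrightarrow>
       \<bar>lg_W n x - (A * cos (lg_zeta n x) + B * sin (lg_zeta n x))\<bar> \<le> C / x"
    using lg_W_approx by metis
  define b where "b = (1 + a) / 2"
  have b: "1 < b" "b < a" using a by (auto simp: b_def)
  obtain C where C: "C > 0" "\<And>n x. x \<ge> 1 \<Longrightarrow> x \<ge> b * real n \<Longrightarrow>
       \<bar>lg_W n x - (A * cos (lg_zeta n x) + B * sin (lg_zeta n x))\<bar> \<le> C / x"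
    using ap[OF b(1)] by blast
  \<comment> \<open>Chosen so that |d| < c gives |A cos d + B sin d| \<ge> |A| - (|A| + |B|) |d|
    \<ge> |A|/2.\<close>
  define c where "c = \<bar>A\<bar> / (2 * (\<bar>A\<bar> + \<bar>B\<bar>))"
  have c: "c > 0" "c \<le> 1 / 2" "(\<bar>A\<bar> + \<bar>B\<bar>) * c = \<bar>A\<bar> / 2"
    using A by (auto simp: c_def field_simps)
  \<comment> \<open>The bound 1 / (a - b) keeps every x within distance c < 1 of a n above b n,
    where the approximation holds; 2 C / |A| brings its error below |A|/2.\<close>
  obtain N :: nat where N: "real N > max 1 (max (1 / (a - b)) (2 * C / \<bar>A\<bar>))" using reals_Archimedean2 by blast
  have "\<bar>x - a * real n\<bar> \<ge> c" if n: "n \<ge> N" and x: "x > 0" "bessel n x = 0" for n x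
  proof (rule ccontr)
    assume "\<not> \<bar>x - a * real n\<bar> \<ge> c"
    then have near: "\<bar>x - a * real n\<bar> < c" by simp
    have nN: "real n > 1" "real n > 1 / (a - b)" "real n > 2 * C / \<bar>A\<bar>" using n N by linarith+
    have bn: "real n < b * real n" "b * real n < a * real n" using b nN(1) by (auto simp: mult_less_cancel_right1)
    have "1 < (a - b) * real n" using nN(2) b by (simp add: field_simps)
    then have xb: "b * real n \<le> x" using near c by (simp add: algebra_simps)
    define d where "d = lg_zeta n x - lg_zeta n (a * real n)"
    have d: "\<bar>d\<bar> < c"
      using lg_zeta_dist[of n x "a * real n"] near xb bn by (simp add: d_def)
    have z: "lg_zeta n x = real (n * m) * pi + d"
      using nN by (simp add: d_def lg_zeta_scale m del: One_nat_def)
    have "lg_W n x = 0" using x by (simp add: lg_W_def)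
    moreover have "\<bar>lg_W n x - (A * cos (lg_zeta n x) + B * sin (lg_zeta n x))\<bar> \<le> C / x"
      using nN xb bn by (intro C) linarith+
    ultimately have "\<bar>(-1) ^ (n * m) * (A * cos d + B * sin d)\<bar> \<le> C / x"
      unfolding z cos_npi_real by (simp add: algebra_simps)
    then have "\<bar>A * cos d + B * sin d\<bar> \<le> C / x" by (simp add: abs_mult)
    moreover have "C / x \<le> C / real n"
    proof -
      have "real n \<le> x" "0 < x" "0 < real n" using xb bn nN by linarith+
      then show ?thesis using C(1) by (intro divide_left_mono) auto
    qed
    moreover have "C / real n < \<bar>A\<bar> / 2" using nN A by (simp add: field_simps)
    moreover have "\<bar>A * cos d + B * sin d\<bar> \<ge> \<bar>A\<bar> / 2"
    proof -
      have "\<bar>d\<bar> * \<bar>d\<bar> \<le> \<bar>d\<bar> * 1" using d c by (intro mult_left_mono) auto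
      moreover have "1 - d\<^sup>2 / 2 \<le> cos d"
      proof -
        have "\<bar>sin (d / 2)\<bar>\<^sup>2 \<le> \<bar>d / 2\<bar>\<^sup>2" by (intro power_mono abs_sin_x_le_abs_x) auto
        then show ?thesis using cos_double_sin[of "d / 2"] by (simp add: power2_eq_square)
      qed
      ultimately have "1 - \<bar>d\<bar> \<le> cos d" by (simp add: power2_eq_square abs_mult_self_eq)
      then have "\<bar>A\<bar> * (1 - \<bar>d\<bar>) \<le> \<bar>A\<bar> * \<bar>cos d\<bar>" by (intro mult_left_mono) auto
      moreover have "\<bar>B\<bar> * \<bar>sin d\<bar> \<le> \<bar>B\<bar> * \<bar>d\<bar>" by (intro mult_left_mono abs_sin_x_le_abs_x) auto
      moreover have "(\<bar>A\<bar> + \<bar>B\<bar>) * \<bar>d\<bar> \<le> (\<bar>A\<bar> + \<bar>B\<bar>) * c" using d by (intro mult_left_mono) auto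
      moreover have "\<bar>A * cos d\<bar> - \<bar>B * sin d\<bar> \<le> \<bar>A * cos d + B * sin d\<bar>" by linarith
      ultimately show ?thesis using c(3) by (simp add: abs_mult algebra_simps)
    qed
    ultimately show False by linarith
  qed
  then show ?thesis using c(1) by blast
qed

text \<open>Intermediate values: g(1) = 0, while sqrt(b^2 - 1) \<ge> b - 1 and arccos \<le> pi give
  g(b) \<ge> m pi for b = m pi + pi + 1. The bound m pi \<le> a comes from g(a) \<le> a and makes
  the sequence of these parameters unbounded.\<close>

lemma lg_zeta_1_eq_multiple_pi:
  assumes "m > 0"
  shows "\<exists>a>1. real m * pi \<le> a \<and> lg_zeta 1 a = real m * pi"
proof -
  have "\<exists>a\<ge>1. a \<le> real m * pi + pi + 1 \<and> lg_zeta 1 a = real m * pi"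
  proof (rule IVT')
    let ?b = "real m * pi + pi + 1"
    show "lg_zeta 1 1 \<le> real m * pi" by (simp add: lg_zeta_1_1 del: One_nat_def)
    show "1 \<le> ?b" by simp
    have "?b - 1 \<le> sqrt (?b\<^sup>2 - 1)"
      by (rule real_le_rsqrt) (simp add: power2_eq_square algebra_simps)
    moreover have "arccos (1 / ?b) \<le> pi"
    proof (rule arccos_ubound)
      have "1 \<le> ?b" by simp
      then show "1 / ?b \<le> 1" by (subst divide_le_eq_1_pos) linarith+
      have "0 \<le> 1 / ?b" by simp
      then show "-1 \<le> 1 / ?b" by linarith
    qed
    ultimately show "real m * pi \<le> lg_zeta 1 ?b" by (simp add: lg_zeta_def)
    show "continuous_on {1..?b} (lg_zeta 1)" by (rule continuous_on_lg_zeta_1)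
  qed
  then obtain a where a: "a \<ge> 1" "lg_zeta 1 a = real m * pi" by blast
  have "a \<noteq> 1" using a assms by (auto simp: lg_zeta_1_1 simp del: One_nat_def)
  moreover have "lg_zeta 1 a \<le> a"
  proof -
    have "sqrt (a\<^sup>2 - 1) \<le> a" using a by (intro real_le_lsqrt) auto
    moreover have "arccos (1 / a) \<ge> 0" using a by (intro arccos_lbound) (auto simp: field_simps)
    ultimately show ?thesis by (simp add: lg_zeta_def)
  qed
  ultimately show ?thesis using a by (intro exI[of _ a]) auto
qed

section \<open>Enumeration of the zeros\<close>

lemma card_Int_atMost_less:
  fixes S :: "real set"
  assumes fin: "finite (S \<inter> {..y})" and y: "y \<in> S" "x < y"
  shows "card (S \<inter> {..x}) < card (S \<inter> {..y})"
proof (rule psubset_card_mono[OF fin], rule psubsetI)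
  show "S \<inter> {..x} \<subseteq> S \<inter> {..y}" using y by auto
  have "y \<in> S \<inter> {..y}" "y \<notin> S \<inter> {..x}" using y by auto
  then show "S \<inter> {..x} \<noteq> S \<inter> {..y}" by blast
qed

text \<open>What makes the definite description in \<open>Bessel_zero\<close> meaningful. Existence
  steps from each element to its successor, which local finiteness provides; uniqueness is strict
  growth of the counting function.\<close>

lemma ex1_card_eq:
  fixes S :: "real set"
  assumes fin: "\<And>x. finite (S \<inter> {..x})" and unb: "\<And>X. \<exists>x\<in>S. x > X" and pos: "\<And>x. x \<in> S \<Longrightarrow> x > 0" and k: "k \<ge> 1"
  shows "\<exists>!x. x \<in> S \<and> card (S \<inter> {..x}) = k"
proof -
  have least: "\<exists>y\<in>S. y > X \<and> (\<forall>z\<in>S. z > X \<longrightarrow> y \<le> z)" for X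
  proof -
    obtain u where u: "u \<in> S" "u > X" using unb by blast
    let ?F = "(S \<inter> {..u}) \<inter> {X<..}"
    have F: "finite ?F" "?F \<noteq> {}" using fin[of u] u by auto
    have "Min ?F \<in> ?F" using F by (rule Min_in)
    moreover have "Min ?F \<le> z" if "z \<in> S" "z > X" for z
      using that u F by (cases "z \<le> u") (auto intro: Min_le order_trans[OF Min_le])
    ultimately show ?thesis by blast
  qed
  have ex: "\<exists>x. x \<in> S \<and> card (S \<inter> {..x}) = Suc k" for k
  proof (induction k)
    case 0
    obtain y where y: "y \<in> S" "\<forall>z\<in>S. z > 0 \<longrightarrow> y \<le> z" using least by blast
    then have "S \<inter> {..y} = {y}" using pos by force
    then show ?case using y by auto
  next
    case (Suc k)
    then obtain x where x: "x \<in> S" "card (S \<inter> {..x}) = Suc k" by blast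
    obtain y where y: "y \<in> S" "y > x" "\<forall>z\<in>S. z > x \<longrightarrow> y \<le> z" using least by blast
    then have "S \<inter> {..y} = insert y (S \<inter> {..x})" by force
    then have "card (S \<inter> {..y}) = Suc (Suc k)" using x y fin[of x] by simp
    then show ?case using y by blast
  qed
  note mono = card_Int_atMost_less[OF fin]
  show ?thesis
  proof (rule ex_ex1I)
    show "\<exists>x. x \<in> S \<and> card (S \<inter> {..x}) = k" using ex[of "k - 1"] k by simp
    show "x = y" if "x \<in> S \<and> card (S \<inter> {..x}) = k" "y \<in> S \<and> card (S \<inter> {..y}) = k" for x y
      using mono[of y x] mono[of x y] that by (cases x y rule: linorder_cases) auto
  qed
qed

lemma Bessel_J_eq_bessel: "x \<ge> 0 \<Longrightarrow> Bessel_J (real l) x = bessel l x"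
  by (simp add: Bessel_J_clifford bessel_def)

definition bessel_zeros :: "nat \<Rightarrow> real set" where
  "bessel_zeros l = {x. x > 0 \<and> bessel l x = 0}"

lemma finite_bessel_zeros: "finite (bessel_zeros l \<inter> {..X})"
proof -
  have "(\<lambda>x. x\<^sup>2 / 4) ` (bessel_zeros l \<inter> {..X}) \<subseteq> {y. 0 \<le> y \<and> y \<le> X\<^sup>2 / 4 \<and> clifford l y = 0}"
    by (auto simp: bessel_zeros_def bessel_def power_mono)
  then have "finite ((\<lambda>x. x\<^sup>2 / 4) ` (bessel_zeros l \<inter> {..X}))"
    using finite_clifford_zeros finite_subset by blast
  moreover have "inj_on (\<lambda>x. x\<^sup>2 / 4) (bessel_zeros l \<inter> {..X})"
    by (rule inj_onI) (auto simp: bessel_zeros_def power2_eq_iff)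
  ultimately show ?thesis using finite_imageD by blast
qed

abbreviation (input) bz :: "nat \<Rightarrow> nat \<Rightarrow> real" where
  "bz l k \<equiv> Bessel_zero (real l) k"

context
  fixes l k :: nat
  assumes k: "k \<ge> 1"
begin

lemma bz_props: "bz l k \<in> bessel_zeros l" "card (bessel_zeros l \<inter> {..bz l k}) = k"
proof -
  have *: "(x > 0 \<and> Bessel_J (real l) x = 0 \<and> card {y. 0 < y \<and> y \<le> x \<and> Bessel_J (real l) y = 0} = k)
     \<longleftrightarrow> (x \<in> bessel_zeros l \<and> card (bessel_zeros l \<inter> {..x}) = k)" for x
  proof -
    have "{y. 0 < y \<and> y \<le> x \<and> Bessel_J (real l) y = 0} = bessel_zeros l \<inter> {..x}"
      by (auto simp: bessel_zeros_def Bessel_J_eq_bessel)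
    then show ?thesis by (auto simp: bessel_zeros_def Bessel_J_eq_bessel)
  qed
  have "\<exists>!x. x \<in> bessel_zeros l \<and> card (bessel_zeros l \<inter> {..x}) = k"
  proof (rule ex1_card_eq[OF finite_bessel_zeros _ _ k])
    show "\<exists>x\<in>bessel_zeros l. X < x" for X
      using bessel_zeros_unbounded[of "max 0 X" l] by (auto simp: bessel_zeros_def)
  qed (simp add: bessel_zeros_def)
  from theI'[OF this] show "bz l k \<in> bessel_zeros l" "card (bessel_zeros l \<inter> {..bz l k}) = k"
    unfolding Bessel_zero_def * by auto
qed

lemma bz_pos: "bz l k > 0" and bessel_bz: "bessel l (bz l k) = 0"
  using bz_props(1) by (auto simp: bessel_zeros_def)

end

lemma bz_less:
  assumes "1 \<le> k" "k < k'"
  shows "bz l k < bz l k'"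
proof (rule ccontr)
  assume "\<not> bz l k < bz l k'"
  then have "card (bessel_zeros l \<inter> {..bz l k'}) \<le> card (bessel_zeros l \<inter> {..bz l k})"
    by (intro card_mono finite_bessel_zeros) auto
  then show False using bz_props(2)[of k l] bz_props(2)[of k' l] assms by simp
qed

lemma inj_on_bz: "inj_on (bz l) {1..}"
proof (rule inj_onI)
  fix k k' :: nat
  assume "k \<in> {1..}" "k' \<in> {1..}" "bz l k = bz l k'"
  then show "k = k'" using bz_less[of k k' l] bz_less[of k' k l] by (cases k k' rule: linorder_cases) auto
qed

lemma bessel_zero_imp_bz:
  assumes "x > 0" "bessel l x = 0"
  shows "\<exists>k\<ge>1. x = bz l k"
proof -
  let ?k = "card (bessel_zeros l \<inter> {..x})"
  have x: "x \<in> bessel_zeros l" using assms by (simp add: bessel_zeros_def)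
  then have k: "?k \<ge> 1" using finite_bessel_zeros[of l x] by (metis Int_iff One_nat_def Suc_leI atMost_iff card_gt_0_iff empty_iff order_refl)
  have "x = bz l ?k"
  proof (rule ccontr)
    assume "x \<noteq> bz l ?k"
    then consider "x < bz l ?k" | "bz l ?k < x" by linarith
    then show False
    proof cases
      case 1
      then have "card (bessel_zeros l \<inter> {..x}) < card (bessel_zeros l \<inter> {..bz l ?k})"
        using bz_props(1)[OF k, of l] by (intro card_Int_atMost_less finite_bessel_zeros)
      then show False using bz_props(2)[OF k, of l] by simp
    next
      case 2
      then have "card (bessel_zeros l \<inter> {..bz l ?k}) < card (bessel_zeros l \<inter> {..x})"
        using x by (intro card_Int_atMost_less finite_bessel_zeros)
      then show False using bz_props(2)[OF k, of l] by simp
    qed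
  qed
  with k show ?thesis by blast
qed

text \<open>The first two terms of the series: the derivative is - C_{l+1}, and the energy started
  at 0 bounds C_{l+1} by its value 1/(l+1)! there.\<close>

lemma clifford_lower:
  assumes "y \<ge> 0"
  shows "clifford l y \<ge> (1 - y / (real l + 1)) / fact l"
proof -
  have b: "clifford (Suc l) t \<le> 1 / fact (Suc l)" if "t \<ge> 0" for t
  proof (rule power2_le_imp_le)
    have "(clifford (Suc l) t)\<^sup>2 + t * (clifford (Suc (Suc l)) t)\<^sup>2 \<le> (1 / fact (Suc l))\<^sup>2"
      using clifford_energy_antimono[of 0 t "Suc l"] that by (simp del: fact_Suc)
    moreover have "t * (clifford (Suc (Suc l)) t)\<^sup>2 \<ge> 0" using that by simp
    ultimately show "(clifford (Suc l) t)\<^sup>2 \<le> (1 / fact (Suc l))\<^sup>2" by linarith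
  qed simp
  have "clifford l 0 + 0 / fact (Suc l) \<le> clifford l y + y / fact (Suc l)"
  proof (rule DERIV_nonneg_imp_nondecreasing[OF assms, where f = "\<lambda>y. clifford l y + y / fact (Suc l)"])
    fix t assume "0 \<le> t" "t \<le> y"
    moreover have "((\<lambda>y. clifford l y + y / fact (Suc l)) has_real_derivative - clifford (Suc l) t * 1 + 1 / fact (Suc l)) (at t)"
      by (intro derivative_intros DERIV_cdivide)
    ultimately show "\<exists>D. ((\<lambda>y. clifford l y + y / fact (Suc l)) has_real_derivative D) (at t) \<and> 0 \<le> D"
      using b[of t] by (intro exI[of _ "- clifford (Suc l) t * 1 + 1 / fact (Suc l)"]) auto
  qed
  then have "clifford l y \<ge> 1 / fact l - y / fact (Suc l)" by simp
  moreover have "1 / fact l - y / fact (Suc l) = (1 - y / (real l + 1)) / fact l"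
  proof -
    have "fact (Suc l) = (real l + 1) * fact l" by (simp add: algebra_simps)
    then show ?thesis by (simp add: diff_divide_distrib)
  qed
  ultimately show ?thesis by simp
qed

text \<open>A crude bound, but it limits the order of a zero below X by X^2 and so leaves only
  finitely many pairs (l, k) with \<open>bz l k\<close> \<le> X.\<close>

lemma bz_lower:
  assumes "k \<ge> 1"
  shows "(bz l k)\<^sup>2 / 4 \<ge> real l + 1"
proof (rule ccontr)
  assume "\<not> (bz l k)\<^sup>2 / 4 \<ge> real l + 1"
  then have "(bz l k)\<^sup>2 / 4 / (real l + 1) < 1" by (simp add: field_simps)
  then have "0 < (1 - (bz l k)\<^sup>2 / 4 / (real l + 1)) / fact l" by (intro divide_pos_pos) auto
  also have "\<dots> \<le> clifford l ((bz l k)\<^sup>2 / 4)" by (rule clifford_lower) simp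
  finally show False using bessel_bz[OF assms, of l] bz_pos[OF assms, of l] by (simp add: bessel_def)
qed

lemma finite_bz_le: "finite {(l, k). k \<ge> 1 \<and> bz l k \<le> X}"
proof -
  have "{(l, k). k \<ge> 1 \<and> bz l k \<le> X} \<subseteq> (SIGMA l : {l. real l \<le> X\<^sup>2}. {k. k \<ge> 1 \<and> bz l k \<le> X})"
  proof safe
    fix l k assume k: "1 \<le> k" "bz l k \<le> X"
    have "(bz l k)\<^sup>2 \<le> X\<^sup>2" using bz_pos[OF k(1), of l] k(2) by (intro power_mono) auto
    then show "real l \<le> X\<^sup>2" using bz_lower[OF k(1), of l] by simp
  qed
  moreover have "finite {l. real l \<le> Y}" for Y
  proof -
    have "{l. real l \<le> Y} \<subseteq> {..nat \<lceil>Y\<rceil>}" by (auto simp: le_nat_iff) linarith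
    then show ?thesis using finite_subset by blast
  qed
  moreover have "finite {k. k \<ge> 1 \<and> bz l k \<le> X}" for l
  proof -
    have "bz l ` {k. k \<ge> 1 \<and> bz l k \<le> X} \<subseteq> bessel_zeros l \<inter> {..X}" using bz_props(1) by auto
    then have "finite (bz l ` {k. k \<ge> 1 \<and> bz l k \<le> X})" using finite_bessel_zeros finite_subset by blast
    then show ?thesis by (rule finite_imageD) (rule inj_on_subset[OF inj_on_bz], auto)
  qed
  ultimately show ?thesis by (elim finite_subset) (intro finite_SigmaI)
qed

text \<open>The zeros in the variable y = x^2/4. They are the eigenvalues w of - (y^(l+1) e')' = w
  y^l e on (0,1) with e regular at 0 and e(1) = 0.\<close>

definition cz :: "nat \<Rightarrow> nat \<Rightarrow> real" where
  "cz l k = (bz l k)\<^sup>2 / 4"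

lemma cz_pos: "k \<ge> 1 \<Longrightarrow> cz l k > 0"
  using bz_pos[of k l] by (simp add: cz_def)

lemma cz_less: "1 \<le> k \<Longrightarrow> k < k' \<Longrightarrow> cz l k < cz l k'"
  using bz_less[of k k' l] bz_pos[of k l] by (simp add: cz_def power_strict_mono)

lemma clifford_cz: "k \<ge> 1 \<Longrightarrow> clifford l (cz l k) = 0"
  using bessel_bz[of k l] bz_pos[of k l] by (simp add: cz_def bessel_def)

lemma clifford_zero_imp_cz:
  assumes "y > 0" "clifford l y = 0"
  shows "\<exists>k\<ge>1. y = cz l k"
proof -
  have "bessel l (2 * sqrt y) = 0" using assms by (simp add: bessel_def power_mult_distrib)
  then obtain k where "k \<ge> 1" "2 * sqrt y = bz l k" using bessel_zero_imp_bz[of "2 * sqrt y"] assms by auto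
  moreover have "cz l k = y"
    unfolding cz_def \<open>2 * sqrt y = bz l k\<close>[symmetric] using assms by (simp add: power_mult_distrib)
  ultimately show ?thesis by blast
qed

lemma cz_unbounded: "\<exists>n0. \<forall>n\<ge>n0. cz l n > X"
proof -
  have "finite {k. k \<ge> 1 \<and> bz l k \<le> sqrt (4 * \<bar>X\<bar>)}"
  proof -
    have "bz l ` {k. k \<ge> 1 \<and> bz l k \<le> sqrt (4 * \<bar>X\<bar>)} \<subseteq> bessel_zeros l \<inter> {..sqrt (4 * \<bar>X\<bar>)}" using bz_props(1) by auto
    then have "finite (bz l ` {k. k \<ge> 1 \<and> bz l k \<le> sqrt (4 * \<bar>X\<bar>)})" using finite_bessel_zeros finite_subset by blast
    then show ?thesis by (rule finite_imageD) (rule inj_on_subset[OF inj_on_bz], auto)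
  qed
  then obtain n0 where n0: "\<And>k. k \<ge> 1 \<Longrightarrow> bz l k \<le> sqrt (4 * \<bar>X\<bar>) \<Longrightarrow> k < n0"
    by (metis (mono_tags, lifting) finite_nat_set_iff_bounded mem_Collect_eq)
  have "cz l n > X" if "n \<ge> max 1 n0" for n
  proof -
    have "sqrt (4 * \<bar>X\<bar>) < bz l n" using n0[of n] that by force
    then have "sqrt (4 * \<bar>X\<bar>) ^ 2 < (bz l n)\<^sup>2" by (intro power_strict_mono) auto
    then show ?thesis by (simp add: cz_def)
  qed
  then show ?thesis by blast
qed

section \<open>Completeness of the radial eigenfunctions\<close>

text \<open>Gaussian elimination, one pivot per induction step. It supplies the trial function in
  the minimax argument.\<close>

lemma homogeneous_system_nontrivial:
  fixes A :: "'i \<Rightarrow> 'j \<Rightarrow> real"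
  assumes "finite I" "finite J" "card I < card J"
  shows "\<exists>x. (\<exists>j\<in>J. x j \<noteq> 0) \<and> (\<forall>i\<in>I. (\<Sum>j\<in>J. A i j * x j) = 0)"
  using assms
proof (induction I arbitrary: J A rule: finite_induct)
  case empty
  then obtain j where "j \<in> J" by (metis card_gt_0_iff equals0I card.empty)
  then show ?case by (intro exI[of _ "\<lambda>_. 1"]) auto
next
  case (insert i0 I)
  show ?case
  proof (cases "\<forall>j\<in>J. A i0 j = 0")
    case True
    have "card I < card J" using insert by simp
    from insert.IH[OF insert.prems(1) this, of A] show ?thesis using True by auto
  next
    case False
    then obtain j0 where j0: "j0 \<in> J" "A i0 j0 \<noteq> 0" by blast
    let ?J = "J - {j0}"
    have "card I < card ?J" using insert j0 by simp
    with insert.IH[of ?J "\<lambda>i j. A i j - A i j0 * A i0 j / A i0 j0"] insert.prems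
    obtain x where x: "\<exists>j\<in>?J. x j \<noteq> 0" "\<forall>i\<in>I. (\<Sum>j\<in>?J. (A i j - A i j0 * A i0 j / A i0 j0) * x j) = 0"
      by auto
    define y where "y = x(j0 := - (\<Sum>j\<in>?J. A i0 j * x j) / A i0 j0)"
    have s: "(\<Sum>j\<in>J. A i j * y j) = A i j0 * y j0 + (\<Sum>j\<in>?J. A i j * x j)" for i
    proof -
      have "(\<Sum>j\<in>J. A i j * y j) = A i j0 * y j0 + (\<Sum>j\<in>?J. A i j * y j)"
        using j0 insert.prems by (intro sum.remove)
      also have "(\<Sum>j\<in>?J. A i j * y j) = (\<Sum>j\<in>?J. A i j * x j)"
        by (intro sum.cong) (auto simp: y_def)
      finally show ?thesis .
    qed
    have "(\<Sum>j\<in>J. A i j * y j) = 0" if "i \<in> I" for i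
    proof -
      have "(\<Sum>j\<in>?J. (A i j - A i j0 * A i0 j / A i0 j0) * x j)
        = (\<Sum>j\<in>?J. A i j * x j) - A i j0 / A i0 j0 * (\<Sum>j\<in>?J. A i0 j * x j)"
        by (simp add: sum_distrib_left sum_subtractf algebra_simps)
      moreover have "y j0 = - (\<Sum>j\<in>?J. A i0 j * x j) / A i0 j0" by (simp add: y_def)
      ultimately show ?thesis using x(2) that unfolding s by simp
    qed
    moreover have "(\<Sum>j\<in>J. A i0 j * y j) = 0" unfolding s using j0 by (simp add: y_def)
    moreover have "\<exists>j\<in>J. y j \<noteq> 0" using x(1) by (auto simp: y_def)
    ultimately show ?thesis by (intro exI[of _ y]) auto
  qed
qed

text \<open>In the variable y = r^2 the disk products of the functions r^l q(r^2) cos(l \<theta>)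
  are multiples of this with m = l. Their derivatives are paired with the weight m = l + 1 of the
  Sturm--Liouville form.\<close>

definition wip :: "nat \<Rightarrow> (real \<Rightarrow> real) \<Rightarrow> (real \<Rightarrow> real) \<Rightarrow> real" where
  "wip m f g = integral {0..1} (\<lambda>y. y ^ m * (f y * g y))"

lemma wip_integrable:
  assumes "continuous_on {0..1} f" "continuous_on {0..1} g"
  shows "(\<lambda>y. y ^ m * (f y * g y)) integrable_on {0..1::real}"
  by (intro integrable_continuous_real continuous_intros assms)

lemma wip_commute: "wip m f g = wip m g f"
  by (simp add: wip_def mult.commute)

lemma wip_self_nonneg:
  assumes "continuous_on {0..1} f"
  shows "wip m f f \<ge> 0"
  unfolding wip_def by (intro integral_nonneg wip_integrable assms) auto

lemma wip_sum_left:
  assumes "\<And>i. i \<in> I \<Longrightarrow> continuous_on {0..1} (f i)" "continuous_on {0..1} g"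
  shows "wip m (\<lambda>y. \<Sum>i\<in>I. c i * f i y) g = (\<Sum>i\<in>I. c i * wip m (f i) g)"
proof (cases "finite I")
  case True
  have "(\<lambda>y. y ^ m * ((\<Sum>i\<in>I. c i * f i y) * g y)) = (\<lambda>y. \<Sum>i\<in>I. c i * (y ^ m * (f i y * g y)))"
    by (simp add: sum_distrib_left sum_distrib_right algebra_simps)
  then have "wip m (\<lambda>y. \<Sum>i\<in>I. c i * f i y) g = (\<Sum>i\<in>I. integral {0..1} (\<lambda>y. c i * (y ^ m * (f i y * g y))))"
    unfolding wip_def using assms
    by (simp only:) (intro integral_sum True integrable_on_mult_right wip_integrable; simp)
  then show ?thesis by (simp add: wip_def)
qed (simp add: wip_def)

lemma wip_sum_orthogonal:
  assumes "finite I" "\<And>i. i \<in> I \<Longrightarrow> continuous_on {0..1} (f i)"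
    and orth: "\<And>i j. i \<in> I \<Longrightarrow> j \<in> I \<Longrightarrow> i \<noteq> j \<Longrightarrow> wip m (f i) (f j) = 0"
  shows "wip m (\<lambda>y. \<Sum>i\<in>I. c i * f i y) (\<lambda>y. \<Sum>i\<in>I. c i * f i y) = (\<Sum>i\<in>I. (c i)\<^sup>2 * wip m (f i) (f i))"
proof -
  let ?s = "\<lambda>y. \<Sum>i\<in>I. c i * f i y"
  have cs: "continuous_on {0..1} ?s" by (intro continuous_intros assms(2))
  have "wip m ?s ?s = (\<Sum>i\<in>I. c i * wip m (f i) ?s)"
    by (rule wip_sum_left[OF assms(2) cs])
  also have "\<dots> = (\<Sum>i\<in>I. c i * wip m ?s (f i))"
    by (intro sum.cong refl arg_cong2[where f = "(*)"] wip_commute)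
  also have "\<dots> = (\<Sum>i\<in>I. (c i)\<^sup>2 * wip m (f i) (f i))"
  proof (rule sum.cong)
    fix i assume i: "i \<in> I"
    have "wip m ?s (f i) = (\<Sum>j\<in>I. c j * wip m (f j) (f i))" by (rule wip_sum_left) (use assms i in auto)
    also have "\<dots> = (\<Sum>j\<in>I. if j = i then c i * wip m (f i) (f i) else 0)"
      using i orth by (intro sum.cong) auto
    also have "\<dots> = c i * wip m (f i) (f i)" using i assms(1) by simp
    finally show "c i * wip m ?s (f i) = (c i)\<^sup>2 * wip m (f i) (f i)" by (simp add: power2_eq_square)
  qed simp
  finally show ?thesis .
qed

text \<open>The derivative is carried along explicitly, and on the whole line, which avoids
  one-sided derivatives at 0 and 1.\<close>

definition is_C1 :: "(real \<Rightarrow> real) \<Rightarrow> (real \<Rightarrow> real) \<Rightarrow> bool" where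
  "is_C1 v v' \<longleftrightarrow> (\<forall>y. (v has_real_derivative v' y) (at y)) \<and> continuous_on UNIV v'"

lemma is_C1D:
  assumes "is_C1 v v'"
  shows "(v has_real_derivative v' y) (at y)" "continuous_on S v'" "continuous_on S v"
proof -
  show d: "(v has_real_derivative v' y) (at y)" for y using assms by (simp add: is_C1_def)
  show "continuous_on S v'" using assms continuous_on_subset by (auto simp: is_C1_def)
  show "continuous_on S v" by (rule DERIV_continuous_on[OF has_field_derivative_at_within[OF d]])
qed

lemma is_C1_sum:
  assumes "\<And>i. i \<in> I \<Longrightarrow> is_C1 (f i) (f' i)"
  shows "is_C1 (\<lambda>y. \<Sum>i\<in>I. c i * f i y) (\<lambda>y. \<Sum>i\<in>I. c i * f' i y)"
  unfolding is_C1_def using is_C1D[OF assms]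
  by (auto intro!: DERIV_sum DERIV_cmult continuous_intros)

text \<open>Rescaled so that the k-th zero lands at 1. Up to a constant factor this is r^(-l) J_l(j
  r) in the variable y = r^2.\<close>

definition ce :: "nat \<Rightarrow> nat \<Rightarrow> real \<Rightarrow> real" where
  "ce l k y = clifford l (cz l k * y)"

definition ce' :: "nat \<Rightarrow> nat \<Rightarrow> real \<Rightarrow> real" where
  "ce' l k y = - cz l k * clifford (Suc l) (cz l k * y)"

lemma is_C1_ce: "is_C1 (ce l k) (ce' l k)"
  unfolding is_C1_def ce_def[abs_def] ce'_def[abs_def]
  by (auto intro!: derivative_eq_intros continuous_intros)

lemma ce_1: "k \<ge> 1 \<Longrightarrow> ce l k 1 = 0"
  by (simp add: ce_def clifford_cz)

lemma ce_0: "ce l k 0 \<noteq> 0" by (simp add: ce_def)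

text \<open>The Bessel equation in Sturm--Liouville form; after the product rule it is
  \<open>clifford_rec\<close> once more.\<close>

lemma DERIV_weight_ce':
  "((\<lambda>y. y ^ Suc l * ce' l k y) has_real_derivative - (cz l k * y ^ l * ce l k y)) (at y)"
proof -
  let ?w = "cz l k"
  have "((\<lambda>y. y ^ Suc l * ce' l k y) has_real_derivative
     - (?w * y ^ l * ((real l + 1) * clifford (Suc l) (?w * y) - ?w * y * clifford (Suc (Suc l)) (?w * y)))) (at y)"
    unfolding ce'_def
    by (auto intro!: derivative_eq_intros simp: algebra_simps simp del: power_Suc)
       (simp add: algebra_simps)
  also have "(real l + 1) * clifford (Suc l) (?w * y) - ?w * y * clifford (Suc (Suc l)) (?w * y) = ce l k y"
    unfolding ce_def by (rule clifford_rec[symmetric])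
  finally show ?thesis .
qed

text \<open>Integration by parts. The boundary term vanishes at 1 through v and at 0 through the
  weight y^(l+1).\<close>

lemma wip_weak_eigen:
  assumes "is_C1 v v'" "v 1 = 0"
  shows "wip (Suc l) v' (ce' l k) = cz l k * wip l v (ce l k)"
proof -
  note c = is_C1D[OF assms(1)] is_C1D[OF is_C1_ce[of l k]]
  let ?f = "\<lambda>y. (y ^ Suc l * ce' l k y) * v y"
  have "(?f has_vector_derivative - (cz l k * y ^ l * ce l k y) * v y + v' y * (y ^ Suc l * ce' l k y)) (at y within {0..1})" for y
    using DERIV_mult[OF DERIV_weight_ce' c(1), THEN has_field_derivative_at_within]
    by (simp only: has_real_derivative_iff_has_vector_derivative)
  then have "((\<lambda>y. - (cz l k * y ^ l * ce l k y) * v y + v' y * (y ^ Suc l * ce' l k y)) has_integral (?f 1 - ?f 0)) {0..1}"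
    by (intro fundamental_theorem_of_calculus) auto
  then have "integral {0..1} (\<lambda>y. y ^ Suc l * (v' y * ce' l k y) - cz l k * (y ^ l * (v y * ce l k y))) = 0"
    using assms(2) by (intro integral_unique) (simp add: algebra_simps)
  then show ?thesis
    unfolding wip_def
    by (subst (asm) integral_diff) (auto intro!: wip_integrable integrable_on_mult_right[OF wip_integrable] c simp del: power_Suc)
qed

lemma wip_ce_orthogonal:
  assumes "1 \<le> i" "1 \<le> j" "i \<noteq> j"
  shows "wip l (ce l i) (ce l j) = 0" "wip (Suc l) (ce' l i) (ce' l j) = 0"
proof -
  have "cz l j * wip l (ce l i) (ce l j) = cz l i * wip l (ce l j) (ce l i)"
    using wip_weak_eigen[OF is_C1_ce ce_1[of i l], of l j] wip_weak_eigen[OF is_C1_ce ce_1[of j l], of l i] assms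
    by (simp add: wip_commute)
  moreover have "cz l i \<noteq> cz l j" using cz_less[of i j l] cz_less[of j i l] assms by (cases i j rule: linorder_cases) auto
  ultimately show *: "wip l (ce l i) (ce l j) = 0" by (simp add: wip_commute)
  show "wip (Suc l) (ce' l i) (ce' l j) = 0"
    using wip_weak_eigen[OF is_C1_ce ce_1[of i l], of l j] * assms by simp
qed

lemma wip_ce_pos: "wip l (ce l k) (ce l k) > 0"
proof -
  have c: "continuous_on {0..1} (ce l k)" by (rule is_C1D[OF is_C1_ce])
  have "wip l (ce l k) (ce l k) \<noteq> 0"
  proof
    assume "wip l (ce l k) (ce l k) = 0"
    then have z: "y ^ l * (ce l k y * ce l k y) = 0" if "y \<in> cbox 0 1" for y
      unfolding wip_def using c that
      by (intro integral_cbox_eq_0_iff[THEN iffD1, rule_format, of 0 1 "\<lambda>y. y ^ l * (ce l k y * ce l k y)"])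
         (auto intro!: continuous_intros)
    \<comment> \<open>For l > 0 the weight vanishes at 0, so the contradiction is drawn at small
      positive y, where \<open>ce l k\<close> is still nonzero.\<close>
    have "(ce l k \<longlongrightarrow> ce l k 0) (at_right 0)"
      using is_C1D(1)[OF is_C1_ce, of l k 0, THEN DERIV_isCont] by (simp add: isCont_def filterlim_at_split)
    then have "eventually (\<lambda>y. ce l k y \<noteq> 0) (at_right 0)"
      by (rule tendsto_imp_eventually_ne) (rule ce_0)
    moreover have "eventually (\<lambda>y::real. 0 < y \<and> y < 1) (at_right 0)"
      unfolding eventually_at_right_field by (intro exI[of _ 1]) auto
    ultimately have "eventually (\<lambda>y::real. False) (at_right 0)"
    proof eventually_elim
      case (elim y)
      then show False using z[of y] by simp
    qed
    then show False by simp
  qed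
  with wip_self_nonneg[OF c, of l] show ?thesis by simp
qed

text \<open>Jacobi's completion of the square: off the zeros of an eigenfunction \<open>e\<close>,
  \<open>y\<^sup>l\<^sup>+\<^sup>1 v'\<^sup>2 - w y\<^sup>l v\<^sup>2 = y\<^sup>l\<^sup>+\<^sup>1 (v' - v e' / e)\<^sup>2 + (y\<^sup>l\<^sup>+\<^sup>1 v\<^sup>2 e' / e)'\<close>, and the function differentiated
  extends continuously to the zeros of \<open>e\<close> when \<open>v\<close> vanishes there.\<close>

lemma Jacobi_inequality:
  assumes v: "is_C1 v v'" and n: "n \<ge> 1" and zero: "\<And>i. 1 \<le> i \<Longrightarrow> i \<le> n \<Longrightarrow> v (cz l i / cz l n) = 0"
  shows "cz l n * wip l v v \<le> wip (Suc l) v' v'"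
proof -
  let ?e = "ce l n" and ?e' = "ce' l n" and ?w = "cz l n"
  have w: "?w > 0" using cz_pos n by simp
  note cv = is_C1D[OF v] and ceD = is_C1D[OF is_C1_ce[of l n]]
  \<comment> \<open>These are the points cz l i / cz l n with i \<le> n. The case i = n is the
    endpoint 1, so the assumption makes v vanish there too.\<close>
  define Z where "Z = {y \<in> {0..1}. ?e y = 0}"
  have Z: "\<exists>i. 1 \<le> i \<and> i \<le> n \<and> y = cz l i / ?w" if "y \<in> Z" for y
  proof -
    have "y \<noteq> 0" using that ce_0[of l n] by (auto simp: Z_def)
    then have y: "0 < y" "y \<le> 1" "?e y = 0" using that by (auto simp: Z_def)
    then obtain i where i: "i \<ge> 1" "?w * y = cz l i"
      using clifford_zero_imp_cz[of "?w * y" l] w by (auto simp: ce_def)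
    have "cz l i \<le> ?w" using y w i(2) by (metis mult.right_neutral mult_le_cancel_left_pos)
    then have "i \<le> n" using cz_less[OF n, of i l] by (meson linorder_not_less)
    then show ?thesis using i w by (intro exI[of _ i]) (auto simp: field_simps)
  qed
  have finZ: "finite Z"
    by (rule finite_subset[of _ "(\<lambda>i. cz l i / ?w) ` {1..n}"]) (use Z in force)+
  have vZ: "v y = 0" if "y \<in> Z" for y using Z[OF that] zero by auto
  have e'Z: "?e' y \<noteq> 0" if "y \<in> Z" for y
  proof -
    have "y > 0" using that ce_0[of l n] by (auto simp: Z_def less_le)
    then have "clifford (Suc l) (?w * y) \<noteq> 0" using that w by (intro clifford_simple_zero) (auto simp: Z_def ce_def)
    then show ?thesis using w by (simp add: ce'_def)
  qed
  define G where "G y = y ^ Suc l * (v y)\<^sup>2 * ?e' y / ?e y" for y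
  define F where "F y = y ^ Suc l * (v' y * v' y) - ?w * (y ^ l * (v y * v y))" for y
  define H where "H y = y ^ Suc l * (v' y - v y * ?e' y / ?e y)\<^sup>2" for y
  have contG: "continuous_on {0..1} G"
  proof (rule continuous_at_imp_continuous_on, rule ballI)
    fix y :: real assume y: "y \<in> {0..1}"
    show "isCont G y"
    proof (cases "?e y = 0")
      case False
      have "isCont v y" "isCont ?e y" by (auto intro: DERIV_isCont cv(1) ceD(1))
      moreover have "isCont ?e' y" using ceD(2)[of UNIV] by (simp add: continuous_on_eq_continuous_at)
      ultimately show ?thesis unfolding G_def using False by (intro continuous_intros)
    next
      case True
      \<comment> \<open>The zero of e is simple, so v / e tends to v' / e'. The remaining factor v
        sends the product to 0, which agrees with the value of \<open>G\<close> under division by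
        zero.\<close>
      then have yZ: "y \<in> Z" using y by (simp add: Z_def)
      have "((\<lambda>t. (v t - v y) / (t - y)) \<longlongrightarrow> v' y) (at y)" "((\<lambda>t. (?e t - ?e y) / (t - y)) \<longlongrightarrow> ?e' y) (at y)"
        using cv(1) ceD(1) by (auto simp: has_field_derivative_iff)
      then have "((\<lambda>t. ((v t - v y) / (t - y)) / ((?e t - ?e y) / (t - y))) \<longlongrightarrow> v' y / ?e' y) (at y)"
        using e'Z[OF yZ] by (intro tendsto_divide)
      moreover have "eventually (\<lambda>t. ((v t - v y) / (t - y)) / ((?e t - ?e y) / (t - y)) = v t / ?e t) (at y)"
        using vZ[OF yZ] True by (auto simp: eventually_at_filter)
      ultimately have q: "((\<lambda>t. v t / ?e t) \<longlongrightarrow> v' y / ?e' y) (at y)"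
        by (rule Lim_transform_eventually)
      have "(v \<longlongrightarrow> v y) (at y)" using cv(1)[of y, THEN DERIV_isCont] by (simp add: isCont_def)
      moreover have "(?e' \<longlongrightarrow> ?e' y) (at y)" using ceD(2)[of UNIV] by (simp add: continuous_on_eq_continuous_at isCont_def)
      ultimately have "((\<lambda>t. t ^ Suc l * v t * ?e' t * (v t / ?e t)) \<longlongrightarrow> y ^ Suc l * v y * ?e' y * (v' y / ?e' y)) (at y)"
        by (intro tendsto_mult tendsto_power tendsto_ident_at q)
      moreover have "y ^ Suc l * v y * ?e' y * (v' y / ?e' y) = G y" using vZ[OF yZ] by (simp add: G_def)
      moreover have "(\<lambda>t. t ^ Suc l * v t * ?e' t * (v t / ?e t)) = G"
        unfolding G_def power2_eq_square by (simp only: times_divide_eq_right mult_ac)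
      ultimately show ?thesis unfolding isCont_def by simp
    qed
  qed
  have dG: "(G has_vector_derivative F y - H y) (at y)" if y: "y \<in> {0<..<1} - Z" for y
  proof -
    have e: "?e y \<noteq> 0" using y by (auto simp: Z_def)
    have "((\<lambda>y. (y ^ Suc l * ?e' y) * (v y)\<^sup>2 / ?e y) has_real_derivative
      ((- (?w * y ^ l * ?e y) * (v y)\<^sup>2 + (2 * v y * v' y) * (y ^ Suc l * ?e' y)) * ?e y
        - (y ^ Suc l * ?e' y) * (v y)\<^sup>2 * ?e' y) / (?e y * ?e y)) (at y)"
      by (rule derivative_eq_intros DERIV_weight_ce' cv(1) ceD(1) e refl)+ (simp add: e)
    moreover have "((- (?w * y ^ l * ?e y) * (v y)\<^sup>2 + (2 * v y * v' y) * (y ^ Suc l * ?e' y)) * ?e y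
        - (y ^ Suc l * ?e' y) * (v y)\<^sup>2 * ?e' y) / (?e y * ?e y) = F y - H y"
      unfolding F_def H_def using e by (simp add: field_simps power2_eq_square)
    moreover have "(\<lambda>y. (y ^ Suc l * ?e' y) * (v y)\<^sup>2 / ?e y) = G" by (auto simp: G_def mult_ac)
    ultimately show ?thesis by (simp add: has_real_derivative_iff_has_vector_derivative)
  qed
  \<comment> \<open>This form of the fundamental theorem accepts a finite exceptional set for the
    derivative, given continuity of \<open>G\<close> on all of [0,1].\<close>
  have "((\<lambda>y. F y - H y) has_integral (G 1 - G 0)) {0..1}"
    by (rule fundamental_theorem_of_calculus_interior_strong[OF finZ _ dG contG]) simp
  moreover have "G 1 = 0" "G 0 = 0" by (simp_all add: G_def ce_1[OF n])
  ultimately have GH: "((\<lambda>y. F y - H y) has_integral 0) {0..1}" by simp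
  have F: "(F has_integral (wip (Suc l) v' v' - ?w * wip l v v)) {0..1}"
    unfolding F_def wip_def
    by (intro has_integral_diff has_integral_mult_right integrable_integral wip_integrable cv)
  from has_integral_diff[OF F GH] have "(H has_integral (wip (Suc l) v' v' - ?w * wip l v v)) {0..1}" by simp
  then have "0 \<le> wip (Suc l) v' v' - ?w * wip l v v"
    by (rule has_integral_nonneg) (auto simp: H_def)
  then show ?thesis by simp
qed

text \<open>The Courant minimax argument: some nontrivial combination of \<open>v\<close> and the first \<open>n - 1\<close>
  eigenfunctions vanishes at the \<open>n - 1\<close> interior zeros of the \<open>n\<close>-th one.\<close>

lemma Courant_inequality:
  assumes v: "is_C1 v v'" "v 1 = 0" and n: "n \<ge> 1"
    and orth: "\<And>i. 1 \<le> i \<Longrightarrow> i < n \<Longrightarrow> wip l v (ce l i) = 0"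
  shows "cz l n * wip l v v \<le> wip (Suc l) v' v'"
proof -
  \<comment> \<open>Index 0 carries v, so that v and the first n - 1 eigenfunctions become one
    orthogonal family.\<close>
  define f where "f i = (if i = 0 then v else ce l i)" for i
  define f' where "f' i = (if i = 0 then v' else ce' l i)" for i
  have C1f: "is_C1 (f i) (f' i)" for i using v is_C1_ce by (simp add: f_def f'_def)
  have f1: "f i 1 = 0" for i using v(2) ce_1[of i l] by (auto simp: f_def)
  have orth_f: "wip l (f i) (f j) = 0 \<and> wip (Suc l) (f' i) (f' j) = 0" if "i < n" "j < n" "i \<noteq> j" for i j
  proof -
    have *: "wip l v (ce l k) = 0 \<and> wip (Suc l) v' (ce' l k) = 0" if "k < n" "k \<noteq> 0" for k
      using orth[of k] that wip_weak_eigen[OF v, of l k] by simp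
    show ?thesis
      using *[of i] *[of j] that wip_ce_orthogonal[of i j l]
      by (auto simp: f_def f'_def wip_commute[of _ _ v] wip_commute[of _ _ v'])
  qed
  \<comment> \<open>There are n coefficients against n - 1 conditions at interior points; at the
    endpoint 1 every member of the family vanishes by itself.\<close>
  obtain c where c: "\<exists>j\<in>{..<n}. c j \<noteq> 0" "\<forall>i\<in>{1..<n}. (\<Sum>j<n. f j (cz l i / cz l n) * c j) = 0"
    using homogeneous_system_nontrivial[of "{1..<n}" "{..<n}" "\<lambda>i j. f j (cz l i / cz l n)"] n by auto
  let ?u = "\<lambda>y. \<Sum>j<n. c j * f j y" and ?u' = "\<lambda>y. \<Sum>j<n. c j * f' j y"
  have "cz l n * wip l ?u ?u \<le> wip (Suc l) ?u' ?u'"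
  proof (rule Jacobi_inequality[OF is_C1_sum[OF C1f] n])
    fix i assume "1 \<le> i" "i \<le> n"
    then show "?u (cz l i / cz l n) = 0"
      using c(2) f1 cz_pos[of n l] by (cases "i = n") (auto simp: mult.commute)
  qed
  moreover have "wip l ?u ?u = (\<Sum>j<n. (c j)\<^sup>2 * wip l (f j) (f j))"
    by (rule wip_sum_orthogonal) (use orth_f is_C1D[OF C1f] in auto)
  moreover have "wip (Suc l) ?u' ?u' = (\<Sum>j<n. (c j)\<^sup>2 * wip (Suc l) (f' j) (f' j))"
    by (rule wip_sum_orthogonal) (use orth_f is_C1D[OF C1f] in auto)
  \<comment> \<open>The inequality is diagonal by orthogonality. The eigenfunctions enter with the
    negative factors cz l j - cz l n, so any surplus must come from v; in particular c 0 = 0 is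
    impossible.\<close>
  ultimately have ge: "0 \<le> (\<Sum>j<n. (c j)\<^sup>2 * (wip (Suc l) (f' j) (f' j) - cz l n * wip l (f j) (f j)))"
    by (simp add: sum_distrib_left sum_subtractf algebra_simps)
  have split: "{..<n} = insert 0 {1..<n}" using n by auto
  have gap: "wip (Suc l) (f' j) (f' j) - cz l n * wip l (f j) (f j) = - ((cz l n - cz l j) * wip l (ce l j) (ce l j))"
    if "j \<in> {1..<n}" for j
    using that wip_weak_eigen[OF is_C1_ce ce_1[of j l], of l j] by (simp add: f_def f'_def algebra_simps)
  have pos: "(cz l n - cz l j) * wip l (ce l j) (ce l j) > 0" if "j \<in> {1..<n}" for j
    using that cz_less[of j n l] wip_ce_pos[of l j] by simp
  have "(\<Sum>j<n. (c j)\<^sup>2 * (wip (Suc l) (f' j) (f' j) - cz l n * wip l (f j) (f j)))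
     = (c 0)\<^sup>2 * (wip (Suc l) v' v' - cz l n * wip l v v) - (\<Sum>j\<in>{1..<n}. (c j)\<^sup>2 * ((cz l n - cz l j) * wip l (ce l j) (ce l j)))"
  proof -
    have "(\<Sum>j\<in>{1..<n}. (c j)\<^sup>2 * (wip (Suc l) (f' j) (f' j) - cz l n * wip l (f j) (f j)))
      = (\<Sum>j\<in>{1..<n}. - ((c j)\<^sup>2 * ((cz l n - cz l j) * wip l (ce l j) (ce l j))))"
      by (intro sum.cong refl) (simp only: gap mult_minus_right)
    then show ?thesis unfolding split sum_negf by (simp add: f_def f'_def)
  qed
  with ge have ge': "(\<Sum>j\<in>{1..<n}. (c j)\<^sup>2 * ((cz l n - cz l j) * wip l (ce l j) (ce l j)))
     \<le> (c 0)\<^sup>2 * (wip (Suc l) v' v' - cz l n * wip l v v)" by simp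
  have nn: "0 \<le> (c j)\<^sup>2 * ((cz l n - cz l j) * wip l (ce l j) (ce l j))" if "j \<in> {1..<n}" for j
    using pos[OF that] by simp
  have "c 0 \<noteq> 0"
  proof
    assume c0: "c 0 = 0"
    from c(1) obtain j where j': "j < n" "c j \<noteq> 0" by auto
    then have "j \<noteq> 0" using c0 by metis
    with j' have j: "j \<in> {1..<n}" "c j \<noteq> 0" by auto
    have "0 < (\<Sum>j\<in>{1..<n}. (c j)\<^sup>2 * ((cz l n - cz l j) * wip l (ce l j) (ce l j)))"
      by (rule sum_pos2[OF _ j(1)]) (use j(2) pos[OF j(1)] nn in auto)
    with ge' c0 show False by simp
  qed
  moreover have "0 \<le> (c 0)\<^sup>2 * (wip (Suc l) v' v' - cz l n * wip l v v)"
  proof -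
    have "0 \<le> (\<Sum>j\<in>{1..<n}. (c j)\<^sup>2 * ((cz l n - cz l j) * wip l (ce l j) (ce l j)))"
      by (rule sum_nonneg) (rule nn)
    with ge' show ?thesis by linarith
  qed
  ultimately show ?thesis by (simp add: zero_le_mult_iff)
qed

text \<open>For the remainder u of the projection onto the first n - 1 eigenfunctions,
  \<open>Courant_inequality\<close> gives cz l n * |u|^2 \<le> |u'|^2 \<le> |v'|^2 in the respective
  weights, and \<open>cz l n\<close> tends to infinity.\<close>

lemma ce_dense_C1:
  assumes v: "is_C1 v v'" "v 1 = 0" and eps: "\<epsilon> > 0"
  shows "\<exists>n c. wip l (\<lambda>y. v y - (\<Sum>i\<in>{1..<n}. c i * ce l i y)) (\<lambda>y. v y - (\<Sum>i\<in>{1..<n}. c i * ce l i y)) < \<epsilon>"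
proof -
  define D where "D = wip (Suc l) v' v'"
  obtain n0 where n0: "\<And>n. n \<ge> n0 \<Longrightarrow> cz l n > D / \<epsilon>"
    using cz_unbounded[of "D / \<epsilon>" l] by metis
  define n where "n = max 1 n0"
  have n: "n \<ge> 1" "cz l n > D / \<epsilon>" using n0 by (auto simp: n_def)
  define b where "b i = wip l v (ce l i) / wip l (ce l i) (ce l i)" for i
  let ?u = "\<lambda>y. v y - (\<Sum>i\<in>{1..<n}. b i * ce l i y)" and ?u' = "\<lambda>y. v' y - (\<Sum>i\<in>{1..<n}. b i * ce' l i y)"
  define c where "c i = (if i = 0 then 1 else - b i)" for i
  have split: "{..<n} = insert 0 {1..<n}" using n by auto
  have ueq: "?u = (\<lambda>y. \<Sum>i<n. c i * (if i = 0 then v else ce l i) y)"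
     "?u' = (\<lambda>y. \<Sum>i<n. c i * (if i = 0 then v' else ce' l i) y)"
    unfolding split by (auto simp: c_def sum_negf intro!: ext)
  have C1u: "is_C1 ?u ?u'" unfolding ueq by (rule is_C1_sum) (use v is_C1_ce in auto)
  note cont = is_C1D[OF v(1)] is_C1D[OF is_C1_ce] is_C1D[OF C1u]
  have u1: "?u 1 = 0" using v(2) ce_1 by simp
  have orth: "wip l ?u (ce l i) = 0" if "1 \<le> i" "i < n" for i
  proof -
    have "wip l ?u (ce l i) = (\<Sum>j<n. c j * wip l (if j = 0 then v else ce l j) (ce l i))"
      unfolding ueq by (rule wip_sum_left) (auto intro: cont)
    also have "\<dots> = wip l v (ce l i) - (\<Sum>j\<in>{1..<n}. b j * wip l (ce l j) (ce l i))"
      unfolding split by (simp add: c_def sum_negf)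
    also have "(\<Sum>j\<in>{1..<n}. b j * wip l (ce l j) (ce l i)) = (\<Sum>j\<in>{1..<n}. if j = i then b i * wip l (ce l i) (ce l i) else 0)"
      using that wip_ce_orthogonal(1)[of _ i l] by (intro sum.cong) auto
    also have "\<dots> = b i * wip l (ce l i) (ce l i)" using that by simp
    finally show ?thesis using wip_ce_pos[of l i] by (simp add: b_def)
  qed
  have "cz l n * wip l ?u ?u \<le> wip (Suc l) ?u' ?u'"
    by (rule Courant_inequality[OF C1u u1 n(1) orth])
  also have "\<dots> \<le> D"
  proof -
    \<comment> \<open>Pythagoras for the derivatives: v' is u' plus multiples of the
      \<open>ce' l i\<close>, orthogonal with weight l + 1, so dropping terms only decreases the
      norm.\<close>
    define g' where "g' i = (if i = 0 then ?u' else ce' l i)" for i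
    define d where "d i = (if i = 0 then 1 else b i)" for i
    have v'eq: "v' = (\<lambda>y. \<Sum>i<n. d i * g' i y)"
      unfolding split by (auto simp: d_def g'_def intro!: ext)
    have orth': "wip (Suc l) ?u' (ce' l i) = 0" if "1 \<le> i" "i < n" for i
      using wip_weak_eigen[OF C1u u1, of l i] orth[OF that] by simp
    have "D = (\<Sum>i<n. (d i)\<^sup>2 * wip (Suc l) (g' i) (g' i))"
      unfolding D_def
    proof (subst (1 2) v'eq, rule wip_sum_orthogonal)
      fix i j assume "i \<in> {..<n}" "j \<in> {..<n}" "i \<noteq> j"
      then show "wip (Suc l) (g' i) (g' j) = 0"
        using orth'[of i] orth'[of j] wip_ce_orthogonal(2)[of i j l]
        by (auto simp: g'_def wip_commute[of _ _ ?u'] simp del: One_nat_def)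
    qed (auto simp: g'_def intro: cont simp del: One_nat_def)
    also have "\<dots> \<ge> (d 0)\<^sup>2 * wip (Suc l) (g' 0) (g' 0)"
      by (rule member_le_sum) (use n in \<open>auto simp: g'_def simp del: One_nat_def intro!: mult_nonneg_nonneg wip_self_nonneg cont\<close>)
    finally show ?thesis by (simp add: d_def g'_def)
  qed
  finally have "cz l n * wip l ?u ?u \<le> D" .
  moreover have "D < cz l n * \<epsilon>" using n(2) eps by (simp add: field_simps)
  ultimately have "cz l n * wip l ?u ?u < cz l n * \<epsilon>" by linarith
  then have "wip l ?u ?u < \<epsilon>" using cz_pos[OF n(1), of l] by simp
  then show ?thesis by blast
qed

lemma has_integral_monomial_01: "((\<lambda>y::real. y ^ m) has_integral 1 / real (Suc m)) {0..1}"
proof -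
  have "((\<lambda>y. y ^ Suc m / real (Suc m)) has_vector_derivative y ^ m) (at y within {0..1})" for y :: real
    using DERIV_cdivide[OF DERIV_pow[of "Suc m" y "{0..1}"], of "real (Suc m)"]
    by (simp add: has_real_derivative_iff_has_vector_derivative del: of_nat_Suc power_Suc)
  then have "((\<lambda>y::real. y ^ m) has_integral (1 ^ Suc m / real (Suc m) - 0 ^ Suc m / real (Suc m))) {0..1}"
    by (intro fundamental_theorem_of_calculus) auto
  then show ?thesis by simp
qed

text \<open>Monomials do not vanish at 1 as \<open>ce_dense_C1\<close> demands. Subtracting y^N for
  large N repairs this at the cost of squared norm 1/(l + 2N + 1).\<close>

lemma ce_dense_monomial:
  assumes "\<epsilon> > 0"
  shows "\<exists>n c. integral {0..1} (\<lambda>y. y ^ l * (y ^ b - (\<Sum>i\<in>{1..<n}. c i * ce l i y))\<^sup>2) < \<epsilon>"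
proof -
  \<comment> \<open>By (p + q)^2 \<le> 2 p^2 + 2 q^2 the total stays below 2 (\<epsilon>/4) +
    2/N.\<close>
  obtain N :: nat where N: "real N > 4 / \<epsilon>" "N > 0" using reals_Archimedean2[of "max (4/\<epsilon>) 0"] by auto
  let ?v = "\<lambda>y::real. y ^ b - y ^ N"
  have v: "is_C1 ?v (\<lambda>y. real b * y ^ (b - 1) - real N * y ^ (N - 1))" "?v 1 = 0"
    unfolding is_C1_def by (auto intro!: derivative_eq_intros continuous_intros)
  obtain n c where nc: "wip l (\<lambda>y. ?v y - (\<Sum>i\<in>{1..<n}. c i * ce l i y)) (\<lambda>y. ?v y - (\<Sum>i\<in>{1..<n}. c i * ce l i y)) < \<epsilon> / 4"
    using ce_dense_C1[OF v, of "\<epsilon> / 4" l] assms by auto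
  let ?s = "\<lambda>y. \<Sum>i\<in>{1..<n}. c i * ce l i y"
  have cs: "continuous_on {0..1} ?s" by (intro continuous_intros is_C1D[OF is_C1_ce])
  have "integral {0..1} (\<lambda>y. y ^ l * (y ^ b - ?s y)\<^sup>2)
     \<le> integral {0..1} (\<lambda>y. 2 * (y ^ l * ((?v y - ?s y) * (?v y - ?s y))) + 2 * (y ^ l * (y ^ N * y ^ N)))"
  proof (rule integral_le)
    show "(\<lambda>y. y ^ l * (y ^ b - ?s y)\<^sup>2) integrable_on {0..1}"
      "(\<lambda>y. 2 * (y ^ l * ((?v y - ?s y) * (?v y - ?s y))) + 2 * (y ^ l * (y ^ N * y ^ N))) integrable_on {0..1}"
      by (intro integrable_continuous_real continuous_intros cs)+
    fix y :: real assume y: "y \<in> {0..1}"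
    have "(p + q)\<^sup>2 \<le> 2 * (p * p) + 2 * (q * q)" for p q :: real
      using zero_le_power2[of "p - q"] by (simp add: power2_eq_square algebra_simps)
    from this[of "?v y - ?s y" "y ^ N"] have "(y ^ b - ?s y)\<^sup>2 \<le> 2 * ((?v y - ?s y) * (?v y - ?s y)) + 2 * (y ^ N * y ^ N)"
      by simp
    then have "y ^ l * (y ^ b - ?s y)\<^sup>2 \<le> y ^ l * (2 * ((?v y - ?s y) * (?v y - ?s y)) + 2 * (y ^ N * y ^ N))"
      using y by (intro mult_left_mono) auto
    then show "y ^ l * (y ^ b - ?s y)\<^sup>2 \<le> 2 * (y ^ l * ((?v y - ?s y) * (?v y - ?s y))) + 2 * (y ^ l * (y ^ N * y ^ N))"
      by (simp add: algebra_simps)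
  qed
  also have "\<dots> = 2 * wip l (\<lambda>y. ?v y - ?s y) (\<lambda>y. ?v y - ?s y) + 2 * wip l (\<lambda>y. y ^ N) (\<lambda>y. y ^ N)"
    unfolding wip_def
    by (subst integral_add) (auto intro!: integrable_continuous_real continuous_intros is_C1D(3)[OF is_C1_ce])
  also have "wip l (\<lambda>y. y ^ N) (\<lambda>y. y ^ N) \<le> 1 / real N"
  proof -
    have "wip l (\<lambda>y. y ^ N) (\<lambda>y. y ^ N) = 1 / real (Suc (l + 2 * N))"
          proof -
      have "(\<lambda>y::real. y ^ l * (y ^ N * y ^ N)) = (\<lambda>y. y ^ (l + 2 * N))"
        by (simp add: power_add mult_2)
      then show ?thesis unfolding wip_def using integral_unique[OF has_integral_monomial_01] by metis
    qed
    also have "\<dots> \<le> 1 / real N" using N(2) by (intro divide_left_mono) auto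
    finally show ?thesis .
  qed
  also have "2 * wip l (\<lambda>y. ?v y - ?s y) (\<lambda>y. ?v y - ?s y) + 2 * (1 / real N) < \<epsilon>"
  proof -
    have "1 / real N < \<epsilon> / 4" using N assms by (simp add: field_simps)
    then show ?thesis using nc by linarith
  qed
  finally show ?thesis by fastforce
qed

section \<open>The space \<open>L\<^sup>2\<close> of the disk\<close>

lemma finite_measure_disk: "finite_measure disk"
  by (rule finite_measure_lebesgue_on) simp

interpretation disk: finite_measure disk by (rule finite_measure_disk)

lemma L2_measurable: "f \<in> L2 \<Longrightarrow> f \<in> borel_measurable disk"
  and L2_integrable: "f \<in> L2 \<Longrightarrow> integrable disk (\<lambda>x. (cmod (f x))\<^sup>2)"
  by (simp_all add: L2_def)

lemma L2I: "f \<in> borel_measurable disk \<Longrightarrow> integrable disk (\<lambda>x. (cmod (f x))\<^sup>2) \<Longrightarrow> f \<in> L2"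
  by (simp add: L2_def)

lemma L2_bounded:
  assumes "f \<in> borel_measurable disk" "\<And>x. x \<in> ball 0 1 \<Longrightarrow> cmod (f x) \<le> B"
  shows "f \<in> L2"
proof (rule L2I[OF assms(1)])
  have "AE x in disk. norm ((cmod (f x))\<^sup>2) \<le> B\<^sup>2"
  proof (rule AE_I2)
    fix x assume "x \<in> space disk"
    then have "cmod (f x) \<le> B" using assms(2) by simp
    then show "norm ((cmod (f x))\<^sup>2) \<le> B\<^sup>2" by (simp add: power_mono)
  qed
  then show "integrable disk (\<lambda>x. (cmod (f x))\<^sup>2)"
    using assms(1) by (intro disk.integrable_const_bound) auto
qed

lemma L2_mult_integrable:
  assumes f: "f \<in> L2" and g: "g \<in> L2"
  shows "integrable disk (\<lambda>x. f x * cnj (g x))"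
proof (rule Bochner_Integration.integrable_bound)
  show "integrable disk (\<lambda>x. (cmod (f x))\<^sup>2 + (cmod (g x))\<^sup>2)"
    using L2_integrable f g by simp
  have "(\<lambda>x. cnj (g x)) \<in> borel_measurable disk"
    using measurable_compose[OF L2_measurable[OF g] borel_measurable_continuous_onI[OF continuous_on_cnj[OF continuous_on_id]]] by simp
  then show "(\<lambda>x. f x * cnj (g x)) \<in> borel_measurable disk" using L2_measurable[OF f] by simp
  have "cmod (f x) * cmod (g x) \<le> (cmod (f x))\<^sup>2 + (cmod (g x))\<^sup>2" for x
  proof -
    have "0 \<le> cmod (f x) * cmod (g x)" by simp
    then show ?thesis using sum_squares_bound[of "cmod (f x)" "cmod (g x)"] by linarith
  qed
  then show "AE x in disk. norm (f x * cnj (g x)) \<le> norm ((cmod (f x))\<^sup>2 + (cmod (g x))\<^sup>2)"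
    by (simp add: norm_mult)
qed

lemma L2_zero: "(\<lambda>x. 0) \<in> L2" by (simp add: L2_def)

lemma L2_add:
  assumes f: "f \<in> L2" and g: "g \<in> L2"
  shows "(\<lambda>x. f x + g x) \<in> L2"
proof (rule L2I)
  show m: "(\<lambda>x. f x + g x) \<in> borel_measurable disk" using L2_measurable f g by simp
  show "integrable disk (\<lambda>x. (cmod (f x + g x))\<^sup>2)"
  proof (rule Bochner_Integration.integrable_bound)
    show "integrable disk (\<lambda>x. 2 * (cmod (f x))\<^sup>2 + 2 * (cmod (g x))\<^sup>2)"
      using L2_integrable f g by simp
    have "(cmod (f x + g x))\<^sup>2 \<le> 2 * (cmod (f x))\<^sup>2 + 2 * (cmod (g x))\<^sup>2" for x
    proof -
      have "(cmod (f x + g x))\<^sup>2 \<le> (cmod (f x) + cmod (g x))\<^sup>2"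
        by (intro power_mono norm_triangle_ineq) simp
      also have "\<dots> \<le> 2 * (cmod (f x))\<^sup>2 + 2 * (cmod (g x))\<^sup>2"
        using sum_squares_bound[of "cmod (f x)" "cmod (g x)"] by (simp add: power2_sum)
      finally show ?thesis .
    qed
    then show "AE x in disk. norm ((cmod (f x + g x))\<^sup>2) \<le> norm (2 * (cmod (f x))\<^sup>2 + 2 * (cmod (g x))\<^sup>2)"
      by simp
  qed (use m in simp)
qed

lemma L2_scale:
  assumes "f \<in> L2"
  shows "(\<lambda>x. c * f x) \<in> L2"
  using assms by (auto simp: L2_def norm_mult power_mult_distrib)

lemma L2_diff:
  assumes "f \<in> L2" "g \<in> L2"
  shows "(\<lambda>x. f x - g x) \<in> L2"
  using L2_add[OF assms(1) L2_scale[OF assms(2), of "-1"]] by simp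

lemma L2_sum: "(\<And>i. i \<in> F \<Longrightarrow> f i \<in> L2) \<Longrightarrow> (\<lambda>x. \<Sum>i\<in>F. f i x) \<in> L2"
  by (induction F rule: infinite_finite_induct) (auto intro: L2_add L2_zero)

lemma L2_inner_cnj: "L2_inner g f = cnj (L2_inner f g)"
proof -
  have "(LINT x|disk. g x * cnj (f x)) = (LINT x|disk. cnj (f x * cnj (g x)))" by (simp add: mult.commute)
  then show ?thesis unfolding L2_inner_def by (simp only: Bochner_Integration.integral_cnj)
qed

lemma L2_inner_scale_left: "L2_inner (\<lambda>x. c * f x) g = c * L2_inner f g"
  unfolding L2_inner_def by (simp add: mult.assoc)

lemma L2_inner_add_left:
  assumes "f \<in> L2" "h \<in> L2" "g \<in> L2"
  shows "L2_inner (\<lambda>x. f x + h x) g = L2_inner f g + L2_inner h g"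
  unfolding L2_inner_def using L2_mult_integrable assms by (simp add: distrib_right)

lemma L2_inner_diff_left:
  assumes "f \<in> L2" "h \<in> L2" "g \<in> L2"
  shows "L2_inner (\<lambda>x. f x - h x) g = L2_inner f g - L2_inner h g"
  unfolding L2_inner_def using L2_mult_integrable assms by (simp add: left_diff_distrib)

lemma L2_inner_sum_left:
  assumes "\<And>i. i \<in> F \<Longrightarrow> f i \<in> L2" "g \<in> L2"
  shows "L2_inner (\<lambda>x. \<Sum>i\<in>F. f i x) g = (\<Sum>i\<in>F. L2_inner (f i) g)"
  unfolding L2_inner_def using L2_mult_integrable assms by (simp add: sum_distrib_right)

lemma L2_inner_add_right:
  assumes "f \<in> L2" "h \<in> L2" "g \<in> L2"
  shows "L2_inner g (\<lambda>x. f x + h x) = L2_inner g f + L2_inner g h"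
  using L2_inner_add_left[OF assms] by (simp add: L2_inner_cnj[of g])

lemma L2_inner_diff_right:
  assumes "f \<in> L2" "h \<in> L2" "g \<in> L2"
  shows "L2_inner g (\<lambda>x. f x - h x) = L2_inner g f - L2_inner g h"
  using L2_inner_diff_left[OF assms] by (simp add: L2_inner_cnj[of g])

lemma L2_inner_scale_right: "L2_inner g (\<lambda>x. c * f x) = cnj c * L2_inner g f"
  by (simp add: L2_inner_cnj[of g] L2_inner_scale_left)

lemma L2_inner_sum_right:
  assumes "\<And>i. i \<in> F \<Longrightarrow> f i \<in> L2" "g \<in> L2"
  shows "L2_inner g (\<lambda>x. \<Sum>i\<in>F. f i x) = (\<Sum>i\<in>F. L2_inner g (f i))"
  using L2_inner_sum_left[of F f g, OF assms] by (simp add: L2_inner_cnj[of g])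

lemma L2_norm_sq: "(L2_norm f)\<^sup>2 = (LINT x|disk. (cmod (f x))\<^sup>2)"
  unfolding L2_norm_def by (simp add: integral_nonneg_AE)

lemma L2_norm_nonneg [simp]: "0 \<le> L2_norm f"
  unfolding L2_norm_def by (simp add: integral_nonneg_AE)

lemma L2_inner_self: "L2_inner f f = complex_of_real ((L2_norm f)\<^sup>2)"
  unfolding L2_norm_sq L2_inner_def complex_norm_square[symmetric] by (rule integral_complex_of_real)

lemma L2_inner_cong_AE:
  assumes "f \<in> L2" "f' \<in> L2" "g \<in> L2" "AE x in disk. f x = f' x"
  shows "L2_inner f g = L2_inner f' g"
  unfolding L2_inner_def
  by (rule integral_cong_AE) (use assms borel_measurable_integrable[OF L2_mult_integrable] in auto)

lemma L2_norm_cong_AE: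
  assumes "f \<in> L2" "f' \<in> L2" "AE x in disk. f x = f' x"
  shows "L2_norm f = L2_norm f'"
  unfolding L2_norm_def
  by (intro arg_cong[where f=sqrt] integral_cong_AE) (use assms L2_measurable in auto)

lemma L2_norm_eq_0_iff:
  assumes "f \<in> L2"
  shows "L2_norm f = 0 \<longleftrightarrow> (AE x in disk. f x = 0)"
  unfolding L2_norm_def using integral_nonneg_eq_0_iff_AE[OF L2_integrable[OF assms]] by simp

lemma L2_Cauchy_Schwarz:
  assumes f: "f \<in> L2" and g: "g \<in> L2"
  shows "cmod (L2_inner f g) \<le> L2_norm f * L2_norm g"
proof (cases "L2_norm g = 0")
  case True
  then have "AE x in disk. g x = 0" using L2_norm_eq_0_iff[OF g] by simp
  then have "L2_inner g f = L2_inner (\<lambda>x. 0) f" by (intro L2_inner_cong_AE f g L2_zero) auto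
  then have "L2_inner g f = 0" by (simp add: L2_inner_def)
  then have "L2_inner f g = 0" using L2_inner_cnj[of f g] by simp
  then show ?thesis by simp
next
  case False
  define c where "c = L2_inner f g / complex_of_real ((L2_norm g)\<^sup>2)"
  let ?h = "\<lambda>x. f x - c * g x"
  have h: "?h \<in> L2" by (intro L2_diff f L2_scale g)
  have "L2_inner ?h g = L2_inner f g - c * complex_of_real ((L2_norm g)\<^sup>2)"
    by (simp add: L2_inner_diff_left L2_scale f g L2_inner_scale_left L2_inner_self)
  then have "L2_inner ?h g = 0"
    using False by (simp add: c_def)
  then have "L2_inner ?h ?h = L2_inner ?h f"
    by (simp add: L2_inner_diff_right L2_scale f g h L2_inner_scale_right)
  also have "\<dots> = L2_inner f f - c * L2_inner g f"
    by (simp add: L2_inner_diff_left L2_scale f g L2_inner_scale_left)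
  also have "c * L2_inner g f = complex_of_real ((cmod (L2_inner f g))\<^sup>2 / (L2_norm g)\<^sup>2)"
  proof -
    have "c * L2_inner g f = (L2_inner f g * cnj (L2_inner f g)) / complex_of_real ((L2_norm g)\<^sup>2)"
      unfolding c_def L2_inner_cnj[of g f] by simp
    then show ?thesis by (simp only: complex_norm_square[symmetric] of_real_divide)
  qed
  finally have "complex_of_real ((L2_norm ?h)\<^sup>2) = complex_of_real ((L2_norm f)\<^sup>2 - (cmod (L2_inner f g))\<^sup>2 / (L2_norm g)\<^sup>2)"
    by (simp add: L2_inner_self)
  then have "(L2_norm ?h)\<^sup>2 = (L2_norm f)\<^sup>2 - (cmod (L2_inner f g))\<^sup>2 / (L2_norm g)\<^sup>2"
    unfolding of_real_eq_iff .
  then have "(cmod (L2_inner f g))\<^sup>2 / (L2_norm g)\<^sup>2 \<le> (L2_norm f)\<^sup>2"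
    using zero_le_power2[of "L2_norm ?h"] by linarith
  then have "(cmod (L2_inner f g))\<^sup>2 \<le> (L2_norm f * L2_norm g)\<^sup>2"
    using False by (simp add: field_simps power_mult_distrib)
  then show ?thesis by (rule power2_le_imp_le) simp
qed

text \<open>Cauchy--Schwarz against the constant 1. It turns Cauchy sequences in L2 into Cauchy
  sequences in L1, from which almost everywhere convergent subsequences are extracted.\<close>

lemma L1_le_L2:
  assumes "f \<in> L2"
  shows "integrable disk (\<lambda>x. cmod (f x))" "(LINT x|disk. cmod (f x)) \<le> L2_norm f * L2_norm (\<lambda>x. 1)"
proof -
  let ?g = "\<lambda>x. complex_of_real (cmod (f x))"
  have g: "?g \<in> L2" using assms by (auto simp: L2_def)
  have one: "(\<lambda>x. 1) \<in> L2" by (rule L2_bounded[of _ 1]) auto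
  have "integrable disk (\<lambda>x. norm (?g x * cnj 1))" using L2_mult_integrable[OF g one] by (rule integrable_norm)
  then show "integrable disk (\<lambda>x. cmod (f x))" by simp
  have "cmod (L2_inner ?g (\<lambda>x. 1)) \<le> L2_norm ?g * L2_norm (\<lambda>x. 1)"
    by (rule L2_Cauchy_Schwarz[OF g one])
  moreover have "L2_inner ?g (\<lambda>x. 1) = complex_of_real (LINT x|disk. cmod (f x))"
    by (simp add: L2_inner_def)
  moreover have "L2_norm ?g = L2_norm f" by (simp add: L2_norm_def)
  ultimately show "(LINT x|disk. cmod (f x)) \<le> L2_norm f * L2_norm (\<lambda>x. 1)" by simp
qed

section \<open>Orthonormal systems, Riesz--Fischer and Parseval\<close>

locale orthonormal_system =
  fixes I :: "'i set" and e :: "'i \<Rightarrow> real ^ 2 \<Rightarrow> complex"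
  assumes e_L2: "\<And>i. i \<in> I \<Longrightarrow> e i \<in> L2"
    and orthonormal: "\<And>i j. i \<in> I \<Longrightarrow> j \<in> I \<Longrightarrow> L2_inner (e i) (e j) = (if i = j then 1 else 0)"
begin

definition comb :: "'i set \<Rightarrow> ('i \<Rightarrow> complex) \<Rightarrow> real ^ 2 \<Rightarrow> complex" where
  "comb F c x = (\<Sum>i\<in>F. c i * e i x)"

lemma comb_L2: "F \<subseteq> I \<Longrightarrow> comb F c \<in> L2"
  unfolding comb_def[abs_def] by (intro L2_sum L2_scale e_L2) auto

lemma inner_comb:
  assumes "F \<subseteq> I" "f \<in> L2"
  shows "L2_inner (comb F c) f = (\<Sum>i\<in>F. c i * L2_inner (e i) f)"
  unfolding comb_def[abs_def]
  by (subst L2_inner_sum_left) (use assms e_L2 in \<open>auto intro!: L2_scale sum.cong L2_inner_scale_left\<close>)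

lemma inner_comb_basis:
  assumes "finite F" "F \<subseteq> I" "j \<in> I"
  shows "L2_inner (comb F c) (e j) = (if j \<in> F then c j else 0)"
proof -
  have "L2_inner (comb F c) (e j) = (\<Sum>i\<in>F. if i = j then c j else 0)"
    unfolding inner_comb[OF assms(2) e_L2[OF assms(3)]]
    using assms by (intro sum.cong) (auto simp: orthonormal subset_iff)
  then show ?thesis using assms(1) by simp
qed

lemma norm_comb:
  assumes "finite F" "F \<subseteq> I"
  shows "(L2_norm (comb F c))\<^sup>2 = (\<Sum>i\<in>F. (cmod (c i))\<^sup>2)"
proof -
  have "complex_of_real ((L2_norm (comb F c))\<^sup>2) = (\<Sum>i\<in>F. c i * L2_inner (e i) (comb F c))"
    unfolding L2_inner_self[symmetric] by (rule inner_comb[OF assms(2) comb_L2[OF assms(2)]])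
  also have "\<dots> = (\<Sum>i\<in>F. complex_of_real ((cmod (c i))\<^sup>2))"
  proof (rule sum.cong)
    fix i assume i: "i \<in> F"
    then have "L2_inner (e i) (comb F c) = cnj (c i)"
      using inner_comb_basis[OF assms, of i c] L2_inner_cnj[of "e i" "comb F c"] assms by auto
    then show "c i * L2_inner (e i) (comb F c) = complex_of_real ((cmod (c i))\<^sup>2)"
      by (simp only: complex_norm_square)
  qed simp
  finally show ?thesis by (simp only: of_real_sum[symmetric] of_real_eq_iff)
qed

lemma norm_diff_projection:
  assumes F: "finite F" "F \<subseteq> I" and f: "f \<in> L2"
  shows "(L2_norm (\<lambda>x. f x - comb F (\<lambda>i. L2_inner f (e i)) x))\<^sup>2
     = (L2_norm f)\<^sup>2 - (\<Sum>i\<in>F. (cmod (L2_inner f (e i)))\<^sup>2)"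
proof -
  let ?c = "\<lambda>i. L2_inner f (e i)"
  let ?S = "comb F ?c" let ?h = "\<lambda>x. f x - ?S x"
  note S = comb_L2[OF F(2), of ?c]
  have h: "?h \<in> L2" by (rule L2_diff[OF f S])
  have "L2_inner (e i) ?h = 0" if "i \<in> F" for i
  proof -
    have i: "i \<in> I" using that F by auto
    have "L2_inner ?h (e i) = 0"
      using inner_comb_basis[OF F i, of ?c] that by (simp add: L2_inner_diff_left f S e_L2[OF i])
    then show ?thesis using L2_inner_cnj[of "e i" ?h] by simp
  qed
  then have "L2_inner ?S ?h = 0" by (simp add: inner_comb[OF F(2) h])
  then have "L2_inner ?h ?S = 0" using L2_inner_cnj[of ?h ?S] by simp
  then have "L2_inner ?h ?h = L2_inner f f - L2_inner ?S f"
    by (simp add: L2_inner_diff_right[OF f S h] L2_inner_diff_left[OF f S f])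
  also have "L2_inner ?S f = complex_of_real (\<Sum>i\<in>F. (cmod (?c i))\<^sup>2)"
    unfolding inner_comb[OF F(2) f] of_real_sum
    by (intro sum.cong refl) (simp only: L2_inner_cnj[of "e _" f] complex_norm_square)
  finally have "complex_of_real ((L2_norm ?h)\<^sup>2) = complex_of_real ((L2_norm f)\<^sup>2 - (\<Sum>i\<in>F. (cmod (?c i))\<^sup>2))"
    unfolding L2_inner_self by simp
  then show ?thesis unfolding of_real_eq_iff .
qed

lemma Bessel_inequality:
  assumes "finite F" "F \<subseteq> I" "f \<in> L2"
  shows "(\<Sum>i\<in>F. (cmod (L2_inner f (e i)))\<^sup>2) \<le> (L2_norm f)\<^sup>2"
  using norm_diff_projection[OF assms] zero_le_power2[of "L2_norm (\<lambda>x. f x - comb F (\<lambda>i. L2_inner f (e i)) x)"]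
  by linarith

lemma Bessel_summable:
  assumes "f \<in> L2"
  shows "(\<lambda>i. (cmod (L2_inner f (e i)))\<^sup>2) summable_on I"
  by (rule nonneg_bdd_above_summable_on)
     (use Bessel_inequality[OF _ _ assms] in \<open>auto intro!: bdd_aboveI2[where M = "(L2_norm f)\<^sup>2"]\<close>)

lemma norm_comb_diff:
  assumes "finite F" "F \<subseteq> I" "finite G" "G \<subseteq> I"
  shows "(L2_norm (\<lambda>x. comb F c x - comb G c x))\<^sup>2 = (\<Sum>i\<in>(F - G) \<union> (G - F). (cmod (c i))\<^sup>2)"
proof -
  let ?d = "\<lambda>i. if i \<in> F then c i else - c i"
  have "comb F c x - comb G c x = comb ((F - G) \<union> (G - F)) ?d x" for x
  proof -
    have "comb F c x = comb (F - G) c x + comb (F \<inter> G) c x"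
      unfolding comb_def using sum.Int_Diff[OF assms(1), of "\<lambda>i. c i * e i x" G] by simp
    moreover have "comb G c x = comb (G - F) c x + comb (F \<inter> G) c x"
      unfolding comb_def using sum.Int_Diff[OF assms(3), of "\<lambda>i. c i * e i x" F] by (simp add: Int_commute)
    moreover have "comb ((F - G) \<union> (G - F)) ?d x = comb (F - G) ?d x + comb (G - F) ?d x"
      unfolding comb_def using assms by (intro sum.union_disjoint) auto
    moreover have "comb (F - G) ?d x = comb (F - G) c x" "comb (G - F) ?d x = - comb (G - F) c x"
      unfolding comb_def by (auto simp: sum_negf[symmetric] intro!: sum.cong)
    ultimately show ?thesis by simp
  qed
  then have "(L2_norm (\<lambda>x. comb F c x - comb G c x))\<^sup>2 = (\<Sum>i\<in>(F - G) \<union> (G - F). (cmod (?d i))\<^sup>2)"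
    using norm_comb[of "(F - G) \<union> (G - F)" ?d] assms by (simp only:) auto
  also have "\<dots> = (\<Sum>i\<in>(F - G) \<union> (G - F). (cmod (c i))\<^sup>2)" by (intro sum.cong) auto
  finally show ?thesis .
qed

end

text \<open>Almost everywhere limits need not preserve norms, but upper bounds survive by Fatou,
  which also gives membership in \<open>L2\<close>.\<close>

lemma L2_Fatou:
  assumes g: "\<And>n. g n \<in> L2" and meas: "f \<in> borel_measurable disk" and B: "\<And>n. (L2_norm (g n))\<^sup>2 \<le> B"
    and lim: "AE x in disk. (\<lambda>n. g n x) \<longlonglongrightarrow> f x"
  shows "f \<in> L2" "(L2_norm f)\<^sup>2 \<le> B"
proof -
  have B0: "B \<ge> 0" using B[of 0] zero_le_power2[of "L2_norm (g 0)"] by linarith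
  have "(\<integral>\<^sup>+x. ennreal ((cmod (f x))\<^sup>2) \<partial>disk) = (\<integral>\<^sup>+x. liminf (\<lambda>n. ennreal ((cmod (g n x))\<^sup>2)) \<partial>disk)"
  proof (rule nn_integral_cong_AE)
    show "AE x in disk. ennreal ((cmod (f x))\<^sup>2) = liminf (\<lambda>n. ennreal ((cmod (g n x))\<^sup>2))"
      using lim
    proof eventually_elim
      case (elim x)
      then have "(\<lambda>n. ennreal ((cmod (g n x))\<^sup>2)) \<longlonglongrightarrow> ennreal ((cmod (f x))\<^sup>2)"
        by (intro tendsto_ennrealI tendsto_intros)
      then show ?case using lim_imp_Liminf[of sequentially] by (metis sequentially_bot)
    qed
  qed
  also have "\<dots> \<le> liminf (\<lambda>n. \<integral>\<^sup>+x. ennreal ((cmod (g n x))\<^sup>2) \<partial>disk)"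
    using L2_measurable[OF g] by (intro nn_integral_liminf) auto
  also have "(\<lambda>n. \<integral>\<^sup>+x. ennreal ((cmod (g n x))\<^sup>2) \<partial>disk) = (\<lambda>n. ennreal ((L2_norm (g n))\<^sup>2))"
    unfolding L2_norm_sq by (intro ext nn_integral_eq_integral L2_integrable g) auto
  also have "liminf (\<lambda>n. ennreal ((L2_norm (g n))\<^sup>2)) \<le> ennreal B"
    using B by (intro Liminf_le always_eventually) (auto intro: ennreal_leI)
  finally have le: "(\<integral>\<^sup>+x. ennreal ((cmod (f x))\<^sup>2) \<partial>disk) \<le> ennreal B" .
  then have int: "integrable disk (\<lambda>x. (cmod (f x))\<^sup>2)"
    using meas by (intro integrableI_nonneg) (auto simp: less_top[symmetric] top_unique)
  then show "f \<in> L2" using meas by (intro L2I)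
  show "(L2_norm f)\<^sup>2 \<le> B"
    using le B0 unfolding L2_norm_sq
    by (subst (asm) nn_integral_eq_integral[OF int]) (auto simp: ennreal_le_iff)
qed

context orthonormal_system
begin

text \<open>Completeness is obtained by hand: partial sums over an exhausting sequence of finite
  sets are Cauchy in L1, a subsequence converges almost everywhere to u, and \<open>L2_Fatou\<close>
  bounds the distance of u to every larger finite sum. That last bound gives convergence along the
  net of finite sets.\<close>

lemma Riesz_Fischer:
  assumes c: "(\<lambda>i. (cmod (c i))\<^sup>2) summable_on I"
  shows "\<exists>u\<in>L2. ((\<lambda>F. L2_norm (\<lambda>x. u x - comb F c x)) \<longlongrightarrow> 0) (finite_subsets_at_top I)"
proof -
  have tail: "\<exists>F. finite F \<and> F \<subseteq> I \<and> (\<forall>G. finite G \<longrightarrow> G \<subseteq> I - F \<longrightarrow> (\<Sum>i\<in>G. (cmod (c i))\<^sup>2) < \<epsilon>)" if "\<epsilon> > 0" for \<epsilon>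
  proof -
    let ?s = "infsum (\<lambda>i. (cmod (c i))\<^sup>2) I"
    have "(sum (\<lambda>i. (cmod (c i))\<^sup>2) \<longlongrightarrow> ?s) (finite_subsets_at_top I)"
      using has_sum_infsum[OF c] by (simp add: has_sum_def)
    then have "eventually (\<lambda>F. dist (sum (\<lambda>i. (cmod (c i))\<^sup>2) F) ?s < \<epsilon>) (finite_subsets_at_top I)"
      using that by (rule tendstoD)
    then obtain F where "finite F \<and> F \<subseteq> I \<and> (\<forall>H. finite H \<and> F \<subseteq> H \<and> H \<subseteq> I \<longrightarrow> dist (sum (\<lambda>i. (cmod (c i))\<^sup>2) H) ?s < \<epsilon>)"
      unfolding eventually_finite_subsets_at_top by (elim exE) (rule that)
    then have F: "finite F" "F \<subseteq> I" "dist (sum (\<lambda>i. (cmod (c i))\<^sup>2) F) ?s < \<epsilon>" by auto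
    have "(\<Sum>i\<in>G. (cmod (c i))\<^sup>2) < \<epsilon>" if "finite G" "G \<subseteq> I - F" for G
    proof -
      have "sum (\<lambda>i. (cmod (c i))\<^sup>2) (F \<union> G) \<le> ?s"
        using that F by (intro finite_sum_le_infsum c) auto
      moreover have "sum (\<lambda>i. (cmod (c i))\<^sup>2) (F \<union> G) = sum (\<lambda>i. (cmod (c i))\<^sup>2) F + sum (\<lambda>i. (cmod (c i))\<^sup>2) G"
        using that F by (intro sum.union_disjoint) auto
      ultimately show ?thesis using F(3) by (simp add: dist_real_def)
    qed
    with F show ?thesis by blast
  qed
  have "\<forall>n. \<exists>F. finite F \<and> F \<subseteq> I \<and> (\<forall>G. finite G \<longrightarrow> G \<subseteq> I - F \<longrightarrow> (\<Sum>i\<in>G. (cmod (c i))\<^sup>2) < 1 / real (Suc n))"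
    by (intro allI tail) simp
  then obtain F0 where F0: "\<And>n. finite (F0 n)" "\<And>n. F0 n \<subseteq> I"
    "\<And>n G. finite G \<Longrightarrow> G \<subseteq> I - F0 n \<Longrightarrow> (\<Sum>i\<in>G. (cmod (c i))\<^sup>2) < 1 / real (Suc n)"
    by metis
  \<comment> \<open>Unions make the sets nested while keeping the tail bound of each
    \<open>F0 n\<close>.\<close>
  define F where "F n = (\<Union>k\<le>n. F0 k)" for n
  have F: "finite (F n)" "F n \<subseteq> I" "F0 n \<subseteq> F n" for n using F0 by (auto simp: F_def)
  have F_mono: "F m \<subseteq> F n" if "m \<le> n" for m n using that by (auto simp: F_def intro: order_trans)
  have near: "(L2_norm (\<lambda>x. comb A c x - comb B c x))\<^sup>2 \<le> 1 / real (Suc n)"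
    if "finite A" "A \<subseteq> I" "finite B" "B \<subseteq> I" "F n \<subseteq> A" "F n \<subseteq> B" for A B n
    unfolding norm_comb_diff[OF that(1-4)]
    by (rule less_imp_le, rule F0(3)) (use F(3)[of n] that in auto)
  let ?s = "\<lambda>n. comb (F n) c"
  have s: "?s n \<in> L2" for n by (rule comb_L2[OF F(2)])
  have "\<exists>N. \<forall>i\<ge>N. \<forall>j\<ge>N. (LINT x|disk. norm (?s i x - ?s j x)) < \<epsilon>" if \<epsilon>: "\<epsilon> > 0" for \<epsilon>
  proof -
    define K where "K = L2_norm (\<lambda>x. 1) + 1"
    have K: "K > 0" "L2_norm (\<lambda>x. 1) \<le> K" unfolding K_def by (simp_all add: add_nonneg_pos)
    obtain N :: nat where N: "real N > (K / \<epsilon>)\<^sup>2" using reals_Archimedean2 by blast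
    have "(LINT x|disk. norm (?s i x - ?s j x)) < \<epsilon>" if "i \<ge> N" "j \<ge> N" for i j
    proof -
      have "(L2_norm (\<lambda>x. ?s i x - ?s j x))\<^sup>2 \<le> 1 / real (Suc N)"
        by (rule near) (use F F_mono that in auto)
      also have "\<dots> < (\<epsilon> / K)\<^sup>2"
      proof -
        have "(K / \<epsilon>)\<^sup>2 < real (Suc N)" using N by simp
        then have "1 / real (Suc N) < 1 / (K / \<epsilon>)\<^sup>2" using K \<epsilon> by (intro divide_strict_left_mono) auto
        then show ?thesis by (simp add: power_divide)
      qed
      finally have "L2_norm (\<lambda>x. ?s i x - ?s j x) < \<epsilon> / K"
        by (rule power2_less_imp_less) (use K \<epsilon> in auto)
      then have "L2_norm (\<lambda>x. ?s i x - ?s j x) * K < \<epsilon>" using K by (simp add: field_simps)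
      moreover have "L2_norm (\<lambda>x. ?s i x - ?s j x) * L2_norm (\<lambda>x. 1) \<le> L2_norm (\<lambda>x. ?s i x - ?s j x) * K"
        using K by (intro mult_left_mono) auto
      ultimately show ?thesis using L1_le_L2(2)[OF L2_diff[OF s s], of i j] by linarith
    qed
    then show ?thesis by blast
  qed
  then obtain r where r: "strict_mono r" "AE x in disk. Cauchy (\<lambda>i. ?s (r i) x)"
  proof (rule cauchy_L1_AE_cauchy_subseq[rotated])
    show "integrable disk (?s n)" for n
      using L1_le_L2(1)[OF s] L2_measurable[OF s] by (rule integrable_norm_cancel)
  qed
  define u where "u x = lim (\<lambda>i. ?s (r i) x)" for x
  have meas: "u \<in> borel_measurable disk"
    unfolding u_def[abs_def] by (rule borel_measurable_lim_metric) (rule L2_measurable[OF s])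
  have lim: "AE x in disk. (\<lambda>i. ?s (r i) x) \<longlonglongrightarrow> u x"
    using r(2) by eventually_elim (simp add: u_def Cauchy_convergent convergent_LIMSEQ_iff[symmetric])
  have close: "(\<lambda>x. u x - comb A c x) \<in> L2 \<and> (L2_norm (\<lambda>x. u x - comb A c x))\<^sup>2 \<le> 1 / real (Suc n)"
    if A: "finite A" "A \<subseteq> I" "F n \<subseteq> A" for A n
  proof -
    \<comment> \<open>The shift by n guarantees n \<le> r (m + n), so every member of the sequence
      already contains \<open>F n\<close>.\<close>
    let ?g = "\<lambda>m x. ?s (r (m + n)) x - comb A c x"
    have g: "?g m \<in> L2" for m by (intro L2_diff s comb_L2 A)
    have m: "(\<lambda>x. u x - comb A c x) \<in> borel_measurable disk"
      using meas L2_measurable[OF comb_L2[OF A(2)]] by simp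
    have B: "(L2_norm (?g m))\<^sup>2 \<le> 1 / real (Suc n)" for m
    proof (rule near)
      have "n \<le> r (m + n)" using seq_suble[OF r(1), of "m + n"] by simp
      then show "F n \<subseteq> F (r (m + n))" by (rule F_mono)
    qed (use A F in auto)
    have "AE x in disk. (\<lambda>m. ?g m x) \<longlonglongrightarrow> u x - comb A c x"
      using lim by eventually_elim (intro tendsto_intros LIMSEQ_ignore_initial_segment)
    from L2_Fatou[OF g m B this] show ?thesis by blast
  qed
  have "u \<in> L2"
    using L2_add[OF close[THEN conjunct1, of "F 0" 0, OF F(1,2) order_refl] s[of 0]] by simp
  moreover have "((\<lambda>A. L2_norm (\<lambda>x. u x - comb A c x)) \<longlongrightarrow> 0) (finite_subsets_at_top I)"
  proof (rule tendstoI)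
    fix \<epsilon> :: real assume \<epsilon>: "\<epsilon> > 0"
    obtain n where n: "1 / real (Suc n) < \<epsilon>\<^sup>2" using nat_approx_posE[of "\<epsilon>\<^sup>2"] \<epsilon> by auto
    have "dist (L2_norm (\<lambda>x. u x - comb A c x)) 0 < \<epsilon>" if "finite A" "F n \<subseteq> A" "A \<subseteq> I" for A
    proof -
      have "(L2_norm (\<lambda>x. u x - comb A c x))\<^sup>2 < \<epsilon>\<^sup>2" using close[of A n] that n by linarith
      then have "L2_norm (\<lambda>x. u x - comb A c x) < \<epsilon>" by (rule power2_less_imp_less) (use \<epsilon> in simp)
      then show ?thesis by simp
    qed
    then show "eventually (\<lambda>A. dist (L2_norm (\<lambda>x. u x - comb A c x)) 0 < \<epsilon>) (finite_subsets_at_top I)"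
      unfolding eventually_finite_subsets_at_top using F(1,2)[of n] by (intro exI[of _ "F n"]) simp
  qed
  ultimately show ?thesis by blast
qed

lemma inner_limit:
  assumes u: "u \<in> L2" and lim: "((\<lambda>F. L2_norm (\<lambda>x. u x - comb F c x)) \<longlongrightarrow> 0) (finite_subsets_at_top I)" and j: "j \<in> I"
  shows "L2_inner u (e j) = c j"
proof -
  have "cmod (L2_inner u (e j) - c j) \<le> 0 * L2_norm (e j)"
  proof (rule tendsto_lowerbound[OF tendsto_mult[OF lim tendsto_const]])
    show "eventually (\<lambda>F. cmod (L2_inner u (e j) - c j) \<le> L2_norm (\<lambda>x. u x - comb F c x) * L2_norm (e j)) (finite_subsets_at_top I)"
      unfolding eventually_finite_subsets_at_top
    proof (intro exI[of _ "{j}"] conjI allI impI)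
      fix F assume F: "finite F \<and> {j} \<subseteq> F \<and> F \<subseteq> I"
      then have "L2_inner (\<lambda>x. u x - comb F c x) (e j) = L2_inner u (e j) - c j"
        using u j by (simp add: L2_inner_diff_left comb_L2 e_L2 inner_comb_basis)
      then show "cmod (L2_inner u (e j) - c j) \<le> L2_norm (\<lambda>x. u x - comb F c x) * L2_norm (e j)"
        using L2_Cauchy_Schwarz[OF L2_diff[OF u comb_L2] e_L2[OF j], of F c] F by simp
    qed (use j in auto)
  qed simp
  then show ?thesis by simp
qed

end

locale orthonormal_basis = orthonormal_system +
  assumes total: "\<And>f. f \<in> L2 \<Longrightarrow> (\<And>i. i \<in> I \<Longrightarrow> L2_inner f (e i) = 0) \<Longrightarrow> AE x in disk. f x = 0"
begin

text \<open>Riesz--Fischer produces some u with the coefficients of f; totality identifies u with f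
  almost everywhere.\<close>

lemma expansion:
  assumes f: "f \<in> L2"
  shows "((\<lambda>F. L2_norm (\<lambda>x. f x - comb F (\<lambda>i. L2_inner f (e i)) x)) \<longlongrightarrow> 0) (finite_subsets_at_top I)"
proof -
  let ?c = "\<lambda>i. L2_inner f (e i)"
  obtain u where u: "u \<in> L2" "((\<lambda>F. L2_norm (\<lambda>x. u x - comb F ?c x)) \<longlongrightarrow> 0) (finite_subsets_at_top I)"
    using Riesz_Fischer[OF Bessel_summable[OF f]] by blast
  have "AE x in disk. f x - u x = 0"
  proof (rule total)
    show "(\<lambda>x. f x - u x) \<in> L2" by (rule L2_diff[OF f u(1)])
    show "L2_inner (\<lambda>x. f x - u x) (e i) = 0" if "i \<in> I" for i
      using inner_limit[OF u that] that by (simp add: L2_inner_diff_left f u(1) e_L2)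
  qed
  then have eq: "AE x in disk. f x = u x" by eventually_elim simp
  have "L2_norm (\<lambda>x. f x - comb F ?c x) = L2_norm (\<lambda>x. u x - comb F ?c x)" if "F \<subseteq> I" for F
    by (rule L2_norm_cong_AE) (use f u(1) comb_L2[OF that] eq in \<open>auto intro: L2_diff elim: eventually_mono\<close>)
  then have "eventually (\<lambda>F. L2_norm (\<lambda>x. u x - comb F ?c x) = L2_norm (\<lambda>x. f x - comb F ?c x)) (finite_subsets_at_top I)"
    unfolding eventually_finite_subsets_at_top by (intro exI[of _ "{}"]) auto
  from Lim_transform_eventually[OF u(2) this] show ?thesis .
qed

lemma Parseval:
  assumes f: "f \<in> L2"
  shows "((\<lambda>i. (cmod (L2_inner f (e i)))\<^sup>2) has_sum (L2_norm f)\<^sup>2) I"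
proof -
  have "((\<lambda>F. (L2_norm f)\<^sup>2 - (L2_norm (\<lambda>x. f x - comb F (\<lambda>i. L2_inner f (e i)) x))\<^sup>2) \<longlongrightarrow> (L2_norm f)\<^sup>2 - 0\<^sup>2) (finite_subsets_at_top I)"
    by (intro tendsto_intros expansion f)
  moreover have "eventually (\<lambda>F. (L2_norm f)\<^sup>2 - (L2_norm (\<lambda>x. f x - comb F (\<lambda>i. L2_inner f (e i)) x))\<^sup>2
      = sum (\<lambda>i. (cmod (L2_inner f (e i)))\<^sup>2) F) (finite_subsets_at_top I)"
    unfolding eventually_finite_subsets_at_top
    using norm_diff_projection[OF _ _ f] by (intro exI[of _ "{}"]) auto
  ultimately show ?thesis
    unfolding has_sum_def using Lim_transform_eventually by fastforce
qed

lemma ex_coefficients: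
  assumes "(\<lambda>i. (cmod (c i))\<^sup>2) summable_on I"
  shows "\<exists>u\<in>L2. \<forall>i\<in>I. L2_inner u (e i) = c i"
  using Riesz_Fischer[OF assms] inner_limit by blast

end

section \<open>Spectrum of the diagonal operator\<close>

locale mode_basis = orthonormal_basis modes eigenfun
begin

text \<open>Reduces the operator to multiplication of coefficients. The domain condition follows
  from f in \<open>L2\<close>, since Bessel's inequality makes the squared coefficients of f
  summable; the series converges to f by \<open>expansion\<close>.\<close>

lemma L_op_iff:
  "(u, f) \<in> L_op \<alpha> \<longleftrightarrow> u \<in> L2 \<and> f \<in> L2 \<and>
     (\<forall>i\<in>modes. L2_inner f (eigenfun i) = complex_of_real (mode_eigenvalue \<alpha> i) * L2_inner u (eigenfun i))"
  (is "?L \<longleftrightarrow> ?R")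
proof -
  let ?c = "\<lambda>i. complex_of_real (mode_eigenvalue \<alpha> i) * L2_inner u (eigenfun i)"
  have L: "?L \<longleftrightarrow> u \<in> L_domain \<alpha> \<and> f \<in> L2 \<and> ((\<lambda>F. L2_norm (\<lambda>x. f x - comb F ?c x)) \<longlongrightarrow> 0) (finite_subsets_at_top modes)"
    by (simp add: L_op_def comb_def)
  show ?thesis
  proof
    assume ?L
    then show ?R unfolding L using inner_limit[of f ?c] by (auto simp: L_domain_def)
  next
    assume R: ?R
    have "(\<lambda>i. (mode_eigenvalue \<alpha> i)\<^sup>2 * (cmod (L2_inner u (eigenfun i)))\<^sup>2) summable_on modes
      \<longleftrightarrow> (\<lambda>i. (cmod (L2_inner f (eigenfun i)))\<^sup>2) summable_on modes"
      using R by (intro summable_on_cong) (simp add: norm_mult power_mult_distrib)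
    then have "u \<in> L_domain \<alpha>" using R Bessel_summable by (simp add: L_domain_def)
    moreover have "((\<lambda>F. L2_norm (\<lambda>x. f x - comb F ?c x)) \<longlongrightarrow> 0) (finite_subsets_at_top modes)"
    proof (rule Lim_transform_eventually)
      show "((\<lambda>F. L2_norm (\<lambda>x. f x - comb F (\<lambda>i. L2_inner f (eigenfun i)) x)) \<longlongrightarrow> 0) (finite_subsets_at_top modes)"
        using R by (intro expansion) simp
      have "comb F (\<lambda>i. L2_inner f (eigenfun i)) = comb F ?c" if "F \<subseteq> modes" for F
        unfolding comb_def[abs_def] using R that by (intro ext sum.cong) auto
      then show "eventually (\<lambda>F. L2_norm (\<lambda>x. f x - comb F (\<lambda>i. L2_inner f (eigenfun i)) x) = L2_norm (\<lambda>x. f x - comb F ?c x)) (finite_subsets_at_top modes)"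
        unfolding eventually_finite_subsets_at_top by (intro exI[of _ "{}"]) auto
    qed
    ultimately show ?L using R unfolding L by simp
  qed
qed

lemma eigenfun_nonzero:
  assumes "i \<in> modes"
  shows "\<not> (AE x in disk. eigenfun i x = 0)"
proof
  assume "AE x in disk. eigenfun i x = 0"
  then have "L2_norm (eigenfun i) = 0" using L2_norm_eq_0_iff[OF e_L2[OF assms]] by simp
  then show False using L2_inner_self[of "eigenfun i"] orthonormal[OF assms assms] by simp
qed

lemma eigenfun_L_op:
  assumes "i \<in> modes"
  shows "(eigenfun i, \<lambda>x. complex_of_real (mode_eigenvalue \<alpha> i) * eigenfun i x) \<in> L_op \<alpha>"
  unfolding L_op_iff using assms e_L2 by (auto simp: L2_scale L2_inner_scale_left orthonormal)

lemma mode_eigenvalue_is_eigenvalue: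
  assumes "i \<in> modes"
  shows "is_eigenvalue (L_op \<alpha>) (complex_of_real (mode_eigenvalue \<alpha> i))"
  unfolding is_eigenvalue_def eigenspace_def
  using eigenfun_L_op[OF assms] eigenfun_nonzero[OF assms] by (intro bexI[of _ "eigenfun i"]) auto

lemma mode_eigenvalue_in_spectrum:
  assumes "i \<in> modes"
  shows "complex_of_real (mode_eigenvalue \<alpha> i) \<in> spectrum (L_op \<alpha>)"
  unfolding spectrum_def
proof (rule ComplI)
  let ?z = "complex_of_real (mode_eigenvalue \<alpha> i)"
  assume "?z \<in> resolvent_set (L_op \<alpha>)"
  then have "\<forall>(u, f)\<in>L_op \<alpha>. (AE x in disk. f x - ?z * u x = 0) \<longrightarrow> (AE x in disk. u x = 0)"
    unfolding resolvent_set_def mem_Collect_eq by (rule conjunct1)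
  from bspec[OF this eigenfun_L_op[OF assms]] eigenfun_nonzero[OF assms] show False by simp
qed

text \<open>Dividing coefficients by the difference of eigenvalue and z costs at most a factor 1/d.
  With Parseval this gives the bound and injectivity, and with Riesz--Fischer the preimage.\<close>

lemma resolvent_setI:
  assumes d: "d > 0" and gap: "\<And>i. i \<in> modes \<Longrightarrow> d \<le> cmod (complex_of_real (mode_eigenvalue \<alpha> i) - z)"
  shows "z \<in> resolvent_set (L_op \<alpha>)"
proof -
  let ?l = "\<lambda>i. complex_of_real (mode_eigenvalue \<alpha> i)"
  have bound: "L2_norm u \<le> 1 / d * L2_norm (\<lambda>x. f x - z * u x)" if "(u, f) \<in> L_op \<alpha>" for u f
  proof -
    let ?h = "\<lambda>x. f x - z * u x"
    have u: "u \<in> L2" and f: "f \<in> L2" and uf: "\<And>i. i \<in> modes \<Longrightarrow> L2_inner f (eigenfun i) = ?l i * L2_inner u (eigenfun i)"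
      using that by (auto simp: L_op_iff)
    have h: "?h \<in> L2" by (intro L2_diff f L2_scale u)
    have hi: "L2_inner ?h (eigenfun i) = (?l i - z) * L2_inner u (eigenfun i)" if "i \<in> modes" for i
      using that by (simp add: L2_inner_diff_left f L2_scale u e_L2 L2_inner_scale_left uf algebra_simps)
    have "d\<^sup>2 * (L2_norm u)\<^sup>2 \<le> (L2_norm ?h)\<^sup>2"
    proof (rule has_sum_mono)
      show "((\<lambda>i. d\<^sup>2 * (cmod (L2_inner u (eigenfun i)))\<^sup>2) has_sum d\<^sup>2 * (L2_norm u)\<^sup>2) modes"
        by (intro has_sum_cmult_right Parseval u)
      show "((\<lambda>i. (cmod (L2_inner ?h (eigenfun i)))\<^sup>2) has_sum (L2_norm ?h)\<^sup>2) modes"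
        by (rule Parseval[OF h])
      fix i assume i: "i \<in> modes"
      show "d\<^sup>2 * (cmod (L2_inner u (eigenfun i)))\<^sup>2 \<le> (cmod (L2_inner ?h (eigenfun i)))\<^sup>2"
        unfolding hi[OF i] norm_mult power_mult_distrib
        using gap[OF i] d by (intro mult_right_mono power_mono) auto
    qed
    then have "(d * L2_norm u)\<^sup>2 \<le> (L2_norm ?h)\<^sup>2" by (simp add: power_mult_distrib)
    then have "d * L2_norm u \<le> L2_norm ?h" by (rule power2_le_imp_le) simp
    then show ?thesis using d by (simp add: field_simps)
  qed
  show ?thesis unfolding resolvent_set_def
  proof (intro CollectI conjI)
    show "\<forall>(u, f)\<in>L_op \<alpha>. (AE x in disk. f x - z * u x = 0) \<longrightarrow> (AE x in disk. u x = 0)"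
    proof (rule ballI, rule case_prodI2, rule impI)
      fix p u f assume "p \<in> L_op \<alpha>" "p = (u, f)" and 0: "AE x in disk. f x - z * u x = 0"
      then have uf: "(u, f) \<in> L_op \<alpha>" by simp
      have "u \<in> L2" "(\<lambda>x. f x - z * u x) \<in> L2" using uf by (auto simp: L_op_iff intro: L2_diff L2_scale)
      moreover from this have "L2_norm (\<lambda>x. f x - z * u x) = 0" using 0 by (subst L2_norm_eq_0_iff) auto
      then have "L2_norm u = 0" using bound[OF uf] L2_norm_nonneg[of u] by simp
      ultimately show "AE x in disk. u x = 0" by (simp add: L2_norm_eq_0_iff)
    qed
  next
    show "\<forall>g\<in>L2. \<exists>(u, f)\<in>L_op \<alpha>. AE x in disk. f x - z * u x = g x"
    proof
      fix g assume g: "g \<in> L2"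
      define c where "c i = L2_inner g (eigenfun i) / (?l i - z)" for i
      have "(\<lambda>i. (cmod (c i))\<^sup>2) summable_on modes"
      proof (rule summable_on_comparison_test)
        show "(\<lambda>i. (1 / d\<^sup>2) * (cmod (L2_inner g (eigenfun i)))\<^sup>2) summable_on modes"
          by (intro summable_on_cmult_right Bessel_summable g)
        fix i assume i: "i \<in> modes"
        have "(cmod (c i))\<^sup>2 = (cmod (L2_inner g (eigenfun i)))\<^sup>2 / (cmod (?l i - z))\<^sup>2"
          by (simp add: c_def norm_divide power_divide)
        also have "\<dots> \<le> (cmod (L2_inner g (eigenfun i)))\<^sup>2 / d\<^sup>2"
          using gap[OF i] d by (intro divide_left_mono power_mono mult_pos_pos zero_less_power) auto
        finally show "(cmod (c i))\<^sup>2 \<le> (1 / d\<^sup>2) * (cmod (L2_inner g (eigenfun i)))\<^sup>2" by simp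
      qed auto
      then obtain u where u: "u \<in> L2" "\<And>i. i \<in> modes \<Longrightarrow> L2_inner u (eigenfun i) = c i"
        using ex_coefficients by blast
      \<comment> \<open>The image is defined through the equation to be solved, which therefore
        holds pointwise; what remains is a check of coefficients.\<close>
      let ?f = "\<lambda>x. g x + z * u x"
      have "(u, ?f) \<in> L_op \<alpha>"
        unfolding L_op_iff
      proof (intro conjI ballI)
        show "?f \<in> L2" by (intro L2_add g L2_scale u)
        fix i assume i: "i \<in> modes"
        have "?l i - z \<noteq> 0" using gap[OF i] d by auto
        then have "L2_inner g (eigenfun i) = (?l i - z) * c i" by (simp add: c_def)
        then show "L2_inner ?f (eigenfun i) = ?l i * L2_inner u (eigenfun i)"
          using i by (simp add: L2_inner_add_left g L2_scale u e_L2 L2_inner_scale_left algebra_simps)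
      qed (rule u)
      then show "\<exists>(u, f)\<in>L_op \<alpha>. AE x in disk. f x - z * u x = g x"
        by (intro bexI[of _ "(u, ?f)"]) auto
    qed
  next
    show "\<exists>C. \<forall>(u, f)\<in>L_op \<alpha>. L2_norm u \<le> C * L2_norm (\<lambda>x. f x - z * u x)"
      using bound by (intro exI[of _ "1 / d"]) auto
  qed
qed

text \<open>An eigenvector has zero coefficients at all modes with another eigenvalue, so by
  totality it is the finite combination of the others.\<close>

lemma finite_multiplicityI:
  assumes fin: "finite {i \<in> modes. complex_of_real (mode_eigenvalue \<alpha> i) = z}"
  shows "finite_multiplicity (L_op \<alpha>) z"
proof -
  let ?J = "{i \<in> modes. complex_of_real (mode_eigenvalue \<alpha> i) = z}"
  have inj: "inj_on eigenfun ?J"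
  proof (rule inj_onI)
    fix i j assume "i \<in> ?J" "j \<in> ?J" "eigenfun i = eigenfun j"
    then show "i = j" using orthonormal[of i j] orthonormal[of i i] by (auto split: if_splits)
  qed
  show ?thesis unfolding finite_multiplicity_def
  proof (intro exI[of _ "eigenfun ` ?J"] conjI ballI)
    show "finite (eigenfun ` ?J)" using fin by simp
    show "eigenfun ` ?J \<subseteq> L2" using e_L2 by auto
    fix u assume "u \<in> eigenspace (L_op \<alpha>) z"
    then obtain f where uf: "(u, f) \<in> L_op \<alpha>" and fz: "AE x in disk. f x = z * u x"
      by (auto simp: eigenspace_def)
    have u: "u \<in> L2" and f: "f \<in> L2" using uf by (auto simp: L_op_iff)
    have zero: "L2_inner u (eigenfun i) = 0" if i: "i \<in> modes" "i \<notin> ?J" for i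
    proof -
      have "L2_inner f (eigenfun i) = L2_inner (\<lambda>x. z * u x) (eigenfun i)"
        by (intro L2_inner_cong_AE f L2_scale u e_L2 i fz)
      then have "complex_of_real (mode_eigenvalue \<alpha> i) * L2_inner u (eigenfun i) = z * L2_inner u (eigenfun i)"
        using uf i by (simp add: L_op_iff L2_inner_scale_left)
      then show ?thesis using i by simp
    qed
    let ?S = "comb ?J (\<lambda>i. L2_inner u (eigenfun i))"
    have S: "?S \<in> L2" by (rule comb_L2) auto
    have "AE x in disk. u x - ?S x = 0"
    proof (rule total)
      show "(\<lambda>x. u x - ?S x) \<in> L2" by (rule L2_diff[OF u S])
      fix i assume i: "i \<in> modes"
      have "L2_inner ?S (eigenfun i) = (if i \<in> ?J then L2_inner u (eigenfun i) else 0)"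
        by (rule inner_comb_basis[OF fin _ i]) auto
      then show "L2_inner (\<lambda>x. u x - ?S x) (eigenfun i) = 0"
        using zero[OF i] by (simp add: L2_inner_diff_left[OF u S e_L2[OF i]] split: if_splits)
    qed
    moreover have "?S x = (\<Sum>v\<in>eigenfun ` ?J. L2_inner u v * v x)" for x
      unfolding comb_def by (simp add: sum.reindex[OF inj])
    ultimately show "\<exists>c. AE x in disk. u x = (\<Sum>v\<in>eigenfun ` ?J. c v * v x)"
      by (intro exI[of _ "L2_inner u"]) simp
  qed
qed

end

section \<open>Integrals over the disk\<close>

definition zc :: "real ^ 2 \<Rightarrow> complex" where
  "zc x = Complex (x $ 1) (x $ 2)"

lemma zc_eq: "zc x = complex_of_real (x $ 1) + \<i> * complex_of_real (x $ 2)"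
  by (simp add: zc_def Complex_eq)

lemma norm_zc: "cmod (zc x) = norm x"
  by (simp add: zc_def cmod_def norm_eq_sqrt_inner inner_vec_def sum_2 power2_eq_square)

lemma continuous_on_zc [continuous_intros]: "continuous_on S zc"
  unfolding zc_eq[abs_def] by (intro continuous_intros)

lemma zc_power_polar: "zc x ^ l = complex_of_real (norm x ^ l) * cis (real l * polar_angle x)"
proof -
  have "zc x = rcis (norm x) (polar_angle x)"
    using rcis_cmod_Arg[of "zc x"] by (simp add: norm_zc polar_angle_def zc_def[symmetric])
  then have "zc x ^ l = rcis (norm x ^ l) (real l * polar_angle x)" by (simp add: DeMoivre2)
  then show ?thesis by (simp add: rcis_def)
qed

lemma continuous_measurable_disk:
  fixes F :: "real ^ 2 \<Rightarrow> 'a :: euclidean_space"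
  assumes "continuous_on UNIV F"
  shows "F \<in> borel_measurable disk"
  by (rule continuous_imp_measurable_on_sets_lebesgue) (use assms continuous_on_subset in auto)

lemma continuous_bounded_disk:
  fixes F :: "real ^ 2 \<Rightarrow> 'a :: euclidean_space"
  assumes "continuous_on UNIV F"
  obtains B where "\<And>x. x \<in> cball 0 1 \<Longrightarrow> norm (F x) \<le> B"
proof -
  have "compact (F ` cball 0 1)"
    by (intro compact_continuous_image continuous_on_subset[OF assms]) auto
  then have "bounded (F ` cball 0 1)" by (rule compact_imp_bounded)
  then obtain B where "\<forall>y\<in>F ` cball 0 1. norm y \<le> B" by (auto simp: bounded_iff)
  then show ?thesis using that by blast
qed

lemma continuous_L2:
  assumes "continuous_on UNIV F"
  shows "F \<in> L2"
proof -
  obtain B where "\<And>x. x \<in> cball 0 1 \<Longrightarrow> cmod (F x) \<le> B" using continuous_bounded_disk[OF assms] by blast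
  then show ?thesis by (intro L2_bounded[of F B] continuous_measurable_disk assms) auto
qed

lemma continuous_integrable_disk:
  fixes F :: "real ^ 2 \<Rightarrow> 'a :: euclidean_space"
  assumes "continuous_on UNIV F"
  shows "integrable disk F"
proof -
  obtain B where "\<And>x. x \<in> cball 0 1 \<Longrightarrow> norm (F x) \<le> B" using continuous_bounded_disk[OF assms] by blast
  then have "AE x in disk. norm (F x) \<le> B" by (intro AE_I2) auto
  then show ?thesis by (rule disk.integrable_const_bound) (rule continuous_measurable_disk[OF assms])
qed

lemma integral_disk_rotation_real:
  fixes h :: "real ^ 2 \<Rightarrow> real"
  assumes g: "orthogonal_transformation g" and h: "continuous_on UNIV h"
  shows "(LINT x|disk. h (g x)) = (LINT x|disk. h x)"
proof -
  \<comment> \<open>Packing the values into \<open>real ^ 1\<close> fits the vector-valued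
    \<open>integral_change_of_variables_linear\<close>; its only component is unpacked again
    below.\<close>
  define f :: "real ^ 2 \<Rightarrow> real ^ 1" where "f x = (\<chi> i. h x)" for x
  have lin: "linear g" using g by (rule orthogonal_transformation_linear)
  have img: "g ` ball 0 1 = ball 0 1"
    using image_orthogonal_transformation_ball[OF g, of 0 1] lin by (simp add: linear_0)
  have cg: "continuous_on UNIV g" using lin by (rule linear_continuous_on_compose[OF continuous_on_id, simplified])
  have cf: "continuous_on UNIV f" unfolding f_def by (intro continuous_intros h)
  have chg: "continuous_on UNIV (\<lambda>x. h (g x))" using continuous_on_compose2[OF h cg] by simp
  have ai: "f absolutely_integrable_on ball 0 1"
    using continuous_integrable_disk[OF cf] by (simp add: set_integrable_def integrable_restrict_space)
  have io: "k integrable_on ball 0 1" if "continuous_on UNIV k" for k :: "real ^ 2 \<Rightarrow> real ^ 1"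
    using continuous_integrable_disk[OF that] by (intro integrable_on_lebesgue_on) auto
  have "integral (ball 0 1) f = integral (ball 0 1) (f \<circ> g)"
    using integral_change_of_variables_linear[OF lin, where f = f and S = "ball 0 1"] ai g unfolding img by simp
  then have "integral (ball 0 1) f $ 1 = integral (ball 0 1) (f \<circ> g) $ 1" by simp
  moreover have "integral (ball 0 1) f $ 1 = integral (ball 0 1) h"
    using integral_component_eq_cart[OF io[OF cf], of 1] by (simp add: f_def)
  moreover have "integral (ball 0 1) (f \<circ> g) $ 1 = integral (ball 0 1) (\<lambda>x. h (g x))"
  proof -
    have "continuous_on UNIV (f \<circ> g)" using continuous_on_compose[OF cg] cf continuous_on_subset by blast
    from integral_component_eq_cart[OF io[OF this], of 1] show ?thesis by (simp add: f_def)
  qed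
  moreover have "(LINT x|disk. k x) = integral (ball 0 1) k" if "continuous_on UNIV k" for k :: "real ^ 2 \<Rightarrow> real"
    by (rule lebesgue_integral_eq_integral) (use continuous_integrable_disk[OF that] in auto)
  ultimately show ?thesis using h chg by simp
qed

lemma integral_disk_rotation:
  fixes F :: "real ^ 2 \<Rightarrow> complex"
  assumes g: "orthogonal_transformation g" and F: "continuous_on UNIV F"
  shows "(LINT x|disk. F (g x)) = (LINT x|disk. F x)"
proof -
  have lin: "linear g" using g by (rule orthogonal_transformation_linear)
  have cg: "continuous_on UNIV g" using lin by (rule linear_continuous_on_compose[OF continuous_on_id, simplified])
  have cFg: "continuous_on UNIV (\<lambda>x. F (g x))" using continuous_on_compose2[OF F cg] by simp
  note i = continuous_integrable_disk[OF F] continuous_integrable_disk[OF cFg]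
  have cR: "continuous_on UNIV (\<lambda>x. Re (F x))" and cI: "continuous_on UNIV (\<lambda>x. Im (F x))" by (intro continuous_intros F)+
  show ?thesis
    using integral_disk_rotation_real[OF g cR] integral_disk_rotation_real[OF g cI] i
    by (intro complex_eqI) (simp_all flip: Bochner_Integration.integral_Re Bochner_Integration.integral_Im)
qed

section \<open>Rotations, and the substitute for polar coordinates\<close>

definition rot :: "real \<Rightarrow> real ^ 2 \<Rightarrow> real ^ 2" where
  "rot t x = vector [cos t * x $ 1 - sin t * x $ 2, sin t * x $ 1 + cos t * x $ 2]"

lemma zc_rot: "zc (rot t x) = cis t * zc x"
  by (simp add: zc_def rot_def complex_eq_iff)

lemma norm_rot: "norm (rot t x) = norm x"
  by (simp flip: norm_zc add: zc_rot norm_mult)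

lemma orthogonal_transformation_rot: "orthogonal_transformation (rot t)"
  unfolding orthogonal_transformation
proof
  show "linear (rot t)"
    by (rule linearI) (simp_all add: rot_def vec_eq_iff forall_2 algebra_simps)
qed (simp add: norm_rot)

text \<open>Rotation by t multiplies this by \<open>cis ((a - b) * t)\<close>, so the difference a -
  b plays the part of the Fourier frequency in the angle.\<close>

definition zmono :: "nat \<Rightarrow> nat \<Rightarrow> (real \<Rightarrow> real) \<Rightarrow> real ^ 2 \<Rightarrow> complex" where
  "zmono a b q x = zc x ^ a * cnj (zc x) ^ b * complex_of_real (q ((norm x)\<^sup>2))"

lemma continuous_on_zmono:
  assumes "continuous_on UNIV q"
  shows "continuous_on S (zmono a b q)"
  unfolding zmono_def[abs_def]
  by (intro continuous_intros continuous_on_compose2[OF assms]) auto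

text \<open>Rotation by pi / (a - b) changes the sign of the integrand and preserves its
  integral.\<close>

lemma integral_zmono_neq:
  assumes q: "continuous_on UNIV q" and "a \<noteq> b"
  shows "(LINT x|disk. zmono a b q x) = 0"
proof -
  define t where "t = pi / (real a - real b)"
  have t: "real a * t - real b * t = pi"
  proof -
    have "real a * t - real b * t = (real a - real b) * t" by (simp add: algebra_simps)
    then show ?thesis using assms(2) by (simp add: t_def)
  qed
  have "zmono a b q (rot t x) = - zmono a b q x" for x
  proof -
    have "cis t ^ a * cnj (cis t) ^ b = cis (real a * t) * cis (real b * (- t))"
      by (simp only: Complex.DeMoivre cis_cnj)
    also have "\<dots> = cis (real a * t - real b * t)" by (simp add: cis_mult)
    finally have "cis t ^ a * cnj (cis t) ^ b = - 1" unfolding t by simp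
    moreover have "zmono a b q (rot t x) = (cis t ^ a * cnj (cis t) ^ b) * zmono a b q x"
      unfolding zmono_def zc_rot norm_rot complex_cnj_mult power_mult_distrib by (simp only: mult_ac)
    ultimately show ?thesis by simp
  qed
  moreover have "(LINT x|disk. zmono a b q (rot t x)) = (LINT x|disk. zmono a b q x)"
    by (rule integral_disk_rotation[OF orthogonal_transformation_rot continuous_on_zmono[OF q]])
  ultimately have "(LINT x|disk. zmono a b q x) = - (LINT x|disk. zmono a b q x)" by simp
  then show ?thesis by simp
qed

text \<open>The points with |x|^2 > t form an annulus of area pi (1 - t) for t in [0,1], so |x|^2 is
  uniformly distributed on [0,1] with mass pi; the rays \<open>{t<..}\<close> determine a measure on
  the line. This is the source of the variable y = r^2.\<close>

lemma distr_norm_sq_disk: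
  "distr disk borel (\<lambda>x. (norm x)\<^sup>2) = density lborel (\<lambda>y. ennreal (pi * indicator {0..1} y))"
proof (rule measure_eqI_lessThan)
  have meas: "(\<lambda>x::real^2. (norm x)\<^sup>2) \<in> borel_measurable disk"
    by (rule continuous_measurable_disk) (intro continuous_intros)
  have eq: "emeasure (distr disk borel (\<lambda>x. (norm x)\<^sup>2)) {t<..} = ennreal (pi * (1 - min 1 (max 0 t)))" for t
  proof -
    define s where "s = sqrt (min 1 (max 0 t))"
    have s: "0 \<le> s" "s \<le> 1" "s\<^sup>2 = min 1 (max 0 t)" by (auto simp: s_def)
    have "emeasure (distr disk borel (\<lambda>x. (norm x)\<^sup>2)) {t<..} = emeasure disk ((\<lambda>x. (norm x)\<^sup>2) -` {t<..} \<inter> space disk)"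
      by (rule emeasure_distr[OF meas]) simp
    also have "\<dots> = emeasure lebesgue ((\<lambda>x. (norm x)\<^sup>2) -` {t<..} \<inter> space disk)"
      by (rule emeasure_restrict_space) auto
    \<comment> \<open>For t < 0 nothing may be removed, whereas \<open>cball 0 0\<close> would take
      out the origin.\<close>
    also have "\<dots> = emeasure lebesgue (ball 0 1 - (if t < 0 then {} else cball 0 s) :: (real^2) set)"
    proof (rule arg_cong[where f = "emeasure lebesgue"])
      have "t < (norm x)\<^sup>2 \<longleftrightarrow> \<not> norm x \<le> s" if "norm x < 1" "t \<ge> 0" for x :: "real^2"
      proof (cases "t \<le> 1")
        case True
        then have "s = sqrt t" using that by (simp add: s_def)
        then show ?thesis using that by (metis norm_ge_zero not_le real_sqrt_le_iff real_sqrt_abs abs_of_nonneg)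
      next
        case False
        then have "(norm x)\<^sup>2 \<le> 1\<^sup>2" using that by (intro power_mono) auto
        then show ?thesis using False that by (simp add: s_def)
      qed
      moreover have "t < (norm x)\<^sup>2" if "t < 0" for x :: "real^2" using that zero_le_power2[of "norm x"] by linarith
      ultimately show "(\<lambda>x. (norm x)\<^sup>2) -` {t<..} \<inter> space disk = (ball 0 1 - (if t < 0 then {} else cball 0 s) :: (real^2) set)"
        by (auto simp: dist_norm)
    qed
    also have "\<dots> = ennreal (pi * (1 - min 1 (max 0 t)))"
    proof (cases "t < 0")
      case True
      then show ?thesis by (simp add: emeasure_ball eval_unit_ball_vol)
    next
      case False
      have e: "emeasure lebesgue (cball 0 s :: (real^2) set) = ennreal (pi * s\<^sup>2)"
        using emeasure_cball[OF s(1), of "0 :: real^2"] by (simp add: eval_unit_ball_vol)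
      have b: "emeasure lebesgue (ball 0 1 :: (real^2) set) = ennreal pi"
        by (simp add: emeasure_ball eval_unit_ball_vol)
      have bs: "emeasure lebesgue (ball 0 s :: (real^2) set) = ennreal (pi * s\<^sup>2)"
        using emeasure_ball[OF s(1), of "0 :: real^2"] by (simp add: eval_unit_ball_vol)
      have "emeasure lebesgue (ball 0 1 - cball 0 s :: (real^2) set) = ennreal (pi * (1 - s\<^sup>2))"
      proof (cases "s = 1")
        case True
        then have e0: "ball 0 1 - cball 0 s = ({} :: (real^2) set)" by auto
        show ?thesis unfolding e0 using True by simp
      next
        case False
        then have "cball 0 s \<subseteq> (ball 0 1 :: (real^2) set)" using s by auto
        then have "emeasure lebesgue (ball 0 1 - cball 0 s :: (real^2) set) = ennreal pi - ennreal (pi * s\<^sup>2)"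
          by (subst emeasure_Diff) (auto simp: e b)
        also have "\<dots> = ennreal (pi - pi * s\<^sup>2)" using s by (intro ennreal_minus) auto
        finally show ?thesis by (simp add: algebra_simps)
      qed
      then show ?thesis using False s(3) by simp
    qed
    finally show ?thesis .
  qed
  show "emeasure (distr disk borel (\<lambda>x. (norm x)\<^sup>2)) {t<..} < \<infinity>" for t
    unfolding eq by simp
  show "emeasure (distr disk borel (\<lambda>x. (norm x)\<^sup>2)) {t<..} = emeasure (density lborel (\<lambda>y. ennreal (pi * indicator {0..1} y))) {t<..}" for t
  proof -
    have "emeasure (density lborel (\<lambda>y. ennreal (pi * indicator {0..1} y))) {t<..}
      = (\<integral>\<^sup>+y. ennreal (pi * indicator {0..1} y) * indicator {t<..} y \<partial>lborel)"
      by (rule emeasure_density) auto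
    also have "\<dots> = (\<integral>\<^sup>+y. ennreal pi * indicator ({0..1} \<inter> {t<..}) y \<partial>lborel)"
      by (intro nn_integral_cong) (auto simp: indicator_def)
    also have "\<dots> = ennreal pi * emeasure lborel ({0..1} \<inter> {t<..})"
      by (rule nn_integral_cmult_indicator) auto
    also have "emeasure lborel ({0..1} \<inter> {t<..}) = ennreal (1 - min 1 (max 0 t))"
    proof -
      consider "t < 0" | "0 \<le> t" "t \<le> 1" | "t > 1" by linarith
      then show ?thesis
      proof cases
        case 1
        then have "{0..1} \<inter> {t<..} = {0..1}" by auto
        then show ?thesis using 1 by simp
      next
        case 2
        then have "{0..1} \<inter> {t<..} = {t<..1}" by auto
        then show ?thesis using 2 by simp
      next
        case 3
        then have "{0..1} \<inter> {t<..} = {}" by auto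
        then show ?thesis using 3 by simp
      qed
    qed
    also have "ennreal pi * ennreal (1 - min 1 (max 0 t)) = ennreal (pi * (1 - min 1 (max 0 t)))"
      by (rule ennreal_mult[symmetric]) auto
    finally show ?thesis unfolding eq by simp
  qed
qed auto

lemma integral_disk_radial:
  fixes q :: "real \<Rightarrow> real"
  assumes q: "continuous_on UNIV q"
  shows "(LINT x|disk. q ((norm x)\<^sup>2)) = pi * integral {0..1} q"
proof -
  have meas: "(\<lambda>x::real^2. (norm x)\<^sup>2) \<in> borel_measurable disk"
    by (rule continuous_measurable_disk) (intro continuous_intros)
  have qm: "q \<in> borel_measurable borel" using q by (rule borel_measurable_continuous_onI)
  have "(LINT x|disk. q ((norm x)\<^sup>2)) = (LINT y|distr disk borel (\<lambda>x. (norm x)\<^sup>2). q y)"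
    by (rule integral_distr[symmetric, OF meas qm])
  also have "\<dots> = (LINT y|lborel. (pi * indicator {0..1} y) *\<^sub>R q y)"
    unfolding distr_norm_sq_disk by (rule integral_density) (use qm in auto)
  also have "\<dots> = pi * (LINT y:{0..1}|lborel. q y)"
    by (simp add: set_lebesgue_integral_def mult.assoc)
  also have "(LINT y:{0..1}|lborel. q y) = integral {0..1} q"
    by (intro set_borel_integral_eq_integral borel_integrable_atLeastAtMost' continuous_on_subset[OF q]) auto
  finally show ?thesis .
qed

lemma integral_zmono_eq:
  assumes q: "continuous_on UNIV q"
  shows "(LINT x|disk. zmono a a q x) = complex_of_real (pi * integral {0..1} (\<lambda>y. y ^ a * q y))"
proof -
  have "zmono a a q x = complex_of_real (((norm x)\<^sup>2) ^ a * q ((norm x)\<^sup>2))" for x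
  proof -
    have "zc x ^ a * cnj (zc x) ^ a = (complex_of_real ((norm x)\<^sup>2)) ^ a"
      by (simp only: power_mult_distrib[symmetric] complex_norm_square[symmetric] norm_zc)
    then show ?thesis by (simp add: zmono_def)
  qed
  then have "(LINT x|disk. zmono a a q x) = complex_of_real (LINT x|disk. ((norm x)\<^sup>2) ^ a * q ((norm x)\<^sup>2))"
    by (simp only: integral_complex_of_real)
  also have "(LINT x|disk. ((norm x)\<^sup>2) ^ a * q ((norm x)\<^sup>2)) = pi * integral {0..1} (\<lambda>y. y ^ a * q y)"
    by (rule integral_disk_radial) (intro continuous_intros q)
  finally show ?thesis .
qed

section \<open>The eigenfunctions form an orthonormal basis\<close>

text \<open>In polar coordinates, r^l cos(l \<theta>) q(r^2), but visibly continuous at the origin;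
  \<open>imode\<close> is the sine counterpart.\<close>

definition rmode :: "nat \<Rightarrow> (real \<Rightarrow> real) \<Rightarrow> real ^ 2 \<Rightarrow> complex" where
  "rmode l q x = complex_of_real (Re (zc x ^ l) * q ((norm x)\<^sup>2))"

definition imode :: "nat \<Rightarrow> (real \<Rightarrow> real) \<Rightarrow> real ^ 2 \<Rightarrow> complex" where
  "imode l q x = complex_of_real (Im (zc x ^ l) * q ((norm x)\<^sup>2))"

lemma continuous_on_radial:
  fixes q :: "real \<Rightarrow> real"
  assumes "continuous_on UNIV q"
  shows "continuous_on S (\<lambda>x :: real ^ 2. q ((norm x)\<^sup>2))"
  by (rule continuous_on_compose2[OF assms]) (auto intro!: continuous_intros)

lemma continuous_on_rmode: "continuous_on UNIV q \<Longrightarrow> continuous_on S (rmode l q)"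
  and continuous_on_imode: "continuous_on UNIV q \<Longrightarrow> continuous_on S (imode l q)"
  unfolding rmode_def[abs_def] imode_def[abs_def]
  by (intro continuous_intros continuous_on_radial; assumption)+

lemma Re_eq: "complex_of_real (Re w) = (w + cnj w) / 2"
  and Im_eq: "complex_of_real (Im w) = (w - cnj w) / (2 * \<i>)"
  by (simp_all add: complex_add_cnj complex_diff_cnj complex_eq_iff)

lemma cnj_rmode: "cnj (rmode l q x) = rmode l q x"
  and cnj_imode: "cnj (imode l q x) = imode l q x"
  by (simp_all add: rmode_def imode_def)

context
  fixes q q' :: "real \<Rightarrow> real" and l l' :: nat
  assumes q: "continuous_on UNIV q" and q': "continuous_on UNIV q'"
begin

private abbreviation "qq \<equiv> \<lambda>y. q y * q' y"

private abbreviation (input) "M a b \<equiv> (LINT x|disk. zmono a b qq x)"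

private lemma cont_qq: "continuous_on UNIV qq" by (intro continuous_intros q q')

private lemma int: "integrable disk (zmono a b qq)"
  by (rule continuous_integrable_disk[OF continuous_on_zmono[OF cont_qq]])

text \<open>Writing real parts as (w + cnj w)/2 expands the product into four monomials, each with a
  definite angular frequency.\<close>

private lemma inner_rmode_M:
  "L2_inner (rmode l q) (rmode l' q') = (M (l + l') 0 + M l l' + M l' l + M 0 (l + l')) / 4"
proof -
  have eq: "rmode l q x * cnj (rmode l' q' x)
     = (zmono (l + l') 0 qq x + zmono l l' qq x + zmono l' l qq x + zmono 0 (l + l') qq x) / 4" for x
  proof -
    let ?Z = "zc x ^ l" and ?Z' = "zc x ^ l'" and ?q = "complex_of_real (q ((norm x)\<^sup>2))" and ?q' = "complex_of_real (q' ((norm x)\<^sup>2))"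
    have "rmode l q x * cnj (rmode l' q' x) = ((?Z + cnj ?Z) / 2 * ?q) * ((?Z' + cnj ?Z') / 2 * ?q')"
      by (simp only: cnj_rmode) (simp only: rmode_def of_real_mult Re_eq)
    also have "\<dots> = (?Z * ?Z' * (?q * ?q') + ?Z * cnj ?Z' * (?q * ?q') + ?Z' * cnj ?Z * (?q * ?q') + cnj ?Z * cnj ?Z' * (?q * ?q')) / 4"
      by (simp add: field_simps)
    finally show ?thesis by (simp add: zmono_def power_add)
  qed
  show ?thesis unfolding L2_inner_def eq by (simp add: int)
qed

private lemma inner_imode_M:
  "L2_inner (imode l q) (imode l' q') = (- M (l + l') 0 + M l l' + M l' l - M 0 (l + l')) / 4"
proof -
  have eq: "imode l q x * cnj (imode l' q' x)
     = (- zmono (l + l') 0 qq x + zmono l l' qq x + zmono l' l qq x - zmono 0 (l + l') qq x) / 4" for x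
  proof -
    let ?Z = "zc x ^ l" and ?Z' = "zc x ^ l'" and ?q = "complex_of_real (q ((norm x)\<^sup>2))" and ?q' = "complex_of_real (q' ((norm x)\<^sup>2))"
    have "imode l q x * cnj (imode l' q' x) = ((?Z - cnj ?Z) / (2 * \<i>) * ?q) * ((?Z' - cnj ?Z') / (2 * \<i>) * ?q')"
      by (simp only: cnj_imode) (simp only: imode_def of_real_mult Im_eq)
    also have "\<dots> = (- (?Z * ?Z' * (?q * ?q')) + ?Z * cnj ?Z' * (?q * ?q') + ?Z' * cnj ?Z * (?q * ?q') - cnj ?Z * cnj ?Z' * (?q * ?q')) / 4"
      by (simp add: field_simps)
    finally show ?thesis by (simp add: zmono_def power_add)
  qed
  show ?thesis unfolding L2_inner_def eq by (simp add: int)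
qed

text \<open>For equal orders the mixed monomials have nonzero frequency-free integrals in general;
  they cancel because the imaginary part gives them opposite signs.\<close>

lemma inner_rmode_imode: "L2_inner (rmode l q) (imode l' q') = 0"
proof -
  have eq: "rmode l q x * cnj (imode l' q' x)
     = (zmono (l + l') 0 qq x - zmono l l' qq x + zmono l' l qq x - zmono 0 (l + l') qq x) / (4 * \<i>)" for x
  proof -
    let ?Z = "zc x ^ l" and ?Z' = "zc x ^ l'" and ?q = "complex_of_real (q ((norm x)\<^sup>2))" and ?q' = "complex_of_real (q' ((norm x)\<^sup>2))"
    have "rmode l q x * cnj (imode l' q' x) = ((?Z + cnj ?Z) / 2 * ?q) * ((?Z' - cnj ?Z') / (2 * \<i>) * ?q')"
      by (simp only: cnj_imode) (simp only: rmode_def imode_def of_real_mult Re_eq Im_eq)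
    also have "\<dots> = (?Z * ?Z' * (?q * ?q') - ?Z * cnj ?Z' * (?q * ?q') + ?Z' * cnj ?Z * (?q * ?q') - cnj ?Z * cnj ?Z' * (?q * ?q')) / (4 * \<i>)"
      by (simp add: field_simps)
    finally show ?thesis by (simp add: zmono_def power_add)
  qed
  have "L2_inner (rmode l q) (imode l' q') = (M (l + l') 0 - M l l' + M l' l - M 0 (l + l')) / (4 * \<i>)"
    unfolding L2_inner_def eq by (simp add: int)
  moreover have "M (l + l') 0 = M 0 (l + l')"
    by (cases "l + l' = 0") (simp_all add: integral_zmono_neq[OF cont_qq] del: add_is_0)
  moreover have "M l l' = M l' l"
    by (cases "l = l'") (simp_all add: integral_zmono_neq[OF cont_qq])
  ultimately show ?thesis by simp
qed

text \<open>For l = l' = 0 all four monomials contribute, for l = l' > 0 only the two mixed ones;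
  hence pi against pi / 2.\<close>

lemma inner_rmode:
  "L2_inner (rmode l q) (rmode l' q')
    = (if l = l' then complex_of_real ((if l = 0 then pi else pi / 2) * wip l q q') else 0)"
proof (cases "l = l'")
  case True
  show ?thesis
  proof (cases "l = 0")
    case True
    then show ?thesis using \<open>l = l'\<close> unfolding inner_rmode_M by (simp add: integral_zmono_eq[OF cont_qq] wip_def)
  next
    case False
    then show ?thesis using \<open>l = l'\<close> unfolding inner_rmode_M
      by (simp add: integral_zmono_eq[OF cont_qq] integral_zmono_neq[OF cont_qq] wip_def)
  qed
next
  case False
  then have "M (l + l') 0 = 0" "M 0 (l + l') = 0" "M l l' = 0" "M l' l = 0"
    by (auto intro!: integral_zmono_neq[OF cont_qq])
  then show ?thesis using False by (simp add: inner_rmode_M)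
qed

lemma inner_imode:
  assumes "l \<ge> 1"
  shows "L2_inner (imode l q) (imode l' q') = (if l = l' then complex_of_real (pi / 2 * wip l q q') else 0)"
  using assms unfolding inner_imode_M
  by (auto simp add: integral_zmono_eq[OF cont_qq] integral_zmono_neq[OF cont_qq] wip_def)

end

lemma inner_imode_rmode:
  "continuous_on UNIV q \<Longrightarrow> continuous_on UNIV q' \<Longrightarrow> L2_inner (imode l q) (rmode l' q') = 0"
  using inner_rmode_imode[of q' q l' l] L2_inner_cnj[of "imode l q" "rmode l' q'"] by simp

section \<open>The eigenfunctions as normalized modes\<close>

lemma continuous_on_ce: "continuous_on S (ce l k)"
  by (rule is_C1D[OF is_C1_ce])

definition mode_mass :: "mode \<Rightarrow> real" where
  "mode_mass i = (case i of Phi l k \<Rightarrow> (if l = 0 then pi else pi / 2) * wip l (ce l k) (ce l k)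
      | Psi l k \<Rightarrow> pi / 2 * wip l (ce l k) (ce l k))"

definition raw_mode :: "mode \<Rightarrow> real ^ 2 \<Rightarrow> complex" where
  "raw_mode i = (case i of Phi l k \<Rightarrow> rmode l (ce l k) | Psi l k \<Rightarrow> imode l (ce l k))"

lemma mode_mass_pos: "mode_mass i > 0"
  using wip_ce_pos by (auto simp: mode_mass_def split: mode.split)

lemma wip_ce_nonzero_imp_eq:
  "Suc 0 \<le> k \<Longrightarrow> Suc 0 \<le> k' \<Longrightarrow> wip l (ce l k) (ce l k') \<noteq> 0 \<Longrightarrow> k = k'"
  using wip_ce_orthogonal(1)[of k k' l] by auto

lemma inner_raw_mode:
  assumes "i \<in> modes" "j \<in> modes"
  shows "L2_inner (raw_mode i) (raw_mode j) = (if i = j then complex_of_real (mode_mass i) else 0)"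
  using assms
  by (auto simp: modes_def raw_mode_def mode_mass_def inner_rmode inner_imode inner_rmode_imode inner_imode_rmode
      continuous_on_ce intro: wip_ce_nonzero_imp_eq split: if_splits)

lemma bessel_scaled:
  assumes "k \<ge> 1" "r \<ge> 0"
  shows "Bessel_J (real l) (bz l k * r) = (bz l k / 2) ^ l * (r ^ l * ce l k (r\<^sup>2))"
proof -
  have "bz l k * r \<ge> 0" using bz_pos[OF assms(1), of l] assms(2) by simp
  then have "Bessel_J (real l) (bz l k * r) = (bz l k * r / 2) ^ l * clifford l ((bz l k * r)\<^sup>2 / 4)"
    by (rule Bessel_J_clifford)
  also have "(bz l k * r)\<^sup>2 / 4 = cz l k * r\<^sup>2" by (simp add: cz_def power_mult_distrib)
  also have "(bz l k * r / 2) ^ l = (bz l k / 2) ^ l * r ^ l" by (simp add: power_mult_distrib power_divide)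
  finally show ?thesis by (simp add: ce_def)
qed

lemma Re_zc_power: "Re (zc x ^ l) = norm x ^ l * cos (real l * polar_angle x)"
  and Im_zc_power: "Im (zc x ^ l) = norm x ^ l * sin (real l * polar_angle x)"
  by (simp_all only: zc_power_polar scaleR_conv_of_real[symmetric] scaleR_complex.sel cis.sel)

text \<open>Normalization forgets a positive factor; this is how (j/2)^l from
  \<open>bessel_scaled\<close> disappears.\<close>

lemma normalized:
  assumes raw: "\<And>x. complex_of_real (f x) = complex_of_real A * g x" and A: "A > 0"
    and g: "L2_inner g g = complex_of_real m" "m > 0"
  shows "complex_of_real (f x / sqrt (LINT y|disk. (f y)\<^sup>2)) = complex_of_real (1 / sqrt m) * g x"
proof -
  have "complex_of_real (LINT y|disk. (f y)\<^sup>2) = L2_inner (\<lambda>x. complex_of_real (f x)) (\<lambda>x. complex_of_real (f x))"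
    unfolding L2_inner_def by (simp flip: integral_complex_of_real add: power2_eq_square)
  also have "\<dots> = complex_of_real (A\<^sup>2 * m)"
    unfolding raw L2_inner_scale_left L2_inner_scale_right g by (simp add: power2_eq_square)
  finally have "(LINT y|disk. (f y)\<^sup>2) = A\<^sup>2 * m" unfolding of_real_eq_iff .
  then have "sqrt (LINT y|disk. (f y)\<^sup>2) = A * sqrt m" using A by (simp add: real_sqrt_mult)
  then have "complex_of_real (f x / sqrt (LINT y|disk. (f y)\<^sup>2)) = complex_of_real (f x) / complex_of_real (A * sqrt m)"
    by simp
  also have "\<dots> = complex_of_real (1 / sqrt m) * g x" unfolding raw using A by simp
  finally show ?thesis .
qed

lemma eigenfun_eq:
  assumes "i \<in> modes"
  shows "eigenfun i = (\<lambda>x. complex_of_real (1 / sqrt (mode_mass i)) * raw_mode i x)"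
proof (cases i)
  case (Phi l k)
  then have k: "k \<ge> 1" using assms by (auto simp: modes_def)
  have "complex_of_real (phi_raw l k x) = complex_of_real ((bz l k / 2) ^ l) * raw_mode i x" for x
    unfolding phi_raw_def bessel_scaled[OF k norm_ge_zero] by (simp add: Phi raw_mode_def rmode_def Re_zc_power)
  from normalized[OF this _ inner_raw_mode[OF assms assms, simplified] mode_mass_pos] show ?thesis
    using bz_pos[OF k, of l] by (auto simp: Phi phi_def)
next
  case (Psi l k)
  then have k: "k \<ge> 1" using assms by (auto simp: modes_def)
  have "complex_of_real (psi_raw l k x) = complex_of_real ((bz l k / 2) ^ l) * raw_mode i x" for x
    unfolding psi_raw_def bessel_scaled[OF k norm_ge_zero] by (simp add: Psi raw_mode_def imode_def Im_zc_power)
  from normalized[OF this _ inner_raw_mode[OF assms assms, simplified] mode_mass_pos] show ?thesis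
    using bz_pos[OF k, of l] by (auto simp: Psi psi_def)
qed

lemma raw_mode_L2: "raw_mode i \<in> L2"
  by (cases i) (auto simp: raw_mode_def intro!: continuous_L2 continuous_on_rmode continuous_on_imode continuous_on_ce)

lemma orthonormal_system_modes: "orthonormal_system modes eigenfun"
proof
  show "eigenfun i \<in> L2" if "i \<in> modes" for i
    unfolding eigenfun_eq[OF that] by (intro L2_scale raw_mode_L2)
  show "L2_inner (eigenfun i) (eigenfun j) = (if i = j then 1 else 0)" if "i \<in> modes" "j \<in> modes" for i j
  proof -
    have "sqrt (mode_mass i) * sqrt (mode_mass i) = mode_mass i" using mode_mass_pos[of i] by simp
    then have "complex_of_real (sqrt (mode_mass i)) * complex_of_real (sqrt (mode_mass i)) = complex_of_real (mode_mass i)"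
      by (simp only: of_real_mult[symmetric])
    then show ?thesis
      unfolding eigenfun_eq[OF that(1)] eigenfun_eq[OF that(2)] L2_inner_scale_left L2_inner_scale_right
      using inner_raw_mode[OF that] mode_mass_pos[of i] by (auto simp: field_simps)
  qed
qed

section \<open>Totality of the eigenfunctions\<close>

lemma nonpos_if_le_epsilon_mult:
  fixes t M :: real
  assumes "\<And>\<epsilon>. \<epsilon> > 0 \<Longrightarrow> t \<le> \<epsilon> * M"
  shows "t \<le> 0"
proof (rule field_le_epsilon)
  fix e :: real assume "e > 0"
  then have "t \<le> e / (\<bar>M\<bar> + 1) * M" by (intro assms) (simp add: add_nonneg_pos)
  also have "\<dots> \<le> e / (\<bar>M\<bar> + 1) * (\<bar>M\<bar> + 1)"
    using \<open>e > 0\<close> by (intro mult_left_mono) auto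
  finally show "t \<le> 0 + e" by simp
qed

text \<open>Treats cosine and sine modes at once: t is to be the real or imaginary part of z^l. The
  bound |t| \<le> |x|^l dominates the disk norm by the radial integral with weight y^l, in which
  \<open>ce_dense_monomial\<close> approximates y^b.\<close>

lemma perp_radial_monomial:
  assumes f: "f \<in> L2" and t: "continuous_on UNIV t" "\<And>x. \<bar>t x\<bar> \<le> norm x ^ l"
    and perp: "\<And>k. k \<ge> 1 \<Longrightarrow> L2_inner f (\<lambda>x. complex_of_real (t x * ce l k ((norm x)\<^sup>2))) = 0"
  shows "L2_inner f (\<lambda>x. complex_of_real (t x * ((norm x)\<^sup>2) ^ b)) = 0"
proof -
  let ?T = "\<lambda>q x. complex_of_real (t x * q ((norm x)\<^sup>2))"
  have L2T: "?T q \<in> L2" if "continuous_on UNIV q" for q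
    by (rule continuous_L2) (intro continuous_intros t continuous_on_compose2[OF that]; simp)
  have norm_T: "(L2_norm (?T q))\<^sup>2 \<le> pi * integral {0..1} (\<lambda>y. y ^ l * (q y)\<^sup>2)" if q: "continuous_on UNIV q" for q
  proof -
    have "(L2_norm (?T q))\<^sup>2 = (LINT x|disk. (t x)\<^sup>2 * (q ((norm x)\<^sup>2))\<^sup>2)"
      unfolding L2_norm_sq by (simp add: power_mult_distrib norm_mult)
    also have "\<dots> \<le> (LINT x|disk. ((norm x)\<^sup>2) ^ l * (q ((norm x)\<^sup>2))\<^sup>2)"
    proof (rule integral_mono)
      show "integrable disk (\<lambda>x. (t x)\<^sup>2 * (q ((norm x)\<^sup>2))\<^sup>2)"
        by (rule continuous_integrable_disk) (intro continuous_intros t continuous_on_compose2[OF q]; simp)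
      show "integrable disk (\<lambda>x::real^2. ((norm x)\<^sup>2) ^ l * (q ((norm x)\<^sup>2))\<^sup>2)"
        by (rule continuous_integrable_disk) (intro continuous_intros continuous_on_compose2[OF q]; simp)
      fix x :: "real ^ 2"
      have "\<bar>t x\<bar>\<^sup>2 \<le> (norm x ^ l)\<^sup>2" using t(2)[of x] by (intro power_mono) auto
      also have "(norm x ^ l)\<^sup>2 = ((norm x)\<^sup>2) ^ l" by (simp add: power_mult[symmetric] mult.commute)
      finally show "(t x)\<^sup>2 * (q ((norm x)\<^sup>2))\<^sup>2 \<le> ((norm x)\<^sup>2) ^ l * (q ((norm x)\<^sup>2))\<^sup>2"
        by (intro mult_right_mono) auto
    qed
    also have "\<dots> = pi * integral {0..1} (\<lambda>y. y ^ l * (q y)\<^sup>2)"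
      by (rule integral_disk_radial) (intro continuous_intros q)
    finally show ?thesis .
  qed
  let ?p = "\<lambda>y::real. y ^ b"
  have p: "continuous_on UNIV ?p" by (intro continuous_intros)
  have "cmod (L2_inner f (?T ?p)) \<le> \<epsilon> * L2_norm f" if \<epsilon>: "\<epsilon> > 0" for \<epsilon>
  proof -
    obtain n c where nc: "integral {0..1} (\<lambda>y. y ^ l * (y ^ b - (\<Sum>i\<in>{1..<n}. c i * ce l i y))\<^sup>2) < \<epsilon>\<^sup>2 / pi"
      using ce_dense_monomial[of "\<epsilon>\<^sup>2 / pi" l b] \<epsilon> by auto
    define s where "s y = (\<Sum>i\<in>{1..<n}. c i * ce l i y)" for y
    have s: "continuous_on UNIV s" unfolding s_def[abs_def] by (intro continuous_intros continuous_on_ce)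
    have ps: "continuous_on UNIV (\<lambda>y. ?p y - s y)" by (intro continuous_intros s)
    have "L2_inner f (?T s) = 0"
    proof -
      have "?T s = (\<lambda>x. \<Sum>i\<in>{1..<n}. complex_of_real (c i) * ?T (ce l i) x)"
        by (simp add: s_def sum_distrib_left mult_ac)
      then have "L2_inner f (?T s) = (\<Sum>i\<in>{1..<n}. L2_inner f (\<lambda>x. complex_of_real (c i) * ?T (ce l i) x))"
        by (simp only:) (intro L2_inner_sum_right L2_scale L2T continuous_on_ce f)
      also have "\<dots> = (\<Sum>i\<in>{1..<n}. cnj (complex_of_real (c i)) * L2_inner f (?T (ce l i)))"
        by (simp only: L2_inner_scale_right)
      also have "\<dots> = 0" by (intro sum.neutral ballI) (simp add: perp del: of_real_mult)
      finally show ?thesis .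
    qed
    moreover have "?T (\<lambda>y. ?p y - s y) = (\<lambda>x. ?T ?p x - ?T s x)" by (simp add: algebra_simps)
    ultimately have "L2_inner f (?T ?p) = L2_inner f (?T (\<lambda>y. ?p y - s y))"
      using L2_inner_diff_right[OF L2T[OF p] L2T[OF s] f] by simp
    then have "cmod (L2_inner f (?T ?p)) \<le> L2_norm f * L2_norm (?T (\<lambda>y. ?p y - s y))"
      using L2_Cauchy_Schwarz[OF f L2T[OF ps]] by simp
    also have "\<dots> \<le> L2_norm f * \<epsilon>"
    proof (rule mult_left_mono, rule power2_le_imp_le)
      have "(L2_norm (?T (\<lambda>y. ?p y - s y)))\<^sup>2 \<le> pi * integral {0..1} (\<lambda>y. y ^ l * (?p y - s y)\<^sup>2)"
        by (rule norm_T[OF ps])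
      also have "\<dots> \<le> pi * (\<epsilon>\<^sup>2 / pi)" using nc by (intro mult_left_mono) (auto simp: s_def)
      finally show "(L2_norm (?T (\<lambda>y. ?p y - s y)))\<^sup>2 \<le> \<epsilon>\<^sup>2" by simp
    qed (use \<epsilon> in simp_all)
    finally show ?thesis by (simp add: mult.commute)
  qed
  then have "cmod (L2_inner f (?T ?p)) \<le> 0" by (rule nonpos_if_le_epsilon_mult)
  then show ?thesis by simp
qed

text \<open>The polynomials in z and its conjugate, generated linearly from monomials so that
  orthogonality has to be checked on monomials alone.\<close>

inductive zpoly :: "(real ^ 2 \<Rightarrow> complex) \<Rightarrow> bool" where
  mono: "zpoly (\<lambda>x. zc x ^ a * cnj (zc x) ^ b)"
| add: "zpoly p \<Longrightarrow> zpoly p' \<Longrightarrow> zpoly (\<lambda>x. p x + p' x)"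
| scale: "zpoly p \<Longrightarrow> zpoly (\<lambda>x. c * p x)"

lemma zpoly_mult:
  assumes "zpoly p" "zpoly p'"
  shows "zpoly (\<lambda>x. p x * p' x)"
  using assms(1)
proof induction
  case (mono a b)
  from assms(2) show ?case
  proof induction
    case (mono a' b')
    have "(\<lambda>x. zc x ^ a * cnj (zc x) ^ b * (zc x ^ a' * cnj (zc x) ^ b'))
        = (\<lambda>x. zc x ^ (a + a') * cnj (zc x) ^ (b + b'))"
      by (simp add: power_add mult_ac)
    then show ?case by (metis zpoly.mono)
  next
    case (add p p')
    then show ?case using zpoly.add by (simp add: distrib_left)
  next
    case (scale p c)
    from zpoly.scale[OF scale.IH, of c] show ?case by (simp add: mult_ac)
  qed
next
  case (add p p')
  then show ?case using zpoly.add by (simp add: distrib_right)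
next
  case (scale p c)
  from zpoly.scale[OF scale.IH, of c] show ?case by (simp add: mult_ac)
qed

lemma real_polynomial_function_zpoly:
  assumes "real_polynomial_function p"
  shows "zpoly (\<lambda>x::real^2. complex_of_real (p x))"
  using assms
proof induction
  case (linear h)
  have z: "zpoly (\<lambda>x. (1/2) * (zc x ^ 1 * cnj (zc x) ^ 0) + (1/2) * (zc x ^ 0 * cnj (zc x) ^ 1))"
    "zpoly (\<lambda>x. (- \<i> / 2) * (zc x ^ 1 * cnj (zc x) ^ 0) + (\<i> / 2) * (zc x ^ 0 * cnj (zc x) ^ 1))"
    by (intro zpoly.intros)+
  have x1: "(1/2) * (zc x ^ 1 * cnj (zc x) ^ 0) + (1/2) * (zc x ^ 0 * cnj (zc x) ^ 1) = complex_of_real (x $ 1)" for x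
    by (simp add: zc_def complex_eq_iff)
  have x2: "(- \<i> / 2) * (zc x ^ 1 * cnj (zc x) ^ 0) + (\<i> / 2) * (zc x ^ 0 * cnj (zc x) ^ 1) = complex_of_real (x $ 2)" for x
    by (simp add: zc_def complex_eq_iff)
  have "h x = h (axis 1 1) * x $ 1 + h (axis 2 1) * x $ 2" for x
  proof -
    have "x = (x $ 1) *\<^sub>R axis 1 1 + (x $ 2) *\<^sub>R axis 2 1"
      by (simp add: vec_eq_iff forall_2 axis_def)
    then have "h x = h ((x $ 1) *\<^sub>R axis 1 1 + (x $ 2) *\<^sub>R axis 2 1)" by simp
    then show ?thesis using linear by (simp add: bounded_linear.linear linear_add linear_scale)
  qed
  then have "(\<lambda>x. complex_of_real (h x)) = (\<lambda>x. complex_of_real (h (axis 1 1)) * complex_of_real (x $ 1) + complex_of_real (h (axis 2 1)) * complex_of_real (x $ 2))"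
    by (metis of_real_add of_real_mult)
  then show ?case using z unfolding x1 x2 by (simp add: zpoly.add zpoly.scale)
next
  case (const c)
  from zpoly.scale[OF zpoly.mono[of 0 0], of "complex_of_real c"] show ?case by simp
next
  case (add p p')
  then show ?case using zpoly.add by simp
next
  case (mult p p')
  then show ?case using zpoly_mult by simp
qed

lemma continuous_on_zpoly: "zpoly p \<Longrightarrow> continuous_on UNIV p"
  by (induction rule: zpoly.induct) (intro continuous_intros; assumption?)+

text \<open>The sign of F is an almost everywhere limit of continuous functions; testing against
  them and passing to the limit gives a vanishing integral of |F|.\<close>

lemma AE_zero_if_perp_continuous:
  fixes F :: "real ^ 2 \<Rightarrow> real"
  assumes F: "integrable disk F" and perp: "\<And>g. continuous_on UNIV g \<Longrightarrow> (LINT x|disk. F x * g x) = 0"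
  shows "AE x in disk. F x = 0"
proof -
  have Fm: "F \<in> borel_measurable disk" using F by simp
  define s where "s x = sgn (F x)" for x
  have sm: "s \<in> borel_measurable disk" unfolding s_def[abs_def] using Fm by simp
  then have "s measurable_on (ball 0 1)" by (subst measurable_on_iff_borel_measurable) auto
  then obtain N g where N: "negligible N" and g: "\<And>n. continuous_on UNIV (g n)"
    and lim: "\<And>x. x \<notin> N \<Longrightarrow> (\<lambda>n. g n x) \<longlonglongrightarrow> (if x \<in> ball 0 1 then s x else 0)"
    unfolding measurable_on_def by blast
  \<comment> \<open>Clamping to [-1, 1] provides the dominating function |F| and leaves the limit
    alone, since signs already lie in that range.\<close>
  define h where "h n x = max (-1) (min 1 (g n x))" for n x
  have h: "continuous_on UNIV (h n)" for n unfolding h_def by (intro continuous_intros g)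
  have hb: "\<bar>h n x\<bar> \<le> 1" for n x by (auto simp: h_def)
  have "N \<in> null_sets lebesgue" using N by (simp add: negligible_iff_null_sets)
  then have "AE x in lebesgue. x \<notin> N" by (rule AE_not_in)
  then have AEN: "AE x in disk. x \<notin> N" by (subst AE_restrict_space_iff) auto
  have limh: "AE x in disk. (\<lambda>n. F x * h n x) \<longlonglongrightarrow> \<bar>F x\<bar>"
    using AEN AE_space
  proof eventually_elim
    case (elim x)
    then have "(\<lambda>n. g n x) \<longlonglongrightarrow> s x" using lim[of x] by simp
    then have "(\<lambda>n. F x * h n x) \<longlonglongrightarrow> F x * max (-1) (min 1 (s x))"
      unfolding h_def by (intro tendsto_intros)
    moreover have "F x * max (-1) (min 1 (s x)) = \<bar>F x\<bar>" by (auto simp: s_def sgn_if)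
    ultimately show ?case by simp
  qed
  have "(\<lambda>n. LINT x|disk. F x * h n x) \<longlonglongrightarrow> (LINT x|disk. \<bar>F x\<bar>)"
  proof (rule integral_dominated_convergence[where w = "\<lambda>x. \<bar>F x\<bar>"])
    show "(\<lambda>x. F x * h n x) \<in> borel_measurable disk" for n
      using Fm continuous_measurable_disk[OF h, of n] by simp
    show "AE x in disk. norm (F x * h n x) \<le> \<bar>F x\<bar>" for n
      using hb by (auto simp: abs_mult intro!: mult_left_le)
  qed (use F Fm limh in auto)
  moreover have "(LINT x|disk. F x * h n x) = 0" for n by (rule perp[OF h])
  ultimately have "(\<lambda>n::nat. 0) \<longlonglongrightarrow> (LINT x|disk. \<bar>F x\<bar>)" by simp
  then have "(LINT x|disk. \<bar>F x\<bar>) = 0" by (rule LIMSEQ_unique) (rule tendsto_const)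
  then show ?thesis using integral_nonneg_eq_0_iff_AE[of disk "\<lambda>x. \<bar>F x\<bar>"] F by simp
qed

text \<open>Stone--Weierstrass on the closed disk: uniform closeness implies L2 closeness because
  the area is finite. With real continuous test functions, real and imaginary parts of f can then be
  treated separately.\<close>

lemma AE_zero_if_perp_zpoly:
  assumes f: "f \<in> L2" and perp: "\<And>p. zpoly p \<Longrightarrow> L2_inner f p = 0"
  shows "AE x in disk. f x = 0"
proof -
  have inner0: "L2_inner f (\<lambda>x. complex_of_real (g x)) = 0" if g: "continuous_on UNIV g" for g :: "real^2 \<Rightarrow> real"
  proof -
    let ?g = "\<lambda>x. complex_of_real (g x)"
    have gL: "?g \<in> L2" by (intro continuous_L2 continuous_intros g)
    have one: "(\<lambda>x. 1) \<in> L2" by (intro continuous_L2 continuous_intros)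
    have "cmod (L2_inner f ?g) \<le> \<epsilon> * (L2_norm f * L2_norm (\<lambda>x. 1))" if \<epsilon>: "\<epsilon> > 0" for \<epsilon>
    proof -
      obtain p where p: "real_polynomial_function p" "\<And>x. x \<in> cball 0 1 \<Longrightarrow> \<bar>g x - p x\<bar> < \<epsilon>"
        using Stone_Weierstrass_real_polynomial_function[of "cball (0::real^2) 1" g \<epsilon>] \<epsilon> continuous_on_subset[OF g] by auto
      let ?p = "\<lambda>x. complex_of_real (p x)"
      note zp = real_polynomial_function_zpoly[OF p(1)]
      have pL: "?p \<in> L2" by (intro continuous_L2 continuous_on_zpoly zp)
      have "L2_inner f ?g = L2_inner f (\<lambda>x. ?g x - ?p x)"
        using perp[OF zp] by (simp add: L2_inner_diff_right[OF gL pL f])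
      then have "cmod (L2_inner f ?g) \<le> L2_norm f * L2_norm (\<lambda>x. ?g x - ?p x)"
        using L2_Cauchy_Schwarz[OF f L2_diff[OF gL pL]] by simp
      also have "\<dots> \<le> L2_norm f * (\<epsilon> * L2_norm (\<lambda>x. 1))"
      proof (rule mult_left_mono, rule power2_le_imp_le)
        have "(L2_norm (\<lambda>x. ?g x - ?p x))\<^sup>2 \<le> (LINT x|disk. \<epsilon>\<^sup>2 * (cmod 1)\<^sup>2)"
          unfolding L2_norm_sq
        proof (rule integral_mono_AE)
          show "integrable disk (\<lambda>x. (cmod (?g x - ?p x))\<^sup>2)" by (rule L2_integrable[OF L2_diff[OF gL pL]])
          have "(cmod (?g x - ?p x))\<^sup>2 \<le> \<epsilon>\<^sup>2" if "x \<in> ball 0 1" for x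
          proof -
            have "cmod (?g x - ?p x) = \<bar>g x - p x\<bar>" by (simp flip: of_real_diff)
            also have "\<dots> \<le> \<epsilon>" using p(2)[of x] that by simp
            finally show ?thesis by (intro power_mono) auto
          qed
          then show "AE x in disk. (cmod (?g x - ?p x))\<^sup>2 \<le> \<epsilon>\<^sup>2 * (cmod 1)\<^sup>2" by (intro AE_I2) simp
        qed (rule integrable_mult_right[OF L2_integrable[OF one]])
        also have "\<dots> = \<epsilon>\<^sup>2 * (L2_norm (\<lambda>x. 1))\<^sup>2" unfolding L2_norm_sq by simp
        finally show "(L2_norm (\<lambda>x. ?g x - ?p x))\<^sup>2 \<le> (\<epsilon> * L2_norm (\<lambda>x. 1))\<^sup>2" by (simp add: power_mult_distrib)
      qed (use \<epsilon> in simp_all)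
      finally show ?thesis by (simp add: mult_ac)
    qed
    then have "cmod (L2_inner f ?g) \<le> 0" by (rule nonpos_if_le_epsilon_mult)
    then show ?thesis by simp
  qed
  have int: "integrable disk f"
    using L1_le_L2(1)[OF f] L2_measurable[OF f] by (rule integrable_norm_cancel)
  have gi: "integrable disk (\<lambda>x. f x * complex_of_real (g x))" if "continuous_on UNIV g" for g :: "real^2 \<Rightarrow> real"
    using L2_mult_integrable[OF f, of "\<lambda>x. complex_of_real (g x)"] that by (simp add: continuous_L2 continuous_intros)
  have "AE x in disk. Re (f x) = 0"
  proof (rule AE_zero_if_perp_continuous)
    show "(LINT x|disk. Re (f x) * g x) = 0" if "continuous_on UNIV g" for g
      using Bochner_Integration.integral_Re[OF gi[OF that]] inner0[OF that] by (simp add: L2_inner_def)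
  qed (use int in simp)
  moreover have "AE x in disk. Im (f x) = 0"
  proof (rule AE_zero_if_perp_continuous)
    show "(LINT x|disk. Im (f x) * g x) = 0" if "continuous_on UNIV g" for g
      using Bochner_Integration.integral_Im[OF gi[OF that]] inner0[OF that] by (simp add: L2_inner_def)
  qed (use int in simp)
  ultimately show ?thesis by eventually_elim (simp add: complex_eq_iff)
qed

text \<open>With m = min a b, the monomial z^a cnj(z)^b is |z|^(2m) times a power of z or of its
  conjugate, so real and imaginary parts of z^l times powers of |z|^2 span all polynomials.\<close>

lemma modes_total:
  assumes f: "f \<in> L2" and perp: "\<And>i. i \<in> modes \<Longrightarrow> L2_inner f (eigenfun i) = 0"
  shows "AE x in disk. f x = 0"
proof -
  have raw: "L2_inner f (raw_mode i) = 0" if "i \<in> modes" for i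
    using perp[OF that] mode_mass_pos[of i] unfolding eigenfun_eq[OF that] L2_inner_scale_right by simp
  have R: "L2_inner f (\<lambda>x. complex_of_real (Re (zc x ^ l) * ((norm x)\<^sup>2) ^ b)) = 0" for l b
  proof (rule perp_radial_monomial[OF f])
    show "continuous_on UNIV (\<lambda>x. Re (zc x ^ l))" by (intro continuous_intros)
    show "\<bar>Re (zc x ^ l)\<bar> \<le> norm x ^ l" for x using abs_Re_le_cmod[of "zc x ^ l"] by (simp add: norm_power norm_zc)
    show "L2_inner f (\<lambda>x. complex_of_real (Re (zc x ^ l) * ce l k ((norm x)\<^sup>2))) = 0" if "k \<ge> 1" for k
      using raw[of "Phi l k"] that by (simp add: modes_def raw_mode_def rmode_def[abs_def])
  qed
  have I: "L2_inner f (\<lambda>x. complex_of_real (Im (zc x ^ l) * ((norm x)\<^sup>2) ^ b)) = 0" for l b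
  proof (rule perp_radial_monomial[OF f])
    show "continuous_on UNIV (\<lambda>x. Im (zc x ^ l))" by (intro continuous_intros)
    show "\<bar>Im (zc x ^ l)\<bar> \<le> norm x ^ l" for x using abs_Im_le_cmod[of "zc x ^ l"] by (simp add: norm_power norm_zc)
    show "L2_inner f (\<lambda>x. complex_of_real (Im (zc x ^ l) * ce l k ((norm x)\<^sup>2))) = 0" if "k \<ge> 1" for k
    \<comment> \<open>There is no sine mode of order 0 in \<open>modes\<close>, but Im (z^0) = 0
      settles that case.\<close>
    proof (cases "l = 0")
      case True
      then show ?thesis by (simp add: L2_inner_def)
    next
      case False
      then show ?thesis using raw[of "Psi l k"] that by (simp add: modes_def raw_mode_def imode_def[abs_def])
    qed
  qed
  let ?R = "\<lambda>l b x. complex_of_real (Re (zc x ^ l) * ((norm x)\<^sup>2) ^ b)"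
  let ?I = "\<lambda>l b x. complex_of_real (Im (zc x ^ l) * ((norm x)\<^sup>2) ^ b)"
  have RL: "?R l b \<in> L2" and IL: "?I l b \<in> L2" for l b by (intro continuous_L2 continuous_intros)+
  have sq: "zc x * cnj (zc x) = complex_of_real ((norm x)\<^sup>2)" for x
    by (simp only: complex_norm_square[symmetric] norm_zc)
  have monomial: "L2_inner f (\<lambda>x. zc x ^ a * cnj (zc x) ^ b) = 0" for a b
  proof (cases "b \<le> a")
    case True
    have "zc x ^ a * cnj (zc x) ^ b = ?R (a - b) b x + \<i> * ?I (a - b) b x" for x
    proof -
      have "zc x ^ a * cnj (zc x) ^ b = zc x ^ (a - b) * (zc x * cnj (zc x)) ^ b"
        using True by (simp add: power_mult_distrib power_add[symmetric] mult.assoc[symmetric])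
      also have "\<dots> = (complex_of_real (Re (zc x ^ (a - b))) + \<i> * complex_of_real (Im (zc x ^ (a - b)))) * complex_of_real (((norm x)\<^sup>2) ^ b)"
        unfolding sq complex_eq[symmetric] by simp
      finally show ?thesis by (simp add: algebra_simps)
    qed
    then show ?thesis using R I by (simp add: L2_inner_add_right RL L2_scale[OF IL] f L2_inner_scale_right del: of_real_mult)
  next
    case False
    have "zc x ^ a * cnj (zc x) ^ b = ?R (b - a) a x + (- \<i>) * ?I (b - a) a x" for x
    proof -
      have "zc x ^ a * cnj (zc x) ^ b = cnj (zc x) ^ (b - a) * (zc x * cnj (zc x)) ^ a"
        using False by (simp add: power_mult_distrib power_add[symmetric] mult_ac)
      also have "\<dots> = cnj (complex_of_real (Re (zc x ^ (b - a))) + \<i> * complex_of_real (Im (zc x ^ (b - a)))) * complex_of_real (((norm x)\<^sup>2) ^ a)"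
        unfolding sq complex_eq[symmetric] by simp
      finally show ?thesis by (simp add: algebra_simps)
    qed
    then show ?thesis using R I by (simp add: L2_inner_diff_right RL L2_scale[OF IL] f L2_inner_scale_right del: of_real_mult)
  qed
  have "L2_inner f p = 0" if "zpoly p" for p
    using that
    by (induction rule: zpoly.induct) (simp_all add: monomial L2_inner_add_right f continuous_L2 continuous_on_zpoly L2_inner_scale_right)
  from AE_zero_if_perp_zpoly[OF f this] show ?thesis .
qed

interpretation disk_modes: mode_basis
proof -
  interpret orthonormal_system modes eigenfun by (rule orthonormal_system_modes)
  show "mode_basis"
    by unfold_locales (rule modes_total)
qed

section \<open>The spectrum of \<open>L\<^sub>\<alpha>\<close>\<close>

lemma L_eigenvalue_in_spectrum:
  "k \<ge> 1 \<Longrightarrow> complex_of_real (L_eigenvalue \<alpha> l k) \<in> spectrum (L_op \<alpha>)"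
  using disk_modes.mode_eigenvalue_in_spectrum[of "Phi l k" \<alpha>] by (simp add: modes_def)

text \<open>Order 0 suffices: there \<alpha> drops out and the eigenvalues are the squares of the
  zeros of J_0.\<close>

lemma spectrum_unbounded_above: "\<not> bdd_above {t. complex_of_real t \<in> spectrum (L_op \<alpha>)}"
proof
  assume "bdd_above {t. complex_of_real t \<in> spectrum (L_op \<alpha>)}"
  then obtain M where M: "\<And>t. complex_of_real t \<in> spectrum (L_op \<alpha>) \<Longrightarrow> t \<le> M"
    by (auto simp: bdd_above_def)
  obtain n0 where n0: "\<forall>n\<ge>n0. cz 0 n > M / 4" using cz_unbounded by blast
  let ?n = "max 1 n0"
  have "L_eigenvalue \<alpha> 0 ?n \<le> M" by (intro M L_eigenvalue_in_spectrum) simp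
  moreover have "cz 0 ?n > M / 4" using n0 by simp
  ultimately show False by (simp add: L_eigenvalue_def cz_def)
qed

text \<open>With 1 < a < \<alpha>, a zero of J_n below a n yields an eigenvalue at most -
  (\<alpha>^2 - a^2) n^2.\<close>

lemma spectrum_unbounded_below:
  assumes "\<alpha> > 1"
  shows "\<not> bdd_below {t. complex_of_real t \<in> spectrum (L_op \<alpha>)}"
proof
  assume "bdd_below {t. complex_of_real t \<in> spectrum (L_op \<alpha>)}"
  then obtain M where M: "\<And>t. complex_of_real t \<in> spectrum (L_op \<alpha>) \<Longrightarrow> M \<le> t"
    by (auto simp: bdd_below_def)
  define a where "a = (1 + \<alpha>) / 2"
  have a: "1 < a" "a < \<alpha>" using assms by (auto simp: a_def)
  define d where "d = \<alpha>\<^sup>2 - a\<^sup>2"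
  have d: "d > 0" unfolding d_def using a by (simp add: power_strict_mono)
  obtain N where N: "\<And>n. n \<ge> N \<Longrightarrow> \<exists>x. 0 < x \<and> x \<le> a * real n \<and> bessel n x = 0"
    using bessel_zero_le[OF a(1)] by blast
  obtain n0 :: nat where n0: "real n0 > \<bar>M\<bar> / d" using reals_Archimedean2 by blast
  define n where "n = max (max 1 N) n0"
  have "n \<ge> N" by (simp add: n_def)
  then obtain x where x: "0 < x" "x \<le> a * real n" "bessel n x = 0" using N by blast
  then obtain k where k: "k \<ge> 1" "x = bz n k" using bessel_zero_imp_bz by blast
  have "(bz n k)\<^sup>2 \<le> (a * real n)\<^sup>2" using x k by (intro power_mono) auto
  then have "L_eigenvalue \<alpha> n k \<le> - d * (real n)\<^sup>2"
    by (simp add: L_eigenvalue_def d_def power_mult_distrib algebra_simps)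
  also have "d * (real n)\<^sup>2 > \<bar>M\<bar>"
  proof -
    have "real n0 \<le> real n" "1 \<le> real n" by (simp_all add: n_def)
    then have "real n0 * 1 \<le> real n * real n" by (intro mult_mono) auto
    then have "\<bar>M\<bar> / d < (real n)\<^sup>2" using n0 by (simp add: power2_eq_square)
    then show ?thesis using d by (simp add: field_simps)
  qed
  then have "- d * (real n)\<^sup>2 < M" by linarith
  finally have "L_eigenvalue \<alpha> n k < M" .
  with M[OF L_eigenvalue_in_spectrum[OF k(1), of \<alpha> n]] show False by simp
qed

lemma L_eigenvalue_factor: "L_eigenvalue \<alpha> l k = (bz l k - \<alpha> * real l) * (bz l k + \<alpha> * real l)"
  by (simp add: L_eigenvalue_def power2_eq_square algebra_simps)

text \<open>Large orders use the fixed distance of the zeros from \<alpha> l. For l < N and j > X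
  one has \<alpha> l \<le> j/2, so the eigenvalue is at least 3/4 j^2, hence 3/4 j because X \<ge>
  1. Finitely many nonzero eigenvalues remain. Recording l < N in the zero case bounds the
  multiplicity of the eigenvalue 0.\<close>

lemma L_eigenvalue_gap:
  assumes \<alpha>: "\<alpha> > 1" and m: "lg_zeta 1 \<alpha> = real m * pi"
  obtains c N where "c > 0"
    "\<And>l k. k \<ge> 1 \<Longrightarrow> L_eigenvalue \<alpha> l k = 0 \<and> l < N \<or> \<bar>L_eigenvalue \<alpha> l k\<bar> \<ge> c * bz l k"
proof -
  obtain c0 N where c0: "c0 > 0" and gap: "\<And>n x. n \<ge> N \<Longrightarrow> x > 0 \<Longrightarrow> bessel n x = 0 \<Longrightarrow> \<bar>x - \<alpha> * real n\<bar> \<ge> c0"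
    using bessel_zero_gap[OF \<alpha> m] by blast
  define X where "X = max 1 (2 * \<alpha> * real N)"
  define S where "S = {(l, k). k \<ge> 1 \<and> bz l k \<le> X \<and> L_eigenvalue \<alpha> l k \<noteq> 0}"
  define R where "R = (\<lambda>(l, k). \<bar>L_eigenvalue \<alpha> l k\<bar> / bz l k) ` S"
  have "finite S" by (rule finite_subset[OF _ finite_bz_le[of X]]) (auto simp: S_def)
  then have R: "finite (insert 1 R)" by (simp add: R_def)
  have R_pos: "r > 0" if "r \<in> insert 1 R" for r
    using that bz_pos by (auto simp: R_def S_def)
  \<comment> \<open>One term per regime; the inserted 1 keeps the minimum meaningful when
    \<open>R\<close> is empty.\<close>
  define c where "c = min c0 (min (3/4) (Min (insert 1 R)))"
  have c: "c > 0" "c \<le> c0" "c \<le> 3/4" using c0 R_pos Min_in[OF R] by (auto simp: c_def)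
  have "L_eigenvalue \<alpha> l k = 0 \<and> l < N \<or> \<bar>L_eigenvalue \<alpha> l k\<bar> \<ge> c * bz l k" if k: "k \<ge> 1" for l k
  proof -
    note j = bz_pos[OF k, of l]
    consider "l \<ge> N" | "l < N" "L_eigenvalue \<alpha> l k = 0" | "L_eigenvalue \<alpha> l k \<noteq> 0" "bz l k \<le> X" | "l < N" "bz l k > X"
      by linarith
    then show ?thesis
    proof cases
      case 1
      have "\<bar>L_eigenvalue \<alpha> l k\<bar> = \<bar>bz l k - \<alpha> * real l\<bar> * (bz l k + \<alpha> * real l)"
        unfolding L_eigenvalue_factor abs_mult using j \<alpha> by simp
      also have "\<dots> \<ge> c * bz l k"
        using gap[OF 1 j bessel_bz[OF k]] c j \<alpha> by (intro mult_mono) auto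
      finally show ?thesis by simp
    next
      case 3
      then have "\<bar>L_eigenvalue \<alpha> l k\<bar> / bz l k \<in> insert 1 R" using k by (force simp: R_def S_def)
      then have "Min (insert 1 R) \<le> \<bar>L_eigenvalue \<alpha> l k\<bar> / bz l k" by (rule Min_le[OF R])
      then have "c \<le> \<bar>L_eigenvalue \<alpha> l k\<bar> / bz l k" by (simp add: c_def)
      then show ?thesis using j by (simp add: field_simps)
    next
      case 4
      then have X: "bz l k > 1" "bz l k > 2 * \<alpha> * real N" by (auto simp: X_def)
      have "\<alpha> * real l \<le> \<alpha> * real N" using 4 \<alpha> by (intro mult_left_mono) auto
      then have half: "\<alpha> * real l \<le> bz l k / 2" using X by linarith
      have "0 \<le> \<alpha> * real l" using \<alpha> by simp
      then have "(\<alpha> * real l)\<^sup>2 \<le> (bz l k / 2)\<^sup>2" by (rule power_mono[OF half])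
      then have "L_eigenvalue \<alpha> l k \<ge> 3/4 * (bz l k)\<^sup>2"
        by (simp add: L_eigenvalue_def power_mult_distrib power_divide)
      also have "3/4 * (bz l k)\<^sup>2 \<ge> c * bz l k"
        unfolding power2_eq_square mult.assoc[symmetric] using c X j mult_mono[of c "3/4 * bz l k" "bz l k" "bz l k"] by simp
      finally have "c * bz l k \<le> \<bar>L_eigenvalue \<alpha> l k\<bar>" by linarith
      then show ?thesis by blast
    qed simp
  qed
  with c(1) show ?thesis using that by blast
qed

text \<open>The common root of discreteness and finite multiplicity: a bounded eigenvalue bounds j,
  by \<Lambda> / c through the gap, or by \<alpha> N when the eigenvalue is 0, since then j =
  \<alpha> l.\<close>

lemma finite_bounded_modes:
  assumes \<alpha>: "\<alpha> > 1" and m: "lg_zeta 1 \<alpha> = real m * pi"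
  shows "finite {i \<in> modes. \<bar>mode_eigenvalue \<alpha> i\<bar> \<le> \<Lambda>}"
proof -
  obtain c N where c: "c > 0"
    and gap: "\<And>l k. k \<ge> 1 \<Longrightarrow> L_eigenvalue \<alpha> l k = 0 \<and> l < N \<or> \<bar>L_eigenvalue \<alpha> l k\<bar> \<ge> c * bz l k"
    using L_eigenvalue_gap[OF assms] by blast
  let ?X = "max (\<Lambda> / c) (\<alpha> * real N)"
  have le: "bz l k \<le> ?X" if k: "k \<ge> 1" and L: "\<bar>L_eigenvalue \<alpha> l k\<bar> \<le> \<Lambda>" for l k
  proof -
    note j = bz_pos[OF k, of l]
    consider "L_eigenvalue \<alpha> l k = 0" "l < N" | "\<bar>L_eigenvalue \<alpha> l k\<bar> \<ge> c * bz l k" using gap[OF k] by blast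
    then show ?thesis
    proof cases
      case 1
      have "bz l k + \<alpha> * real l > 0" using j \<alpha> by (simp add: add_pos_nonneg)
      then have "bz l k = \<alpha> * real l" using 1(1) by (simp add: L_eigenvalue_factor)
      also have "\<dots> \<le> \<alpha> * real N" using 1(2) \<alpha> by (intro mult_left_mono) auto
      finally show ?thesis by simp
    next
      case 2
      then have "bz l k \<le> \<Lambda> / c" using L c by (simp add: field_simps)
      then show ?thesis by simp
    qed
  qed
  let ?P = "{(l, k). k \<ge> 1 \<and> bz l k \<le> ?X}"
  have "{i \<in> modes. \<bar>mode_eigenvalue \<alpha> i\<bar> \<le> \<Lambda>} \<subseteq> (\<lambda>(l, k). Phi l k) ` ?P \<union> (\<lambda>(l, k). Psi l k) ` ?P"
    using le by (force simp: modes_def)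
  then show ?thesis using finite_bz_le[of ?X] by (meson finite_UnI finite_imageI finite_subset)
qed

text \<open>Only finitely many modes have eigenvalues within distance 1 of z, so a point that is not
  an eigenvalue has positive distance to all of them and belongs to the resolvent set.\<close>

lemma spectrum_eigenvalues:
  assumes \<alpha>: "\<alpha> > 1" and m: "lg_zeta 1 \<alpha> = real m * pi" and z: "z \<in> spectrum (L_op \<alpha>)"
  shows "\<exists>i\<in>modes. z = complex_of_real (mode_eigenvalue \<alpha> i)"
proof (rule ccontr)
  assume no: "\<not> ?thesis"
  let ?l = "\<lambda>i. complex_of_real (mode_eigenvalue \<alpha> i)"
  define F where "F = {i \<in> modes. \<bar>mode_eigenvalue \<alpha> i\<bar> \<le> cmod z + 1}"
  \<comment> \<open>The element 1 is the distance guaranteed outside \<open>F\<close>, and it keeps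
    the set nonempty.\<close>
  define D where "D = insert 1 ((\<lambda>i. cmod (?l i - z)) ` F)"
  have F: "finite F" unfolding F_def by (rule finite_bounded_modes[OF \<alpha> m])
  then have D: "finite D" "D \<noteq> {}" by (auto simp: D_def)
  have "Min D \<in> D" using D by (rule Min_in)
  then have pos: "Min D > 0" using no by (auto simp: D_def F_def)
  have "Min D \<le> cmod (?l i - z)" if i: "i \<in> modes" for i
  proof (cases "i \<in> F")
    case True
    then show ?thesis using D by (intro Min_le) (auto simp: D_def)
  next
    case False
    then have "cmod z + 1 < cmod (?l i)" using i by (simp add: F_def)
    also have "cmod (?l i) \<le> cmod (?l i - z) + cmod z" using norm_triangle_sub[of "?l i" z] by (simp add: add.commute)
    finally have "1 \<le> cmod (?l i - z)" by simp
    moreover have "Min D \<le> 1" using D by (intro Min_le) (auto simp: D_def)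
    ultimately show ?thesis by simp
  qed
  then have "z \<in> resolvent_set (L_op \<alpha>)" by (rule disk_modes.resolvent_setI[OF pos])
  with z show False by (simp add: spectrum_def)
qed

theorem theorem1p1:
  shows "(\<forall>\<alpha>::real. \<alpha> > 1 \<longrightarrow>
            \<not> bdd_above {t::real. complex_of_real t \<in> spectrum (L_op \<alpha>)} \<and>
            \<not> bdd_below {t::real. complex_of_real t \<in> spectrum (L_op \<alpha>)}) \<and>
         (\<exists>a :: nat \<Rightarrow> real. (\<forall>n. a n > 1) \<and> \<not> bounded (range a) \<and>
            (\<forall>n.
               (\<forall>z \<in> spectrum (L_op (a n)).
                  is_eigenvalue (L_op (a n)) z \<and> finite_multiplicity (L_op (a n)) z) \<and>
               (\<exists>c>0. \<forall>l k. k \<ge> 1 \<longrightarrow>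
                  (Bessel_zero (real l) k)\<^sup>2 - (a n)\<^sup>2 * (real l)\<^sup>2 = 0 \<or>
                  \<bar>(Bessel_zero (real l) k)\<^sup>2 - (a n)\<^sup>2 * (real l)\<^sup>2\<bar> \<ge> c * Bessel_zero (real l) k) \<and>
               (\<nexists>z. z islimpt spectrum (L_op (a n)))))"
proof (intro conjI allI impI)
  fix \<alpha> :: real
  assume "\<alpha> > 1"
  then show "\<not> bdd_below {t. complex_of_real t \<in> spectrum (L_op \<alpha>)}" by (rule spectrum_unbounded_below)
  show "\<not> bdd_above {t. complex_of_real t \<in> spectrum (L_op \<alpha>)}" by (rule spectrum_unbounded_above)
next
  \<comment> \<open>\<open>Suc n\<close> because the multiple 0 would give the excluded value
    1.\<close>
  obtain a where a: "\<And>n. a n > 1" "\<And>n. real (Suc n) * pi \<le> a n" "\<And>n. lg_zeta 1 (a n) = real (Suc n) * pi"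
    using lg_zeta_1_eq_multiple_pi[OF zero_less_Suc] by metis
  have eig: "is_eigenvalue (L_op (a n)) z \<and> finite_multiplicity (L_op (a n)) z" if z: "z \<in> spectrum (L_op (a n))" for n z
  proof
    obtain i where i: "i \<in> modes" "z = complex_of_real (mode_eigenvalue (a n) i)"
      using spectrum_eigenvalues[OF a(1,3) z] by blast
    then show "is_eigenvalue (L_op (a n)) z" using disk_modes.mode_eigenvalue_is_eigenvalue by blast
    have "{j \<in> modes. complex_of_real (mode_eigenvalue (a n) j) = z} \<subseteq> {j \<in> modes. \<bar>mode_eigenvalue (a n) j\<bar> \<le> \<bar>mode_eigenvalue (a n) i\<bar>}"
      using i(2) by auto
    then have "finite {j \<in> modes. complex_of_real (mode_eigenvalue (a n) j) = z}"
      using finite_bounded_modes[OF a(1,3)] by (rule finite_subset)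
    then show "finite_multiplicity (L_op (a n)) z" by (rule disk_modes.finite_multiplicityI)
  qed
  have gap: "\<exists>c>0. \<forall>l k. k \<ge> 1 \<longrightarrow> (bz l k)\<^sup>2 - (a n)\<^sup>2 * (real l)\<^sup>2 = 0 \<or> \<bar>(bz l k)\<^sup>2 - (a n)\<^sup>2 * (real l)\<^sup>2\<bar> \<ge> c * bz l k" for n
    using L_eigenvalue_gap[OF a(1,3), of n] unfolding L_eigenvalue_def by metis
  have limpt: "\<nexists>z. z islimpt spectrum (L_op (a n))" for n
  proof
    assume "\<exists>z. z islimpt spectrum (L_op (a n))"
    then obtain z where "z islimpt spectrum (L_op (a n))" ..
    then have "infinite (spectrum (L_op (a n)) \<inter> ball z 1)"
      by (simp add: islimpt_eq_infinite_ball)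
    moreover have "spectrum (L_op (a n)) \<inter> ball z 1
        \<subseteq> (\<lambda>i. complex_of_real (mode_eigenvalue (a n) i)) ` {i \<in> modes. \<bar>mode_eigenvalue (a n) i\<bar> \<le> cmod z + 1}"
    proof
      fix w assume w: "w \<in> spectrum (L_op (a n)) \<inter> ball z 1"
      then obtain i where i: "i \<in> modes" "w = complex_of_real (mode_eigenvalue (a n) i)"
        using spectrum_eigenvalues[OF a(1,3)] by blast
      have "cmod w \<le> cmod z + 1" using w norm_triangle_sub[of w z] by (simp add: dist_norm norm_minus_commute)
      then show "w \<in> (\<lambda>i. complex_of_real (mode_eigenvalue (a n) i)) ` {i \<in> modes. \<bar>mode_eigenvalue (a n) i\<bar> \<le> cmod z + 1}"
        using i by auto
    qed
    ultimately show False using finite_bounded_modes[OF a(1,3)] finite_subset by blast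
  qed
  have "\<not> bounded (range a)"
  proof
    assume "bounded (range a)"
    then obtain B where B: "\<And>n. \<bar>a n\<bar> \<le> B" by (auto simp: bounded_iff)
    obtain n :: nat where n: "real n > B" using reals_Archimedean2 by blast
    have "real n * 1 \<le> real (Suc n) * pi" using pi_gt3 by (intro mult_mono) auto
    then show False using a(2)[of n] B[of n] n by simp
  qed
  with a(1) eig gap limpt show "\<exists>a :: nat \<Rightarrow> real. (\<forall>n. a n > 1) \<and> \<not> bounded (range a) \<and>
            (\<forall>n.
               (\<forall>z \<in> spectrum (L_op (a n)).
                  is_eigenvalue (L_op (a n)) z \<and> finite_multiplicity (L_op (a n)) z) \<and>
               (\<exists>c>0. \<forall>l k. k \<ge> 1 \<longrightarrow>
                  (Bessel_zero (real l) k)\<^sup>2 - (a n)\<^sup>2 * (real l)\<^sup>2 = 0 \<or>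
                  \<bar>(Bessel_zero (real l) k)\<^sup>2 - (a n)\<^sup>2 * (real l)\<^sup>2\<bar> \<ge> c * Bessel_zero (real l) k) \<and>
               (\<nexists>z. z islimpt spectrum (L_op (a n))))"
    by (intro exI[of _ a]) blast
qed

end
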